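(* Let $N\ge16$ and let $n_0,n_1:\mathbb{R}^2\to\mathbb{R}$ satisfy $$\sum_{|I|\leq N+1}\big\|\langle x\rangle^{|I|+3}\nabla^I n_0\big\|+\sum_{|I|\leq N}\big\|\langle x\rangle^{|I|+3}\nabla^I n_1\big\|<\epsilon\le\epsilon_0$$ with $\epsilon_0>0$ small, and $\int_{\mathbb{R}^2}n_1\,dx\neq0$. Let $\Theta(t,\xi)$ be the phase correction defined in the context. Then for every fixed $\xi\in\mathbb{R}^2$, $$\lim_{t\to+\infty}|\Theta(t,\xi)|=+\infty .$$
   Context: $\|\cdot\|$ is the $L^2(\mathbb{R}^2)$ norm, $\langle a\rangle=\sqrt{1+|a|^2}$, $\widehat f(\xi)=\int_{\mathbb{R}^2}f(x)e^{-ix\cdot\xi}dx$, $t_0=1$. Let $\ell$ solve $(\partial_t^2-\Delta)\ell=0$ on $\mathbb{R}^{1+2}$ with $(\ell,\partial_t\ell)(t_0)=(n_0,n_1)$. Let $\psi:\mathbb{R}^2\to[0,1]$ be a fixed smooth radial function, nonincreasing in $|x|$, with $\psi=1$ for $|x|\le1$ and $\psi=0$ for $|x|\ge2$. With $p=3/4$ put $\widehat{\ell_L}(t,\eta)=\psi(\eta\langle t\rangle^p)\widehat\ell(t,\eta)$ and $$\Theta(t,\xi)=\frac12\langle\xi\rangle^{-1}\int_{t_0}^t\int_{\mathbb{R}^2}\widehat{\ell_L}(s,\eta)\,e^{is\frac{\xi}{\langle\xi\rangle}\cdot\eta}\,d\eta\,ds .$$ *)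

theory Defs
  imports "HOL-Analysis.Analysis"
begin

section \<open>Derivatives and smoothness\<close>

definition pdiff :: "'a::euclidean_space \<Rightarrow> ('a \<Rightarrow> 'b::real_normed_vector) \<Rightarrow> 'a \<Rightarrow> 'b" where
  "pdiff b f x = frechet_derivative f (at x) b"

text \<open>\<open>Ck k f\<close>: \<open>f\<close> is of class \<open>C\<^sup>k\<close> on the whole space.\<close>

primrec Ck :: "nat \<Rightarrow> ('a::euclidean_space \<Rightarrow> 'b::real_normed_vector) \<Rightarrow> bool" where
  "Ck 0 f \<longleftrightarrow> continuous_on UNIV f"
| "Ck (Suc k) f \<longleftrightarrow> (\<forall>x. f differentiable (at x)) \<and> (\<forall>b\<in>Basis. Ck k (pdiff b f))"

definition smooth :: "('a::euclidean_space \<Rightarrow> 'b::real_normed_vector) \<Rightarrow> bool" where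
  "smooth f \<longleftrightarrow> (\<forall>k. Ck k f)"

definition laplacian :: "('a::euclidean_space \<Rightarrow> 'b::real_normed_vector) \<Rightarrow> 'a \<Rightarrow> 'b" where
  "laplacian f x = (\<Sum>b\<in>Basis. pdiff b (pdiff b f) x)"


section \<open>Weighted Sobolev norms of the data\<close>

text \<open>A multi-index on the plane is a pair \<open>I\<close> of naturals, of order \<open>\<bar>I\<bar> = fst I + snd I\<close>.\<close>

definition mi_order :: "nat \<times> nat \<Rightarrow> nat" where
  "mi_order I = fst I + snd I"

definition mi_diff :: "nat \<times> nat \<Rightarrow> (real^2 \<Rightarrow> real) \<Rightarrow> real^2 \<Rightarrow> real" where
  "mi_diff I f = (pdiff (axis 1 1) ^^ fst I) ((pdiff (axis 2 1) ^^ snd I) f)"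

definition loc_integrable :: "(real^2 \<Rightarrow> real) \<Rightarrow> bool" where
  "loc_integrable f \<longleftrightarrow> (\<forall>K. compact K \<longrightarrow> set_integrable lebesgue K f)"

definition test_function :: "(real^2 \<Rightarrow> real) \<Rightarrow> bool" where
  "test_function \<phi> \<longleftrightarrow> smooth \<phi> \<and> compact (closure {x. \<phi> x \<noteq> 0})"

definition has_weak_diff :: "nat \<times> nat \<Rightarrow> (real^2 \<Rightarrow> real) \<Rightarrow> (real^2 \<Rightarrow> real) \<Rightarrow> bool" where
  "has_weak_diff I f g \<longleftrightarrow> loc_integrable f \<and> loc_integrable g \<and>
     (\<forall>\<phi>. test_function \<phi> \<longrightarrow>
        (LINT x|lebesgue. f x * mi_diff I \<phi> x) =
        (-1) ^ mi_order I * (LINT x|lebesgue. g x * \<phi> x))"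

text \<open>The weak derivative is only determined up to a null set; \<open>weak_diff\<close> picks a representative.\<close>

definition weak_diff :: "nat \<times> nat \<Rightarrow> (real^2 \<Rightarrow> real) \<Rightarrow> real^2 \<Rightarrow> real" where
  "weak_diff I f = (SOME g. has_weak_diff I f g)"

definition jbracket :: "'a::real_normed_vector \<Rightarrow> real" where
  "jbracket a = sqrt (1 + (norm a)\<^sup>2)"

definition square_integrable :: "(real^2 \<Rightarrow> real) \<Rightarrow> bool" where
  "square_integrable f \<longleftrightarrow>
     f \<in> borel_measurable lebesgue \<and> integrable lebesgue (\<lambda>x. (f x)\<^sup>2)"

text \<open>Meaningful only for \<open>square_integrable\<close> functions: a divergent Bochner integral has value 0.\<close>

definition L2_norm :: "(real^2 \<Rightarrow> real) \<Rightarrow> real" where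
  "L2_norm f = sqrt (LINT x|lebesgue. (f x)\<^sup>2)"

definition weighted_diff :: "nat \<times> nat \<Rightarrow> (real^2 \<Rightarrow> real) \<Rightarrow> real^2 \<Rightarrow> real" where
  "weighted_diff I f x = jbracket x ^ (mi_order I + 3) * weak_diff I f x"

text \<open>\<open>in_wsobolev m f\<close> says that the sum defining \<open>wsobolev_norm m f\<close> is finite. It has to be
  assumed separately because of the convention for divergent integrals.\<close>

definition in_wsobolev :: "nat \<Rightarrow> (real^2 \<Rightarrow> real) \<Rightarrow> bool" where
  "in_wsobolev m f \<longleftrightarrow>
     (\<forall>I. mi_order I \<le> m \<longrightarrow>
        (\<exists>g. has_weak_diff I f g) \<and> square_integrable (weighted_diff I f))"

definition wsobolev_norm :: "nat \<Rightarrow> (real^2 \<Rightarrow> real) \<Rightarrow> real" where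
  "wsobolev_norm m f = (\<Sum>I\<in>{I. mi_order I \<le> m}. L2_norm (weighted_diff I f))"

text \<open>The index set is finite, so the sum is a genuine one.\<close>

lemma finite_mi_order: "finite {I. mi_order I \<le> m}"
  by (rule finite_subset[of _ "{..m} \<times> {..m}"]) (auto simp: mi_order_def)


section \<open>The wave equation\<close>

definition dt :: "(real \<Rightarrow> real^2 \<Rightarrow> real) \<Rightarrow> real \<Rightarrow> real^2 \<Rightarrow> real" where
  "dt l t x = deriv (\<lambda>s. l s x) t"

text \<open>Classical solutions on the whole space-time. No growth condition is needed for
  uniqueness, by finite speed of propagation.\<close>

definition wave_solution :: "(real \<Rightarrow> real^2 \<Rightarrow> real) \<Rightarrow> bool" where
  "wave_solution l \<longleftrightarrow>
     Ck 2 (\<lambda>(t, x). l t x) \<and> (\<forall>t x. dt (dt l) t x - laplacian (l t) x = 0)"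

definition t0 :: real where
  "t0 = 1"

text \<open>Sobolev data are functions up to null sets, so the data are attained almost everywhere, that
  is, everywhere by the continuous representatives.\<close>

definition has_data ::
  "(real \<Rightarrow> real^2 \<Rightarrow> real) \<Rightarrow> (real^2 \<Rightarrow> real) \<Rightarrow> (real^2 \<Rightarrow> real) \<Rightarrow> bool" where
  "has_data l n0 n1 \<longleftrightarrow> (AE x in lebesgue. l t0 x = n0 x \<and> dt l t0 x = n1 x)"


section \<open>The phase correction\<close>

definition fourier :: "(real^2 \<Rightarrow> real) \<Rightarrow> real^2 \<Rightarrow> complex" where
  "fourier f \<xi> = (LINT x|lebesgue. complex_of_real (f x) * exp (- (\<i> * complex_of_real (x \<bullet> \<xi>))))"

definition radial_cutoff :: "(real^2 \<Rightarrow> real) \<Rightarrow> bool" where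
  "radial_cutoff \<psi> \<longleftrightarrow>
     smooth \<psi> \<and> (\<forall>x. 0 \<le> \<psi> x \<and> \<psi> x \<le> 1) \<and>
     (\<forall>x y. norm x = norm y \<longrightarrow> \<psi> x = \<psi> y) \<and>
     (\<forall>x y. norm x \<le> norm y \<longrightarrow> \<psi> y \<le> \<psi> x) \<and>
     (\<forall>x. norm x \<le> 1 \<longrightarrow> \<psi> x = 1) \<and> (\<forall>x. norm x \<ge> 2 \<longrightarrow> \<psi> x = 0)"

definition low_freq_fourier ::
  "(real^2 \<Rightarrow> real) \<Rightarrow> (real \<Rightarrow> real^2 \<Rightarrow> real) \<Rightarrow> real \<Rightarrow> real^2 \<Rightarrow> complex" where
  "low_freq_fourier \<psi> l t \<eta> =
     complex_of_real (\<psi> ((jbracket t powr (3/4)) *\<^sub>R \<eta>)) * fourier (l t) \<eta>"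

definition phase_correction ::
  "(real^2 \<Rightarrow> real) \<Rightarrow> (real \<Rightarrow> real^2 \<Rightarrow> real) \<Rightarrow> real \<Rightarrow> real^2 \<Rightarrow> complex" where
  "phase_correction \<psi> l t \<xi> =
     complex_of_real (1 / 2 * inverse (jbracket \<xi>)) *
     (LINT s=ereal t0..ereal t|lebesgue.
        (LINT \<eta>|lebesgue. low_freq_fourier \<psi> l s \<eta> *
           exp (\<i> * complex_of_real (s * ((\<xi> /\<^sub>R jbracket \<xi>) \<bullet> \<eta>)))))"

end

(*
  Write u0, u1 for the data of l at time 1 and m for the integral of u1. On the Fourier side
    l^(s, eta) = cos((s - 1)|eta|) u0^(eta) + sin((s - 1)|eta|)/|eta| u1^(eta),
  and the cutoff restricts eta to a ball of area O(s^(-3/2)). Since u0^ is bounded and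
  u1^(eta) - m = O(|eta|), replacing u0^ by 0 and u1^ by m changes the eta-integral by O(s^(-3/2)),
  which is integrable in s. With v = xi/<xi>, |v| < 1, what remains is m times an average over rays
  of (1/2) int_0^oo phi(r) (sin(a_+ r) + sin(a_- r)) dr with a_+- = (s - 1)|z| +- s v.z comparable
  to s; each of these integrals is (1/a)(1 + o(1)), so the real part of the remaining term, divided
  by m, is at least c/s and the phase correction grows at least like log t.

  The formula for l^ needs l(s) to be integrable. This follows from a weighted energy estimate for
  l and its primitives in time of the gradient, which uses no derivatives of the data; the data
  themselves are recovered from their weak derivatives of order zero.
*)
theory Submission
  imports Defs "HOL-Analysis.Analysis"
begin

section \<open>Products and affine substitutions of smooth functions\<close>

text \<open>The exponent p = 3/4 meets two opposite demands. The discarded part of the frequency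
  integral is bounded by the area of the cutoff ball, s^(-2p), integrable for p > 1/2. On a ray the
  frequency a is of order s while the cutoff varies at rate b of order s^p, so the oscillatory
  integral has relative error b / a = s^(p - 1), which vanishes for p < 1. That a is of order s
  rests on |v| < 1: the group velocity of the massive field stays strictly below the speed of the
  waves. The usual energy controls derivatives of l, whereas integrability needs a weighted L^2
  bound for l itself. With P the time primitive of the gradient, the equation becomes l_t = u1 + div
  P, P_t = grad l with P = 0 initially, and the energy l^2 + |P|^2 sits at the right level. The
  weighted bounds concern a chosen weak derivative, tied to the data only through test functions.
  The smooth compactly supported function at hand is the cutoff \<open>\<psi>\<close> itself; all
  test functions are built from it.\<close>

lemma pdiff_eqI:
  assumes "(f has_derivative D) (at x)"
  shows "pdiff b f x = D b"
  using frechet_derivative_at[OF assms] by (simp add: pdiff_def)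

lemma has_derivative_frechet:
  assumes "f differentiable (at x)"
  shows "(f has_derivative (\<lambda>h. frechet_derivative f (at x) h)) (at x)"
  using assms frechet_derivative_works by metis

lemma pdiff_linear_sum:
  fixes f :: "'a::euclidean_space \<Rightarrow> 'b::real_normed_vector"
  assumes "f differentiable (at x)"
  shows "frechet_derivative f (at x) h = (\<Sum>b\<in>Basis. (h \<bullet> b) *\<^sub>R pdiff b f x)"
proof -
  interpret D: bounded_linear "frechet_derivative f (at x)"
    using assms has_derivative_bounded_linear has_derivative_frechet by blast
  have "frechet_derivative f (at x) h = frechet_derivative f (at x) (\<Sum>b\<in>Basis. (h \<bullet> b) *\<^sub>R b)"
    by (simp add: euclidean_representation)
  also have "\<dots> = (\<Sum>b\<in>Basis. (h \<bullet> b) *\<^sub>R pdiff b f x)"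
    by (simp add: D.sum D.scaleR pdiff_def)
  finally show ?thesis .
qed

text \<open>The definition asks for differentiability but not for continuity at positive order; at
  the bottom of the induction differentiability supplies it.\<close>

lemma Ck_Suc_imp: "Ck (Suc k) f \<Longrightarrow> Ck k f"
proof (induction k arbitrary: f)
  case 0
  then show ?case
    by (auto simp: continuous_on_eq_continuous_at intro: differentiable_imp_continuous_within)
next
  case (Suc k)
  then show ?case by (metis Ck.simps(2))
qed

lemma Ck_continuous: "Ck k f \<Longrightarrow> continuous_on UNIV f"
  by (induction k) (auto dest: Ck_Suc_imp simp del: Ck.simps(2))

lemma Ck_const: "Ck k (\<lambda>_. c)"
proof (induction k arbitrary: c)
  case (Suc k)
  have "pdiff b (\<lambda>_. c) = (\<lambda>_. 0)" for b :: 'a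
    by (rule ext, rule pdiff_eqI) auto
  with Suc show ?case by simp
qed auto

lemma Ck_add: "Ck k f \<Longrightarrow> Ck k g \<Longrightarrow> Ck k (\<lambda>x. f x + g x)"
proof (induction k arbitrary: f g)
  case (Suc k)
  have "pdiff b (\<lambda>x. f x + g x) = (\<lambda>x. pdiff b f x + pdiff b g x)" for b
    using Suc.prems
    by (intro ext, subst pdiff_eqI[OF has_derivative_add[OF has_derivative_frechet has_derivative_frechet]])
       (auto simp: pdiff_def)
  with Suc show ?case by auto
qed (auto intro: continuous_intros)

lemma Ck_sum: "finite A \<Longrightarrow> (\<And>i. i \<in> A \<Longrightarrow> Ck k (f i)) \<Longrightarrow> Ck k (\<lambda>x. \<Sum>i\<in>A. f i x)"
  by (induction A rule: finite_induct) (auto intro: Ck_const Ck_add)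

lemma Ck_mult:
  fixes f g :: "'a::euclidean_space \<Rightarrow> real"
  shows "Ck k f \<Longrightarrow> Ck k g \<Longrightarrow> Ck k (\<lambda>x. f x * g x)"
proof (induction k arbitrary: f g)
  case (Suc k)
  have "pdiff b (\<lambda>x. f x * g x) = (\<lambda>x. f x * pdiff b g x + pdiff b f x * g x)" for b
    using Suc.prems
    by (intro ext, subst pdiff_eqI[OF has_derivative_mult[OF has_derivative_frechet has_derivative_frechet]])
       (auto simp: pdiff_def)
  moreover have "Ck k (\<lambda>x. f x * pdiff b g x + pdiff b f x * g x)" if "b \<in> Basis" for b
    using Suc.prems that Ck_Suc_imp[of k f] Ck_Suc_imp[of k g] by (intro Ck_add Suc.IH) auto
  ultimately show ?case using Suc.prems by auto
qed (auto intro: continuous_intros)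

text \<open>By the chain rule a partial derivative of the composite is a fixed linear combination of
  partial derivatives of \<open>f\<close> composed with the same affine map, so the induction
  closes.\<close>

lemma Ck_affine:
  fixes f :: "'a::euclidean_space \<Rightarrow> real" and A :: "'c::euclidean_space \<Rightarrow> 'a"
  assumes A: "bounded_linear A"
  shows "Ck k f \<Longrightarrow> Ck k (\<lambda>x. f (A x + c))"
proof (induction k arbitrary: f)
  case 0
  have "continuous_on UNIV (\<lambda>x. A x + c)"
    by (intro continuous_intros linear_continuous_on A)
  from continuous_on_compose2[OF _ this, of UNIV f] 0 show ?case by simp
next
  case (Suc k)
  have D: "((\<lambda>x. f (A x + c)) has_derivative (\<lambda>h. frechet_derivative f (at (A x + c)) (A h))) (at x)" for x
  proof (rule has_derivative_compose[of "\<lambda>x. A x + c" A x UNIV f, simplified])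
    show "((\<lambda>x. A x + c) has_derivative A) (at x)"
      using A by (auto intro!: derivative_eq_intros bounded_linear_imp_has_derivative)
    show "(f has_derivative frechet_derivative f (at (A x + c))) (at (A x + c))"
      using Suc.prems has_derivative_frechet by auto
  qed
  have "pdiff b (\<lambda>x. f (A x + c)) = (\<lambda>x. \<Sum>i\<in>Basis. (A b \<bullet> i) * pdiff i f (A x + c))" for b
    using Suc.prems by (intro ext) (simp add: pdiff_eqI[OF D] pdiff_linear_sum)
  moreover have "Ck k (\<lambda>x. \<Sum>i\<in>Basis. (A b \<bullet> i) * pdiff i f (A x + c))" for b
    using Suc by (intro Ck_sum Ck_mult Ck_const) auto
  ultimately show ?case using D by (auto simp: differentiable_def)
qed

lemma smooth_const: "smooth (\<lambda>_. c)"
  by (simp add: smooth_def Ck_const)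

lemma smooth_mult:
  fixes f g :: "'a::euclidean_space \<Rightarrow> real"
  shows "smooth f \<Longrightarrow> smooth g \<Longrightarrow> smooth (\<lambda>x. f x * g x)"
  by (simp add: smooth_def Ck_mult)

lemma smooth_prod:
  fixes f :: "'i \<Rightarrow> 'a::euclidean_space \<Rightarrow> real"
  assumes "finite A" "\<And>i. i \<in> A \<Longrightarrow> smooth (f i)"
  shows "smooth (\<lambda>x. \<Prod>i\<in>A. f i x)"
  using assms by (induction A rule: finite_induct) (auto intro: smooth_mult smooth_const)

lemma smooth_power:
  fixes f :: "'a::euclidean_space \<Rightarrow> real"
  shows "smooth f \<Longrightarrow> smooth (\<lambda>x. f x ^ k)"
  by (induction k) (auto intro: smooth_mult smooth_const)

lemma smooth_affine:
  fixes f :: "'a::euclidean_space \<Rightarrow> real" and A :: "'c::euclidean_space \<Rightarrow> 'a"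
  shows "smooth f \<Longrightarrow> bounded_linear A \<Longrightarrow> smooth (\<lambda>x. f (A x + c))"
  by (simp add: smooth_def Ck_affine)

section \<open>The fundamental lemma of the calculus of variations\<close>

lemma smooth_continuous: "smooth f \<Longrightarrow> continuous_on UNIV f"
  using Ck_continuous[of 0 f] by (simp add: smooth_def)

lemma radial_cutoffD:
  assumes "radial_cutoff \<psi>"
  shows "smooth \<psi>" "0 \<le> \<psi> x" "\<psi> x \<le> 1" "norm x \<le> norm y \<Longrightarrow> \<psi> y \<le> \<psi> x"
    "norm x \<le> 1 \<Longrightarrow> \<psi> x = 1" "norm x \<ge> 2 \<Longrightarrow> \<psi> x = 0"
  using assms unfolding radial_cutoff_def by blast+

text \<open>Monotonicity makes the set where the cutoff equals 1 a ball, and continuity makes it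
  closed. The exact radius matters because powers of \<open>\<psi>\<close> converge to the indicator
  of exactly this set.\<close>

lemma radial_cutoff_level:
  assumes "radial_cutoff \<psi>"
  obtains r where "r \<ge> 1" "\<And>y. \<psi> y = 1 \<longleftrightarrow> norm y \<le> r"
proof -
  define S where "S = {y. \<psi> y = 1}"
  have cont: "continuous_on UNIV \<psi>"
    by (intro smooth_continuous radial_cutoffD(1) assms)
  have sub: "S \<subseteq> cball 0 2"
  proof
    fix y assume "y \<in> S"
    then show "y \<in> cball 0 2" using radial_cutoffD(6)[OF assms, of y]
      by (cases "norm y \<ge> 2") (auto simp: S_def)
  qed
  have "closed S" unfolding S_def
    using continuous_closed_preimage_constant[OF cont closed_UNIV, of 1] by simp
  then have comp: "compact S" using sub
    by (meson bounded_cball bounded_subset compact_eq_bounded_closed)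
  have ax: "axis 1 1 \<in> S" by (simp add: S_def radial_cutoffD(5)[OF assms])
  then obtain z where z: "z \<in> S" "\<And>y. y \<in> S \<Longrightarrow> norm y \<le> norm z"
    using continuous_attains_sup[OF comp _ continuous_on_norm_id] by auto
  show ?thesis
  proof (rule that[of "norm z"])
    show "1 \<le> norm z" using z(2)[OF ax] by simp
    fix y
    have "\<psi> y = 1" if "norm y \<le> norm z"
      using radial_cutoffD(3,4)[OF assms] that z(1) unfolding S_def
      by (metis mem_Collect_eq order_antisym)
    then show "\<psi> y = 1 \<longleftrightarrow> norm y \<le> norm z" using z(2) by (auto simp: S_def)
  qed
qed

text \<open>\<open>One\<close> abbreviates the sum of the basis, so this is what lets the simplifier
  evaluate the corners of cubes coordinatewise.\<close>

lemma sum_Basis_component [simp]: "(\<Sum>b\<in>Basis. (b :: real^'n) $ i) = 1"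
proof -
  have ax: "axis i (1::real) \<in> (Basis :: (real^'n) set)" by (simp add: axis_in_Basis_iff)
  have "(\<Sum>b\<in>Basis. (b :: real^'n) $ i) = (\<Sum>b\<in>(Basis :: (real^'n) set). if axis i 1 = b then 1 else 0)"
  proof (rule sum.cong[OF refl])
    fix b :: "real^'n"
    assume "b \<in> Basis"
    from inner_Basis[OF ax this] show "b $ i = (if axis i 1 = b then 1 else 0)"
      by (metis cart_eq_inner_axis inner_commute)
  qed
  also have "\<dots> = 1" using ax by (subst sum.delta') auto
  finally show ?thesis .
qed

text \<open>The cutoff along a fixed axis serves as a one-dimensional bump in each coordinate. The
  product has cubical level sets at height 1, the shape required by the differentiation theorem, and
  the power \<open>k\<close> sharpens the bump to an indicator in the limit.\<close>

definition cube_bump :: "(real^2 \<Rightarrow> real) \<Rightarrow> real^2 \<Rightarrow> real \<Rightarrow> nat \<Rightarrow> real^2 \<Rightarrow> real" where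
  "cube_bump \<psi> c e k x = (\<Prod>i\<in>UNIV. \<psi> (((x $ i - c $ i) / e) *\<^sub>R axis 1 1) ^ k)"

lemma cube_bump_bounds:
  assumes "radial_cutoff \<psi>"
  shows "0 \<le> cube_bump \<psi> c e k x" "cube_bump \<psi> c e k x \<le> 1"
proof -
  have "0 \<le> \<psi> y" "\<psi> y \<le> 1" for y using radial_cutoffD(2,3)[OF assms] by auto
  then show "0 \<le> cube_bump \<psi> c e k x" "cube_bump \<psi> c e k x \<le> 1"
    unfolding cube_bump_def by (auto intro!: prod_nonneg prod_le_1 power_le_one)
qed

text \<open>The exponent is a successor because the zeroth power would be 1 everywhere, without
  compact support.\<close>

lemma cube_bump_support:
  assumes "radial_cutoff \<psi>" "e > 0" "x \<notin> cbox (c - (2 * e) *\<^sub>R One) (c + (2 * e) *\<^sub>R One)"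
  shows "cube_bump \<psi> c e (Suc k) x = 0"
proof -
  from assms(3) obtain i where i: "\<not> (c $ i - 2 * e \<le> x $ i \<and> x $ i \<le> c $ i + 2 * e)"
    by (auto simp: mem_box_cart)
  then have "\<bar>x $ i - c $ i\<bar> \<ge> 2 * e" by linarith
  then have "\<psi> (((x $ i - c $ i) / e) *\<^sub>R axis 1 1) = 0"
    using assms(2) by (intro radial_cutoffD(6)[OF assms(1)]) (auto simp: field_simps)
  then show ?thesis unfolding cube_bump_def by (intro prod_zero) (auto intro!: bexI[of _ i])
qed

lemma test_function_cube_bump:
  assumes "radial_cutoff \<psi>" "e > 0"
  shows "test_function (cube_bump \<psi> c e (Suc k))"
  unfolding test_function_def
proof
  have sm: "smooth \<psi>" by (rule radial_cutoffD(1)[OF assms(1)])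
  have "smooth (\<lambda>x. \<psi> (((x $ i - c $ i) / e) *\<^sub>R axis 1 1))" for i
  proof -
    have "bounded_linear (\<lambda>x::real^2. (x $ i / e) *\<^sub>R (axis 1 1 :: real^2))"
      using bounded_linear_scaleR_const[OF bounded_linear_mult_const[OF bounded_linear_vec_nth[of i]], of "1 / e" "axis 1 1"]
      by simp
    from smooth_affine[OF sm this, of "- (c $ i / e) *\<^sub>R axis 1 1"] show ?thesis
      by (simp add: diff_divide_distrib algebra_simps)
  qed
  then show "smooth (cube_bump \<psi> c e (Suc k))"
    unfolding cube_bump_def by (intro smooth_prod smooth_power) auto
  have "{x. cube_bump \<psi> c e (Suc k) x \<noteq> 0} \<subseteq> cbox (c - (2 * e) *\<^sub>R One) (c + (2 * e) *\<^sub>R One)"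
    using cube_bump_support[OF assms] by blast
  then show "compact (closure {x. cube_bump \<psi> c e (Suc k) x \<noteq> 0})"
    by (meson bounded_cbox bounded_subset compact_closure)
qed

text \<open>Each factor lies between 0 and 1, so its powers tend to 1 where it equals 1 and to 0
  elsewhere; the first happens for all factors exactly on a cube of half-side
  \<open>e * r\<close>.\<close>

lemma cube_bump_tendsto:
  assumes "radial_cutoff \<psi>" "e > 0" "\<And>y. \<psi> y = 1 \<longleftrightarrow> norm y \<le> r"
  shows "(\<lambda>k. cube_bump \<psi> c e (Suc k) x) \<longlonglongrightarrow> indicator (cbox (c - (e * r) *\<^sub>R One) (c + (e * r) *\<^sub>R One)) x"
proof -
  define a where "a i = \<psi> (((x $ i - c $ i) / e) *\<^sub>R axis 1 1)" for i
  have a01: "0 \<le> a i" "a i \<le> 1" for i using radial_cutoffD(2,3)[OF assms(1)] by (auto simp: a_def)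
  have "(\<lambda>k. a i ^ Suc k) \<longlonglongrightarrow> (if a i = 1 then 1 else 0)" for i
    using a01[of i] by (auto intro!: LIMSEQ_Suc LIMSEQ_power_zero simp del: power_Suc)
  then have "(\<lambda>k. \<Prod>i\<in>UNIV. a i ^ Suc k) \<longlonglongrightarrow> (\<Prod>i\<in>UNIV. (if a i = 1 then 1 else 0))"
    by (intro tendsto_prod) auto
  moreover have "(\<Prod>i\<in>UNIV. (if a i = 1 then 1 else 0)) =
      (indicator (cbox (c - (e * r) *\<^sub>R One) (c + (e * r) *\<^sub>R One)) x :: real)"
  proof -
    have "a i = 1 \<longleftrightarrow> c $ i - e * r \<le> x $ i \<and> x $ i \<le> c $ i + e * r" for i
      using assms(2) by (auto simp: a_def assms(3) field_simps abs_le_iff)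
    then have "x \<in> cbox (c - (e * r) *\<^sub>R One) (c + (e * r) *\<^sub>R One) \<longleftrightarrow> (\<forall>i. a i = 1)"
      by (auto simp: mem_box_cart)
    then show ?thesis by (auto simp: indicator_def)
  qed
  ultimately show ?thesis by (simp add: cube_bump_def a_def)
qed

lemma loc_integrable_cbox_indicator:
  assumes "loc_integrable h"
  shows "integrable lebesgue (\<lambda>x. h x * indicator (cbox a b) x)"
  using assms[unfolded loc_integrable_def, rule_format, OF compact_cbox[of a b]]
  by (simp add: set_integrable_def mult.commute)

lemma continuous_lebesgue_measurable:
  "continuous_on UNIV f \<Longrightarrow> f \<in> borel_measurable lebesgue"
  by (intro measurable_completion) (simp add: borel_measurable_continuous_onI)

lemma loc_integrable_mult_test:
  assumes "loc_integrable h" "test_function \<phi>"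
  shows "integrable lebesgue (\<lambda>x. h x * \<phi> x)"
proof -
  have cont: "continuous_on UNIV \<phi>"
    using assms(2) by (intro smooth_continuous) (simp add: test_function_def)
  obtain a b where ab: "{x. \<phi> x \<noteq> 0} \<subseteq> cbox a b"
    by (metis assms(2) bounded_subset_cbox_symmetric bounded_subset closure_subset compact_imp_bounded test_function_def)
  obtain B where B: "\<And>x. x \<in> cbox a b \<Longrightarrow> norm (\<phi> x) \<le> B"
    using compact_continuous_image[OF continuous_on_subset[OF cont] compact_cbox[of a b]]
    by (fastforce dest!: compact_imp_bounded simp: bounded_iff)
  note int = loc_integrable_cbox_indicator[OF assms(1), of a b]
  have m\<phi>: "\<phi> \<in> borel_measurable lebesgue"
    by (rule continuous_lebesgue_measurable[OF cont])
  have eq: "h x * \<phi> x = (h x * indicator (cbox a b) x) * \<phi> x" for x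
    using ab by (cases "\<phi> x = 0") (auto simp: indicator_def)
  show ?thesis
  proof (rule Bochner_Integration.integrable_bound[OF integrable_mult_right[OF int, of "\<bar>B\<bar>"]])
    show "(\<lambda>x. h x * \<phi> x) \<in> borel_measurable lebesgue"
      unfolding eq using int m\<phi> by measurable
    show "AE x in lebesgue. norm (h x * \<phi> x) \<le> norm (\<bar>B\<bar> * (h x * indicator (cbox a b) x))"
    proof (rule AE_I2)
      fix x
      show "norm (h x * \<phi> x) \<le> norm (\<bar>B\<bar> * (h x * indicator (cbox a b) x))"
        using B[of x] ab by (cases "\<phi> x = 0")
          (auto simp: indicator_def abs_mult mult.commute intro!: mult_right_mono)
    qed
  qed
qed

text \<open>Dominated convergence along the powers of a bump carries the vanishing against test
  functions over to the indicator of a cube.\<close>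

lemma loc_integrable_cube_integral_zero:
  assumes \<psi>: "radial_cutoff \<psi>" and h: "loc_integrable h"
    and 0: "\<And>\<phi>. test_function \<phi> \<Longrightarrow> (LINT x|lebesgue. h x * \<phi> x) = 0"
    and e: "d > 0"
  shows "integral (cbox x (x + d *\<^sub>R One)) h = 0"
proof -
  obtain r where r: "r \<ge> 1" "\<And>y. \<psi> y = 1 \<longleftrightarrow> norm y \<le> r"
    using radial_cutoff_level[OF \<psi>] by metis
  \<comment> \<open>The limit cube is centred at \<open>c\<close> with half-side
    \<open>e * r\<close>; this choice makes the half-side \<open>d / 2\<close>.\<close>
  define e where "e = d / (2 * r)"
  define c where "c = x + (d / 2) *\<^sub>R One"
  have epos: "e > 0" using e r by (simp add: e_def)
  have box: "cbox (c - (e * r) *\<^sub>R One) (c + (e * r) *\<^sub>R One) = cbox x (x + d *\<^sub>R One)"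
  proof -
    have "e * r = d / 2" using r by (simp add: e_def)
    then have "c - (e * r) *\<^sub>R One = x" "c + (e * r) *\<^sub>R One = x + d *\<^sub>R One"
      by (simp_all add: c_def vec_eq_iff)
    then show ?thesis by simp
  qed
  define K where "K = cbox (c - (2 * e) *\<^sub>R One) (c + (2 * e) *\<^sub>R One)"
  have int: "integrable lebesgue (\<lambda>x. h x * cube_bump \<psi> c e (Suc k) x)" for k
    by (intro loc_integrable_mult_test h test_function_cube_bump \<psi> epos)
  have intQ: "integrable lebesgue (\<lambda>y. h y * indicator (cbox x (x + d *\<^sub>R One)) y)"
    by (rule loc_integrable_cbox_indicator[OF h])
  have "(\<lambda>k. LINT y|lebesgue. h y * cube_bump \<psi> c e (Suc k) y) \<longlonglongrightarrow>
        (LINT y|lebesgue. h y * indicator (cbox x (x + d *\<^sub>R One)) y)"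
  proof (rule integral_dominated_convergence[where w = "\<lambda>y. \<bar>h y * indicator K y\<bar>"])
    show "integrable lebesgue (\<lambda>y. \<bar>h y * indicator K y\<bar>)"
      unfolding K_def by (intro integrable_abs loc_integrable_cbox_indicator[OF h])
    show "AE y in lebesgue. (\<lambda>k. h y * cube_bump \<psi> c e (Suc k) y) \<longlonglongrightarrow>
            h y * indicator (cbox x (x + d *\<^sub>R One)) y"
      by (intro AE_I2 tendsto_mult tendsto_const cube_bump_tendsto[OF \<psi> epos r(2), of c, unfolded box])
    show "AE y in lebesgue. norm (h y * cube_bump \<psi> c e (Suc k) y) \<le> \<bar>h y * indicator K y\<bar>" for k
    proof (rule AE_I2)
      fix y
      show "norm (h y * cube_bump \<psi> c e (Suc k) y) \<le> \<bar>h y * indicator K y\<bar>"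
        using cube_bump_support[OF \<psi> epos, of y c k] cube_bump_bounds[OF \<psi>, of c e "Suc k" y]
        by (cases "y \<in> K") (auto simp: K_def abs_mult mult_left_le)
    qed
  qed (use int intQ in auto)
  then have "(LINT y|lebesgue. h y * indicator (cbox x (x + d *\<^sub>R One)) y) = 0"
    using 0[OF test_function_cube_bump[OF \<psi> epos]] by (simp add: LIMSEQ_const_iff)
  then have "set_lebesgue_integral lebesgue (cbox x (x + d *\<^sub>R One)) h = 0"
    by (simp add: set_lebesgue_integral_def mult.commute)
  moreover have "set_integrable lebesgue (cbox x (x + d *\<^sub>R One)) h"
    using h by (simp add: loc_integrable_def)
  ultimately show ?thesis using set_lebesgue_integral_eq_integral(2) by metis
qed

text \<open>Lebesgue differentiation over cubes with a corner at \<open>x\<close>: all averages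
  vanish, hence so does almost every value.\<close>

lemma loc_integrable_test_zero_imp_AE_zero:
  assumes \<psi>: "radial_cutoff \<psi>" and h: "loc_integrable h"
    and 0: "\<And>\<phi>. test_function \<phi> \<Longrightarrow> (LINT x|lebesgue. h x * \<phi> x) = 0"
  shows "AE x in lebesgue. h x = 0"
proof -
  have "h integrable_on cbox a b" for a b
    using h compact_cbox[of a b] set_lebesgue_integral_eq_integral(1)[of "cbox a b" h]
    by (simp add: loc_integrable_def)
  then obtain N where N: "negligible N" "\<And>x e. x \<notin> N \<Longrightarrow> 0 < e \<Longrightarrow>
      \<exists>d>0. \<forall>k. 0 < k \<and> k < d \<longrightarrow>
        norm (integral (cbox x (x + k *\<^sub>R One)) h /\<^sub>R k ^ DIM(real^2) - h x) < e"
    using integrable_ccontinuous_explicit[of h] by metis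
  have "h x = 0" if xN: "x \<notin> N" for x
  proof (rule ccontr)
    assume "h x \<noteq> 0"
    \<comment> \<open>With \<open>\<bar>h x\<bar>\<close> itself as tolerance, a vanishing average
      contradicts the strict inequality.\<close>
    then obtain d where d: "d > 0" "\<And>k. 0 < k \<and> k < d \<Longrightarrow>
        norm (integral (cbox x (x + k *\<^sub>R One)) h /\<^sub>R k ^ DIM(real^2) - h x) < \<bar>h x\<bar>"
      using N(2)[OF xN, of "\<bar>h x\<bar>"] by (metis zero_less_abs_iff)
    from d(2)[of "d / 2"] d(1) show False
      using loc_integrable_cube_integral_zero[OF \<psi> h 0, of "d / 2" x] by simp
  qed
  then show ?thesis using N(1)
    by (intro AE_I'[of N]) (auto simp: negligible_iff_null_sets)
qed

text \<open>The weighted norms see only the representative picked by \<open>weak_diff\<close>; this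
  identifies it at order zero with the function itself up to a null set.\<close>

lemma weak_diff_order_zero:
  assumes \<psi>: "radial_cutoff \<psi>" and "has_weak_diff (0, 0) f g"
  shows "AE x in lebesgue. f x = g x"
proof -
  have lf: "loc_integrable f" and lg: "loc_integrable g"
    and eq: "\<And>\<phi>. test_function \<phi> \<Longrightarrow> (LINT x|lebesgue. f x * \<phi> x) = (LINT x|lebesgue. g x * \<phi> x)"
    using assms(2) by (auto simp: has_weak_diff_def mi_order_def mi_diff_def)
  have "loc_integrable (\<lambda>x. f x - g x)"
    using lf lg by (auto simp: loc_integrable_def intro!: set_integral_diff)
  moreover have "(LINT x|lebesgue. (f x - g x) * \<phi> x) = 0" if "test_function \<phi>" for \<phi>
    using loc_integrable_mult_test[OF lf that] loc_integrable_mult_test[OF lg that] eq[OF that]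
    by (simp add: left_diff_distrib)
  ultimately have "AE x in lebesgue. f x - g x = 0"
    by (rule loc_integrable_test_zero_imp_AE_zero[OF \<psi>])
  then show ?thesis by auto
qed

section \<open>Directional derivatives and integration by parts\<close>

text \<open>Only one-dimensional derivatives along \<open>v\<close> are asked for. This notion
  passes through time integrals and compositions without any discussion of Frechet
  derivatives.\<close>

definition has_ddiff :: "'a::real_normed_vector \<Rightarrow> ('a \<Rightarrow> real) \<Rightarrow> ('a \<Rightarrow> real) \<Rightarrow> bool" where
  "has_ddiff v f f' \<longleftrightarrow> (\<forall>z. ((\<lambda>r. f (z + r *\<^sub>R v)) has_real_derivative f' z) (at 0))"

lemma has_ddiffD:
  assumes "has_ddiff v f f'"
  shows "((\<lambda>r. f (z + r *\<^sub>R v)) has_real_derivative f' (z + r *\<^sub>R v)) (at r)"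
proof -
  have "((\<lambda>s. f ((z + r *\<^sub>R v) + s *\<^sub>R v)) has_real_derivative f' (z + r *\<^sub>R v)) (at 0)"
    using assms by (simp add: has_ddiff_def)
  then have "((\<lambda>s. f (z + (s + r) *\<^sub>R v)) has_real_derivative f' (z + r *\<^sub>R v)) (at 0)"
    by (simp add: scaleR_add_left add_ac)
  then show ?thesis by (subst (asm) DERIV_shift[symmetric]) simp
qed

lemma has_ddiff_pdiff:
  assumes "\<And>x. f differentiable (at x)"
  shows "has_ddiff v f (pdiff v f)"
  unfolding has_ddiff_def
proof
  fix z
  have "((\<lambda>r. f (z + r *\<^sub>R v)) has_derivative (\<lambda>r. frechet_derivative f (at z) (r *\<^sub>R v))) (at 0)"
  proof (rule has_derivative_compose[of "\<lambda>r. z + r *\<^sub>R v" _ 0 UNIV f, simplified])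
    show "((\<lambda>r. z + r *\<^sub>R v) has_derivative (\<lambda>r. r *\<^sub>R v)) (at 0)"
      by (auto intro!: derivative_eq_intros)
    show "(f has_derivative frechet_derivative f (at z)) (at z)"
      using assms has_derivative_frechet by auto
  qed
  moreover have "bounded_linear (frechet_derivative f (at z))"
    using assms has_derivative_bounded_linear has_derivative_frechet by blast
  ultimately show "((\<lambda>r. f (z + r *\<^sub>R v)) has_real_derivative pdiff v f z) (at 0)"
    by (simp add: has_field_derivative_def pdiff_def linear_cmul[OF bounded_linear.linear]
        mult_commute_abs)
qed

lemma has_ddiff_mult:
  "has_ddiff v f f' \<Longrightarrow> has_ddiff v g g' \<Longrightarrow> has_ddiff v (\<lambda>x. f x * g x) (\<lambda>x. f' x * g x + f x * g' x)"
  unfolding has_ddiff_def by (auto intro!: derivative_eq_intros)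

lemma has_ddiff_add:
  "has_ddiff v f f' \<Longrightarrow> has_ddiff v g g' \<Longrightarrow> has_ddiff v (\<lambda>x. f x + g x) (\<lambda>x. f' x + g' x)"
  unfolding has_ddiff_def by (auto intro!: derivative_eq_intros)

lemma has_ddiff_cmult:
  "has_ddiff v f f' \<Longrightarrow> has_ddiff v (\<lambda>x. c * f x) (\<lambda>x. c * f' x)"
  unfolding has_ddiff_def by (auto intro!: derivative_eq_intros)

lemma has_ddiff_chain:
  "has_ddiff v f f' \<Longrightarrow> (\<And>x. (g has_real_derivative g' (f x)) (at (f x))) \<Longrightarrow>
    has_ddiff v (\<lambda>x. g (f x)) (\<lambda>x. g' (f x) * f' x)"
  unfolding has_ddiff_def
  by (intro allI, rule DERIV_chain2[where f = g]) simp_all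

lemma continuous_cbox_support_integral:
  fixes g :: "'a::euclidean_space \<Rightarrow> real"
  assumes "continuous_on UNIV g" "\<And>x. x \<notin> cbox a b \<Longrightarrow> g x = 0"
  shows "integrable lebesgue g" "(LINT x|lebesgue. g x) = integral (cbox a b) g"
proof -
  have eq: "(\<lambda>x. indicator (cbox a b) x * g x) = g"
    using assms(2) by (intro ext) (auto simp: indicator_def)
  have *: "set_integrable lebesgue (cbox a b) g"
    using assms(1) by (intro absolutely_integrable_continuous continuous_on_subset[OF assms(1)]) auto
  from * show "integrable lebesgue g" by (simp add: set_integrable_def eq)
  from set_lebesgue_integral_eq_integral(2)[OF *]
  show "(LINT x|lebesgue. g x) = integral (cbox a b) g"
    by (simp add: set_lebesgue_integral_def eq)
qed

text \<open>The complement of a closed set is open, so \<open>f\<close> vanishes along a short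
  segment through \<open>x\<close>.\<close>

lemma has_ddiff_eq_0:
  assumes f: "has_ddiff v f f'" and C: "closed C" and supp: "\<And>x. x \<notin> C \<Longrightarrow> f x = 0" and x: "x \<notin> C"
  shows "f' x = 0"
proof -
  have "open ((\<lambda>r. x + r *\<^sub>R v) -` (- C))"
    by (intro open_vimage open_Compl C continuous_intros)
  then have "\<forall>\<^sub>F r in nhds 0. r \<in> (\<lambda>r. x + r *\<^sub>R v) -` (- C)"
    using x by (intro eventually_nhds_in_open) auto
  then have ev: "\<forall>\<^sub>F r in nhds 0. f (x + r *\<^sub>R v) = 0"
    by eventually_elim (auto simp: supp)
  have "((\<lambda>r. f (x + r *\<^sub>R v)) has_real_derivative f' x) (at 0)"
    using f by (simp add: has_ddiff_def)
  then have "((\<lambda>r. 0) has_real_derivative f' x) (at 0)"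
    using ev DERIV_cong_ev[of 0 0 "\<lambda>r. f (x + r *\<^sub>R v)" "\<lambda>r. 0" "f' x"] by simp
  then show "f' x = 0" using DERIV_unique DERIV_const by blast
qed

text \<open>The integral of the translates \<open>f (x + h v)\<close> does not depend on \<open>h\<close>; differentiate in \<open>h\<close>.\<close>

lemma integral_ddiff_eq_0:
  fixes f :: "'a::euclidean_space \<Rightarrow> real"
  assumes f: "has_ddiff v f f'" "continuous_on UNIV f" "continuous_on UNIV f'"
    and supp: "\<And>x. x \<notin> cbox a b \<Longrightarrow> f x = 0"
  shows "integrable lebesgue f'" "(LINT x|lebesgue. f' x) = 0"
proof -
  have supp': "f' x = 0" if "x \<notin> cbox a b" for x
    using has_ddiff_eq_0[OF f(1) closed_cbox supp that] .
  show "integrable lebesgue f'"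
    by (rule continuous_cbox_support_integral(1)[OF f(3) supp'])
  \<comment> \<open>One box contains every translate with shift at most 1, so that differentiation
    in \<open>h\<close> takes place over a fixed domain.\<close>
  obtain c where c: "(\<Union>h\<in>{-1..1}. cbox (a - h *\<^sub>R v) (b - h *\<^sub>R v)) \<subseteq> cbox (-c) c"
  proof -
    have "bounded ((\<lambda>(x, h). x - h *\<^sub>R v) ` (cbox a b \<times> {-1..1::real}))"
      by (intro compact_imp_bounded compact_continuous_image compact_Times compact_cbox compact_Icc)
        (auto simp: split_def intro!: continuous_intros)
    then obtain c where "(\<lambda>(x, h). x - h *\<^sub>R v) ` (cbox a b \<times> {-1..1::real}) \<subseteq> cbox (-c) c"
      using bounded_subset_cbox_symmetric by metis
    moreover have "cbox (a - h *\<^sub>R v) (b - h *\<^sub>R v) = (\<lambda>x. x - h *\<^sub>R v) ` cbox a b" for h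
      by (simp add: cbox_shift'')
    ultimately show ?thesis using that[of c] by (fastforce simp: image_subset_iff)
  qed
  have fc: "continuous_on UNIV (\<lambda>x. f (x + h *\<^sub>R v))" for h
    by (intro continuous_on_compose2[OF f(2)] continuous_intros) auto
  have const: "integral (cbox (-c) c) (\<lambda>x. f (x + h *\<^sub>R v)) = integral (cbox a b) f" if "h \<in> {-1..1}" for h
  proof -
    have s1: "f (x + h *\<^sub>R v) = 0" if "x \<notin> cbox (a - h *\<^sub>R v) (b - h *\<^sub>R v)" for x
      using that by (intro supp) (auto simp: mem_box algebra_simps)
    have s2: "f (x + h *\<^sub>R v) = 0" if "x \<notin> cbox (-c) c" for x
      using that c \<open>h \<in> {-1..1}\<close> by (intro s1) blast
    have "integral (cbox (-c) c) (\<lambda>x. f (x + h *\<^sub>R v)) = integral (cbox (a - h *\<^sub>R v) (b - h *\<^sub>R v)) (\<lambda>x. f (x + h *\<^sub>R v))"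
      using continuous_cbox_support_integral(2)[OF fc s1] continuous_cbox_support_integral(2)[OF fc s2] by simp
    then show ?thesis by (simp add: integral_shift_cbox)
  qed
  have "((\<lambda>h. integral (cbox (-c) c) (\<lambda>x. f (x + h *\<^sub>R v))) has_field_derivative
      integral (cbox (-c) c) (\<lambda>x. f' (x + 0 *\<^sub>R v))) (at 0 within UNIV)"
  proof (rule leibniz_rule_field_derivative)
    show "((\<lambda>h. f (x + h *\<^sub>R v)) has_real_derivative f' (x + h *\<^sub>R v)) (at h within UNIV)" for x h
      using has_ddiffD[OF f(1)] by simp
    show "(\<lambda>x. f (x + h *\<^sub>R v)) integrable_on cbox (-c) c" for h
      by (intro integrable_continuous continuous_on_subset[OF fc]) auto
    show "continuous_on (UNIV \<times> cbox (-c) c) (\<lambda>(h, x). f' (x + h *\<^sub>R v))"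
      unfolding split_def by (intro continuous_on_compose2[OF f(3)] continuous_intros) auto
  qed auto
  moreover have "\<forall>\<^sub>F h in nhds 0. integral (cbox (-c) c) (\<lambda>x. f (x + h *\<^sub>R v)) = integral (cbox a b) f"
    using eventually_nhds_in_open[of "{-1<..<1::real}" 0]
    by (auto elim!: eventually_mono intro!: const)
  ultimately have "((\<lambda>h. integral (cbox a b) f) has_field_derivative integral (cbox (-c) c) f') (at 0)"
    by (subst (asm) DERIV_cong_ev[OF refl _ refl]) auto
  then have "integral (cbox (-c) c) f' = 0" using DERIV_unique DERIV_const by blast
  moreover have "f' x = 0" if "x \<notin> cbox (-c) c" for x
    using c that by (intro supp') (auto simp: UN_subset_iff dest!: bspec[of _ _ 0])
  ultimately show "(LINT x|lebesgue. f' x) = 0"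
    using continuous_cbox_support_integral(2)[OF f(3), of "-c" c] by simp
qed

section \<open>Classical solutions of the wave equation\<close>

lemma pair_time_derivative:
  fixes F :: "real \<times> 'a::euclidean_space \<Rightarrow> real"
  assumes "\<And>z. F differentiable (at z)"
  shows "((\<lambda>s. F (s, x)) has_real_derivative pdiff (1, 0) F (t, x)) (at t)"
  using has_ddiffD[OF has_ddiff_pdiff[OF assms, of "(1, 0)"], of "(0, x)" t] by simp

lemma pair_space_derivative:
  fixes F :: "real \<times> 'a::euclidean_space \<Rightarrow> real"
  assumes "\<And>z. F differentiable (at z)"
  shows "(\<lambda>x. F (t, x)) differentiable (at x)" "pdiff b (\<lambda>x. F (t, x)) x = pdiff (0, b) F (t, x)"
proof -
  have D: "((\<lambda>x. F (t, x)) has_derivative (\<lambda>h. frechet_derivative F (at (t, x)) (0, h))) (at x)"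
  proof (rule has_derivative_compose[of "\<lambda>x. (t, x)" _ x UNIV F, simplified])
    show "((\<lambda>x. (t, x)) has_derivative (\<lambda>h. (0, h))) (at x)"
      by (auto intro!: derivative_eq_intros)
    show "(F has_derivative frechet_derivative F (at (t, x))) (at (t, x))"
      using assms has_derivative_frechet by auto
  qed
  then show "(\<lambda>x. F (t, x)) differentiable (at x)" by (auto simp: differentiable_def)
  show "pdiff b (\<lambda>x. F (t, x)) x = pdiff (0, b) F (t, x)"
    using pdiff_eqI[OF D] by (simp add: pdiff_def)
qed

locale classical_wave =
  fixes l :: "real \<Rightarrow> real^2 \<Rightarrow> real"
  assumes wave: "wave_solution l"
begin

abbreviation "D b t \<equiv> pdiff b (l t)"
abbreviation "DD b t \<equiv> pdiff b (pdiff b (l t))"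

context
  fixes L defines "L \<equiv> (\<lambda>(t, x). l t x)"
begin

private lemma Ck2: "Ck 2 L"
  using wave by (simp add: wave_solution_def L_def)

private lemma L_diff: "L differentiable (at z)"
  using Ck2 by (cases z) (simp add: numeral_2_eq_2)

private lemma dL_diff: "B \<in> Basis \<Longrightarrow> pdiff B L differentiable (at z)"
  using Ck2 by (cases z) (simp add: numeral_2_eq_2)

private lemma ddL_cont: "B \<in> Basis \<Longrightarrow> B' \<in> Basis \<Longrightarrow> continuous_on UNIV (pdiff B' (pdiff B L))"
  using Ck2 by (simp add: numeral_2_eq_2)

private lemma time_Basis: "(1, 0) \<in> (Basis :: (real \<times> (real^2)) set)"
  by (simp add: Basis_prod_def)

private lemma space_Basis: "b \<in> Basis \<Longrightarrow> (0, b) \<in> (Basis :: (real \<times> (real^2)) set)"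
  by (simp add: Basis_prod_def)

text \<open>\<open>Ck 2\<close> concerns Frechet derivatives on space-time, while \<open>dt\<close>
  and \<open>laplacian\<close> differentiate slices. This and the following identities translate one
  into the other, which makes joint continuity available.\<close>

private lemma dt_eq: "dt l t x = pdiff (1, 0) L (t, x)"
  using DERIV_imp_deriv[OF pair_time_derivative[OF L_diff]] by (simp add: dt_def L_def)

private lemma D_eq: "D b t x = pdiff (0, b) L (t, x)"
  using pair_space_derivative(2)[OF L_diff] by (simp add: L_def)

private lemma dtt_eq: "dt (dt l) t x = pdiff (1, 0) (pdiff (1, 0) L) (t, x)"
  using DERIV_imp_deriv[OF pair_time_derivative[OF dL_diff[OF time_Basis]]]
  by (simp add: dt_def[of "dt l"] dt_eq)

private lemma DD_eq: "b \<in> Basis \<Longrightarrow> DD b t x = pdiff (0, b) (pdiff (0, b) L) (t, x)"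
  using pair_space_derivative(2)[OF dL_diff[OF space_Basis], of b b t x] by (simp add: D_eq[abs_def])

lemma dt_l: "((\<lambda>s. l s x) has_real_derivative dt l t x) (at t)"
  using pair_time_derivative[OF L_diff, of x t] by (simp add: dt_eq L_def)

text \<open>The place where the equation itself, as opposed to the regularity of the solution,
  enters.\<close>

lemma dt_dt_l: "((\<lambda>s. dt l s x) has_real_derivative (\<Sum>b\<in>Basis. DD b t x)) (at t)"
proof -
  have "dt (dt l) t x = (\<Sum>b\<in>Basis. DD b t x)"
    using wave by (simp add: wave_solution_def laplacian_def)
  then show ?thesis
    using pair_time_derivative[OF dL_diff[OF time_Basis], of x t] by (simp add: dt_eq dtt_eq)
qed

lemma ddiff_l: "has_ddiff b (l t) (D b t)"
  using pair_space_derivative(1)[OF L_diff] by (intro has_ddiff_pdiff) (simp add: L_def)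

lemma ddiff_D: "b \<in> Basis \<Longrightarrow> has_ddiff b (D b t) (DD b t)"
  using pair_space_derivative(1)[OF dL_diff[OF space_Basis]]
  by (intro has_ddiff_pdiff) (simp add: D_eq[abs_def])

lemma cont_l: "continuous_on UNIV (\<lambda>z. l (fst z) (snd z))"
  using Ck_continuous[OF Ck2] by (simp add: L_def split_def)

lemma cont_dt: "continuous_on UNIV (\<lambda>z. dt l (fst z) (snd z))"
  using dL_diff[OF time_Basis]
  by (simp add: dt_eq continuous_on_eq_continuous_at differentiable_imp_continuous_within)

lemma cont_D: "b \<in> Basis \<Longrightarrow> continuous_on UNIV (\<lambda>z. D b (fst z) (snd z))"
  using dL_diff[OF space_Basis]
  by (simp add: D_eq continuous_on_eq_continuous_at differentiable_imp_continuous_within)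

lemma cont_DD: "b \<in> Basis \<Longrightarrow> continuous_on UNIV (\<lambda>z. DD b (fst z) (snd z))"
  using ddL_cont[OF space_Basis space_Basis] by (simp add: DD_eq)

end

end

text \<open>\<open>prim g t x\<close> is the primitive \<open>\<integral>\<^sub>1\<^sup>t g s x ds\<close>, rescaled to \<open>[0, 1]\<close>
  so that it is jointly continuous and makes sense for \<open>t < 1\<close>.\<close>

definition prim :: "(real \<Rightarrow> 'a \<Rightarrow> real) \<Rightarrow> real \<Rightarrow> 'a \<Rightarrow> real" where
  "prim g t x = integral (cbox 0 1) (\<lambda>\<sigma>. (t - 1) * g (1 + (t - 1) * \<sigma>) x)"

lemma prim_1 [simp]: "prim g 1 x = 0"
  by (simp add: prim_def)

lemma joint_continuous:
  fixes g :: "'c::topological_space \<Rightarrow> 'a::topological_space \<Rightarrow> real"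
  assumes "continuous_on UNIV (\<lambda>z. g (fst z) (snd z))" "continuous_on S p" "continuous_on S q"
  shows "continuous_on S (\<lambda>y. g (p y) (q y))"
  using continuous_on_compose2[OF assms(1) continuous_on_Pair[OF assms(2,3)]] by simp

lemma prim_continuous:
  fixes g :: "real \<Rightarrow> 'a::topological_space \<Rightarrow> real"
  assumes "continuous_on UNIV (\<lambda>z. g (fst z) (snd z))"
  shows "continuous_on UNIV (\<lambda>z. prim g (fst z) (snd z))"
  unfolding prim_def
  by (rule integral_continuous_on_param)
     (auto simp: split_def intro!: continuous_intros joint_continuous[OF assms])

text \<open>Near \<open>t\<close> the substitution turns \<open>prim g s x\<close> into
  \<open>G s - G 1\<close> for one antiderivative \<open>G\<close>, which is then
  differentiated.\<close>

lemma prim_derivative: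
  fixes g :: "real \<Rightarrow> 'a::topological_space \<Rightarrow> real"
  assumes "continuous_on UNIV (\<lambda>z. g (fst z) (snd z))"
  shows "((\<lambda>t. prim g t x) has_real_derivative g t x) (at t)"
proof -
  \<comment> \<open>The margin on both sides puts 1, \<open>t\<close> and all points between them in
    the interior, where derivatives within the interval are full derivatives.\<close>
  define I where "I = {min t 1 - 1..max t 1 + 1}"
  have "continuous_on I (\<lambda>s. g s x)"
    by (intro joint_continuous[OF assms] continuous_intros)
  then obtain G where G: "\<And>s. s \<in> I \<Longrightarrow> (G has_vector_derivative g s x) (at s within I)"
    using antiderivative_continuous[of "min t 1 - 1" "max t 1 + 1" "\<lambda>s. g s x"] unfolding I_def by metis
  have DG: "(G has_real_derivative g s x) (at s)" if "s \<in> {min t 1 - 1<..<max t 1 + 1}" for s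
  proof -
    have "at s within I = at s"
      using that by (intro at_within_interior) (auto simp: I_def)
    then show ?thesis
      using G[of s] that by (auto simp: I_def has_real_derivative_iff_has_vector_derivative)
  qed
  have eq: "prim g s x = G s - G 1" if s: "s \<in> {min t 1 - 1<..<max t 1 + 1}" for s
  proof -
    have "((\<lambda>\<sigma>. (s - 1) * g (1 + (s - 1) * \<sigma>) x) has_integral
        G (1 + (s - 1) * 1) - G (1 + (s - 1) * 0)) {0..1}"
    proof (rule fundamental_theorem_of_calculus)
      fix \<sigma> :: real assume \<sigma>: "\<sigma> \<in> {0..1}"
      have "1 + (s - 1) * \<sigma> \<in> closed_segment 1 s"
        unfolding in_segment using \<sigma> by (intro exI[of _ \<sigma>]) (auto simp: algebra_simps)
      then have "1 + (s - 1) * \<sigma> \<in> {min t 1 - 1<..<max t 1 + 1}"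
        using s by (auto simp: closed_segment_eq_real_ivl split: if_splits)
      note DERIV_chain2[where f = G and g = "\<lambda>\<sigma>. 1 + (s - 1) * \<sigma>" and x = \<sigma> and Db = "s - 1", OF DG[OF this]]
      moreover have "((\<lambda>\<sigma>. 1 + (s - 1) * \<sigma>) has_real_derivative s - 1) (at \<sigma>)"
        by (auto intro!: derivative_eq_intros)
      ultimately have "((\<lambda>\<sigma>. G (1 + (s - 1) * \<sigma>)) has_real_derivative g (1 + (s - 1) * \<sigma>) x * (s - 1)) (at \<sigma>)"
        by blast
      then show "((\<lambda>\<sigma>. G (1 + (s - 1) * \<sigma>)) has_vector_derivative
          (s - 1) * g (1 + (s - 1) * \<sigma>) x) (at \<sigma> within {0..1})"
        by (simp add: has_real_derivative_iff_has_vector_derivative[symmetric] mult.commute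
            has_field_derivative_at_within)
    qed simp
    from integral_unique[OF this] show ?thesis by (simp add: prim_def)
  qed
  have tin: "t \<in> {min t 1 - 1<..<max t 1 + 1}" by (auto simp: min_def max_def)
  have "((\<lambda>s. G s - G 1) has_real_derivative g t x) (at t)"
    using DERIV_diff[OF DG[OF tin] DERIV_const[of "G 1"]] by simp
  moreover have "\<forall>\<^sub>F s in nhds t. prim g s x = G s - G 1"
    using eventually_nhds_in_open[OF open_greaterThanLessThan tin]
    by eventually_elim (rule eq)
  ultimately show ?thesis by (subst DERIV_cong_ev[OF refl _ refl]) auto
qed

lemma prim_ddiff:
  fixes g g' :: "real \<Rightarrow> 'a::real_normed_vector \<Rightarrow> real"
  assumes g: "\<And>t. has_ddiff b (g t) (g' t)"
    and c: "continuous_on UNIV (\<lambda>z. g (fst z) (snd z))" and c': "continuous_on UNIV (\<lambda>z. g' (fst z) (snd z))"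
  shows "has_ddiff b (prim g t) (prim g' t)"
  unfolding has_ddiff_def
proof
  fix z
  have "((\<lambda>r. integral (cbox 0 1) (\<lambda>\<sigma>. (t - 1) * g (1 + (t - 1) * \<sigma>) (z + r *\<^sub>R b))) has_field_derivative
      integral (cbox 0 1) (\<lambda>\<sigma>. (t - 1) * g' (1 + (t - 1) * \<sigma>) (z + 0 *\<^sub>R b))) (at 0 within UNIV)"
  proof (rule leibniz_rule_field_derivative)
    show "((\<lambda>r. (t - 1) * g (1 + (t - 1) * \<sigma>) (z + r *\<^sub>R b)) has_real_derivative
        (t - 1) * g' (1 + (t - 1) * \<sigma>) (z + r *\<^sub>R b)) (at r within UNIV)" for r \<sigma>
      using DERIV_cmult[OF has_ddiffD[OF g]] by simp
    show "(\<lambda>\<sigma>. (t - 1) * g (1 + (t - 1) * \<sigma>) (z + r *\<^sub>R b)) integrable_on cbox 0 1" for r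
      by (intro integrable_continuous continuous_intros joint_continuous[OF c])
    show "continuous_on (UNIV \<times> cbox 0 1) (\<lambda>(r, \<sigma>). (t - 1) * g' (1 + (t - 1) * \<sigma>) (z + r *\<^sub>R b))"
      unfolding split_def by (intro continuous_intros joint_continuous[OF c'])
  qed auto
  then show "((\<lambda>r. prim g t (z + r *\<^sub>R b)) has_real_derivative prim g' t z) (at 0)"
    by (simp add: prim_def)
qed

text \<open>The wave equation integrated once in time, l_t = u1 + div P; together with P_t = grad l
  it closes into a first-order system.\<close>

lemma (in classical_wave) dt_l_eq: "dt l t x = dt l 1 x + (\<Sum>b\<in>Basis. prim (DD b) t x)"
proof -
  have "((\<lambda>t. dt l t x - (\<Sum>b\<in>Basis. prim (DD b) t x)) has_real_derivative
      (\<Sum>b\<in>Basis. DD b t x) - (\<Sum>b\<in>Basis. DD b t x)) (at t)" for t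
    by (intro DERIV_diff dt_dt_l DERIV_sum prim_derivative cont_DD)
  then have "\<forall>t. ((\<lambda>t. dt l t x - (\<Sum>b\<in>Basis. prim (DD b) t x)) has_real_derivative 0) (at t)"
    by simp
  from DERIV_isconst_all[OF this, of t 1] show ?thesis by simp
qed

section \<open>A weighted energy estimate\<close>

lemma jbracket_ge_1: "1 \<le> jbracket x"
  by (simp add: jbracket_def)

lemma jbracket_pos: "0 < jbracket x"
  using jbracket_ge_1[of x] by linarith

lemma norm_le_jbracket: "norm x \<le> jbracket x"
  unfolding jbracket_def by (rule real_le_rsqrt) simp

lemma jbracket_square: "(jbracket x)\<^sup>2 = 1 + (norm x)\<^sup>2"
  by (simp add: jbracket_def)

lemma continuous_on_jbracket [continuous_intros]:
  "continuous_on S f \<Longrightarrow> continuous_on S (\<lambda>x. jbracket (f x))"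
  unfolding jbracket_def by (intro continuous_intros)

lemma jbracket_ddiff:
  fixes b :: "'a::real_inner"
  shows "has_ddiff b jbracket (\<lambda>x. (x \<bullet> b) / jbracket x)"
  unfolding has_ddiff_def
proof
  fix z :: 'a
  have "((\<lambda>r. sqrt (1 + (z + r *\<^sub>R b) \<bullet> (z + r *\<^sub>R b))) has_real_derivative
      (2 * (z \<bullet> b)) * (inverse (sqrt (1 + z \<bullet> z)) / 2)) (at 0)"
    by (auto intro!: derivative_eq_intros simp: inner_add_left inner_add_right inner_commute[of b z])
       (use inner_ge_zero[of z] in linarith)+
  then show "((\<lambda>r. jbracket (z + r *\<^sub>R b)) has_real_derivative (z \<bullet> b) / jbracket z) (at 0)"
    by (simp add: jbracket_def power2_norm_eq_inner field_simps)
qed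

text \<open>The square makes the truncation continuously differentiable across its edge, as
  differentiation under the integral and the divergence identity require.\<close>

lemma DERIV_max_0_square: "((\<lambda>y. (max 0 y)\<^sup>2) has_real_derivative 2 * max 0 y) (at (y::real))"
proof (cases y "0 :: real" rule: linorder_cases)
  case less
  have "\<forall>\<^sub>F z in nhds y. (max 0 z)\<^sup>2 = 0"
    using eventually_nhds_in_open[of "{..<0}" y] less by (auto elim!: eventually_mono)
  then have "((\<lambda>y. (max 0 y)\<^sup>2) has_real_derivative 0) (at y)"
    by (subst DERIV_cong_ev[OF refl _ refl, where g = "\<lambda>_. 0"]) auto
  then show ?thesis using less by simp
next
  case greater
  have "\<forall>\<^sub>F z in nhds y. (max 0 z)\<^sup>2 = z\<^sup>2"
    using eventually_nhds_in_open[of "{0<..}" y] greater by (auto elim!: eventually_mono)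
  moreover have "((\<lambda>y. y\<^sup>2) has_real_derivative 2 * y) (at y)"
    by (auto intro!: derivative_eq_intros)
  ultimately have "((\<lambda>y. (max 0 y)\<^sup>2) has_real_derivative 2 * y) (at y)"
    by (subst DERIV_cong_ev[OF refl _ refl]) auto
  then show ?thesis using greater by simp
next
  case equal
  have "((\<lambda>h. ((max 0 (0 + h))\<^sup>2 - (max 0 0)\<^sup>2) / h) \<longlongrightarrow> (0::real)) (at 0)"
  proof (rule Lim_null_comparison[where g = abs])
    show "\<forall>\<^sub>F h in at 0. norm (((max 0 (0 + h))\<^sup>2 - (max 0 0)\<^sup>2) / h) \<le> \<bar>h::real\<bar>"
      by (intro always_eventually) (auto simp: max_def power2_eq_square)
    show "(abs \<longlongrightarrow> (0::real)) (at 0)" by (auto intro!: tendsto_eq_intros)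
  qed
  then show ?thesis using equal by (simp add: DERIV_def)
qed

text \<open>The factor \<open>jbracket x ^ 6\<close> is the square of the weight that the data carry
  at order zero. The truncation lives on \<open>jbracket x + t < R\<close>, a smoothed backward
  light cone: bounded at each positive time and shrinking at the speed of the waves, so that cutting
  off costs nothing in the energy estimate.\<close>

definition cone_weight :: "real \<Rightarrow> real \<Rightarrow> real^2 \<Rightarrow> real" where
  "cone_weight R t x = jbracket x ^ 6 * (max 0 (1 - (jbracket x + t) / R))\<^sup>2"

text \<open>The gradient of the weight is this scalar times \<open>x\<close>; each term has lost one
  power of the bracket to the derivative \<open>(x \<bullet> b) / jbracket x\<close>.\<close>

definition cone_weight_grad :: "real \<Rightarrow> real \<Rightarrow> real^2 \<Rightarrow> real" where
  "cone_weight_grad R t x = 6 * jbracket x ^ 4 * (max 0 (1 - (jbracket x + t) / R))\<^sup>2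
     - 2 * jbracket x ^ 5 * max 0 (1 - (jbracket x + t) / R) / R"

definition cone_weight_dt :: "real \<Rightarrow> real \<Rightarrow> real^2 \<Rightarrow> real" where
  "cone_weight_dt R t x = - (2 * jbracket x ^ 6 * max 0 (1 - (jbracket x + t) / R) / R)"

lemma cone_weight_nonneg: "0 \<le> cone_weight R t x"
  using jbracket_pos[of x] by (simp add: cone_weight_def)

lemma cone_weight_support:
  assumes "R > 0" "t > 0" "x \<notin> cbox (- (R *\<^sub>R One)) (R *\<^sub>R One)"
  shows "cone_weight R t x = 0"
proof -
  obtain i where i: "\<not> (- R \<le> x $ i \<and> x $ i \<le> R)" using assms(3) by (auto simp: mem_box_cart)
  then have "jbracket x > R"
    using component_le_norm_cart[of x i] norm_le_jbracket[of x] by auto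
  then show ?thesis using assms by (simp add: cone_weight_def field_simps)
qed

lemma cone_weight_le:
  assumes "R > 0" "t > 0"
  shows "cone_weight R t x \<le> jbracket x ^ 6"
proof -
  have "(max 0 (1 - (jbracket x + t) / R))\<^sup>2 \<le> 1"
    using assms jbracket_pos[of x] by (intro power_le_one) auto
  then show ?thesis unfolding cone_weight_def using jbracket_pos[of x]
    by (intro mult_left_le) auto
qed

lemma cone_weight_ddiff:
  assumes "R > 0"
  shows "has_ddiff b (cone_weight R t) (\<lambda>x. cone_weight_grad R t x * (x \<bullet> b))"
proof -
  let ?m = "\<lambda>x. max 0 (1 - (jbracket x + t) / R)"
  have D: "((\<lambda>y. (max 0 (1 - (y + t) / R))\<^sup>2) has_real_derivative 2 * max 0 (1 - (y + t) / R) * (- (1 / R))) (at y)" for y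
    by (rule DERIV_chain2[OF DERIV_max_0_square]) (use assms in \<open>auto intro!: derivative_eq_intros\<close>)
  have "has_ddiff b (\<lambda>x. jbracket x ^ 6 * (?m x)\<^sup>2)
      (\<lambda>x. (6 * jbracket x ^ 5 * ((x \<bullet> b) / jbracket x)) * (?m x)\<^sup>2 +
        jbracket x ^ 6 * (2 * ?m x * (- (1 / R)) * ((x \<bullet> b) / jbracket x)))"
    by (intro has_ddiff_mult has_ddiff_chain[where g = "\<lambda>y. y ^ 6" and g' = "\<lambda>y. 6 * y ^ 5"]
        has_ddiff_chain[where g = "\<lambda>y. (max 0 (1 - (y + t) / R))\<^sup>2"] jbracket_ddiff D)
       (auto intro!: derivative_eq_intros)
  moreover have "(6 * jbracket x ^ 5 * ((x \<bullet> b) / jbracket x)) * (?m x)\<^sup>2 +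
        jbracket x ^ 6 * (2 * ?m x * (- (1 / R)) * ((x \<bullet> b) / jbracket x)) =
      cone_weight_grad R t x * (x \<bullet> b)" for x
  proof -
    have "(6 * q ^ 5 * (s / q)) * m\<^sup>2 + q ^ 6 * (2 * m * (- (1 / R)) * (s / q)) =
        (6 * q ^ 4 * m\<^sup>2 - 2 * q ^ 5 * m / R) * s" if "q > 0" for q s m :: real
      using that assms by (simp add: field_simps eval_nat_numeral)
    from this[OF jbracket_pos] show ?thesis by (simp add: cone_weight_grad_def)
  qed
  ultimately show ?thesis by (simp add: cone_weight_def[abs_def])
qed

lemma cone_weight_derivative:
  assumes "R > 0"
  shows "((\<lambda>t. cone_weight R t x) has_real_derivative cone_weight_dt R t x) (at t)"
proof -
  have "((\<lambda>t. (max 0 (1 - (jbracket x + t) / R))\<^sup>2) has_real_derivative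
      2 * max 0 (1 - (jbracket x + t) / R) * (- (1 / R))) (at t)"
    by (rule DERIV_chain2[OF DERIV_max_0_square]) (use assms in \<open>auto intro!: derivative_eq_intros\<close>)
  from DERIV_cmult[OF this, of "jbracket x ^ 6"] show ?thesis
    by (simp add: cone_weight_def cone_weight_dt_def mult_ac)
qed

text \<open>The bracket has a gradient of length at most 1, so the spatial derivative of the
  truncation is dominated by minus its time derivative. Differentiating the sixth power contributes
  at most 6 times the weight, as the bracket is at least 1.\<close>

lemma cone_weight_flux:
  assumes R: "R > 0"
  shows "\<bar>cone_weight_grad R t x\<bar> * norm x \<le> 6 * cone_weight R t x - cone_weight_dt R t x"
proof -
  define m where "m = max 0 (1 - (jbracket x + t) / R)"
  define q where "q = jbracket x"
  have q: "q > 0" "m \<ge> 0" "norm x \<le> q" by (auto simp: q_def m_def jbracket_pos norm_le_jbracket)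
  have g: "\<bar>cone_weight_grad R t x\<bar> \<le> 6 * q ^ 4 * m\<^sup>2 + 2 * q ^ 5 * m / R"
    unfolding cone_weight_grad_def q_def[symmetric] m_def[folded q_def, symmetric]
    using q assms by (intro order_trans[OF abs_triangle_ineq4]) auto
  have "\<bar>cone_weight_grad R t x\<bar> * norm x \<le> (6 * q ^ 4 * m\<^sup>2 + 2 * q ^ 5 * m / R) * q"
    using q assms by (intro mult_mono g) (auto intro!: add_nonneg_nonneg)
  also have "\<dots> = 6 * (q ^ 4 * q) * m\<^sup>2 + 2 * q ^ 6 * m / R"
    by (simp add: field_simps eval_nat_numeral)
  also have "q ^ 4 * q \<le> q ^ 6"
    using jbracket_ge_1[of x] power_increasing[of 5 6 q] by (simp add: q_def eval_nat_numeral mult_ac)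
  finally show ?thesis
    by (auto simp: cone_weight_def cone_weight_dt_def q_def[symmetric] m_def[folded q_def, symmetric] mult_right_mono)
qed

lemma cone_weight_continuous:
  assumes "R > 0"
  shows "continuous_on UNIV (\<lambda>z. cone_weight R (fst z) (snd z))"
    "continuous_on UNIV (\<lambda>z. cone_weight_grad R (fst z) (snd z))"
    "continuous_on UNIV (\<lambda>z. cone_weight_dt R (fst z) (snd z))"
  unfolding cone_weight_def cone_weight_grad_def cone_weight_dt_def
  using assms by (auto intro!: continuous_intros)

section \<open>The energy, its time derivative and its growth\<close>

context classical_wave
begin

text \<open>The energy of the first-order system for \<open>l\<close> and the primitive of its
  gradient; at time 1 only the square of \<open>l\<close> is left.\<close>

definition energy_square :: "real \<Rightarrow> real^2 \<Rightarrow> real" where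
  "energy_square t x = (l t x)\<^sup>2 + (\<Sum>b\<in>Basis. (prim (D b) t x)\<^sup>2)"

definition energy :: "real \<Rightarrow> real \<Rightarrow> real" where
  "energy R t = (LINT x|lebesgue. cone_weight R t x * energy_square t x)"

lemma energy_square_nonneg: "0 \<le> energy_square t x"
  by (auto simp: energy_square_def intro!: add_nonneg_nonneg sum_nonneg)

lemma cont_prim_D: "b \<in> Basis \<Longrightarrow> continuous_on UNIV (\<lambda>z. prim (D b) (fst z) (snd z))"
  by (intro prim_continuous cont_D)

lemma cont_energy_square: "continuous_on UNIV (\<lambda>z. energy_square (fst z) (snd z))"
  unfolding energy_square_def by (intro continuous_intros cont_l cont_prim_D) auto

lemma prim_D_ddiff: "b \<in> Basis \<Longrightarrow> has_ddiff b (prim (D b) t) (prim (DD b) t)"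
  by (intro prim_ddiff ddiff_D cont_D cont_DD)

definition energy_density_dt :: "real \<Rightarrow> real \<Rightarrow> real^2 \<Rightarrow> real" where
  "energy_density_dt R t x = cone_weight_dt R t x * energy_square t x +
     cone_weight R t x * (2 * l t x * dt l t x + (\<Sum>b\<in>Basis. 2 * prim (D b) t x * D b t x))"

lemma energy_density_derivative:
  assumes "R > 0"
  shows "((\<lambda>t. cone_weight R t x * energy_square t x) has_real_derivative energy_density_dt R t x) (at t)"
proof -
  have "((\<lambda>t. energy_square t x) has_real_derivative
      2 * l t x * dt l t x + (\<Sum>b\<in>Basis. 2 * prim (D b) t x * D b t x)) (at t)"
    unfolding energy_square_def
  proof (intro DERIV_add DERIV_sum)
    show "((\<lambda>t. (l t x)\<^sup>2) has_real_derivative 2 * l t x * dt l t x) (at t)"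
      by (rule derivative_eq_intros dt_l | simp)+
    fix b :: "real^2" assume "b \<in> Basis"
    then show "((\<lambda>t. (prim (D b) t x)\<^sup>2) has_real_derivative 2 * prim (D b) t x * D b t x) (at t)"
      by (auto intro!: derivative_eq_intros prim_derivative cont_D)
  qed
  from DERIV_mult[OF cone_weight_derivative[OF assms] this] show ?thesis
    by (simp add: energy_density_dt_def add.commute mult_ac)
qed

lemma cont_energy_density_dt:
  "R > 0 \<Longrightarrow> continuous_on UNIV (\<lambda>z. energy_density_dt R (fst z) (snd z))"
  unfolding energy_density_dt_def
  by (intro continuous_intros cone_weight_continuous cont_energy_square cont_l cont_dt cont_prim_D cont_D)

lemma cont_slice:
  fixes g :: "real \<Rightarrow> real^2 \<Rightarrow> real"
  shows "continuous_on UNIV (\<lambda>z. g (fst z) (snd z)) \<Longrightarrow> continuous_on UNIV (g t)"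
  using joint_continuous[of g UNIV "\<lambda>_. t" "\<lambda>x. x"] by (auto intro: continuous_intros)

lemma cone_weight_mult_integral:
  assumes "R > 0" "t > 0" "continuous_on UNIV g"
  shows "integrable lebesgue (\<lambda>x. cone_weight R t x * g x)"
    "(LINT x|lebesgue. cone_weight R t x * g x) = integral (cbox (- (R *\<^sub>R One)) (R *\<^sub>R One)) (\<lambda>x. cone_weight R t x * g x)"
proof -
  have "continuous_on UNIV (\<lambda>x. cone_weight R t x * g x)"
    by (intro continuous_intros assms cont_slice[of "cone_weight R"] cone_weight_continuous)
  then show "integrable lebesgue (\<lambda>x. cone_weight R t x * g x)"
    "(LINT x|lebesgue. cone_weight R t x * g x) = integral (cbox (- (R *\<^sub>R One)) (R *\<^sub>R One)) (\<lambda>x. cone_weight R t x * g x)"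
    using cone_weight_support[OF assms(1,2)]
      continuous_cbox_support_integral[of "\<lambda>x. cone_weight R t x * g x" "- (R *\<^sub>R One)" "R *\<^sub>R One"]
    by auto
qed

lemma energy_derivative:
  assumes "R > 0" "t > 0"
  shows "(energy R has_real_derivative
    integral (cbox (- (R *\<^sub>R One)) (R *\<^sub>R One)) (energy_density_dt R t)) (at t)"
proof -
  let ?B = "cbox (- (R *\<^sub>R One)) (R *\<^sub>R One) :: (real^2) set"
  have "((\<lambda>t. integral ?B (\<lambda>x. cone_weight R t x * energy_square t x)) has_field_derivative
      integral ?B (energy_density_dt R t)) (at t within {0<..})"
  proof (rule leibniz_rule_field_derivative)
    show "((\<lambda>t. cone_weight R t x * energy_square t x) has_real_derivative energy_density_dt R t x)
        (at t within {0<..})" for t x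
      by (rule has_field_derivative_at_within[OF energy_density_derivative[OF assms(1)]])
    show "(\<lambda>x. cone_weight R t x * energy_square t x) integrable_on ?B" for t
      by (intro integrable_continuous continuous_on_mult
          continuous_on_subset[OF cont_slice[OF cone_weight_continuous(1)[OF assms(1)]]]
          continuous_on_subset[OF cont_slice[OF cont_energy_square]]) auto
    show "continuous_on ({0<..} \<times> ?B) (\<lambda>(t, x). energy_density_dt R t x)"
      using continuous_on_subset[OF cont_energy_density_dt[OF assms(1)]] by (simp add: split_def)
  qed (use assms in auto)
  then have "((\<lambda>t. integral ?B (\<lambda>x. cone_weight R t x * energy_square t x)) has_field_derivative
      integral ?B (energy_density_dt R t)) (at t)"
    using at_within_open[of t "{0<..}"] assms by simp
  moreover have "\<forall>\<^sub>F s in nhds t. energy R s = integral ?B (\<lambda>x. cone_weight R s x * energy_square s x)"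
    using eventually_nhds_in_open[of "{0<..}" t] assms
    by (auto elim!: eventually_mono
        simp: energy_def cone_weight_mult_integral(2)[OF _ _ cont_slice[OF cont_energy_square]])
  ultimately show ?thesis by (subst DERIV_cong_ev[OF refl _ refl]) auto
qed

end

lemma cone_weight_dt_eq_0: "cone_weight R t x = 0 \<Longrightarrow> cone_weight_dt R t x = 0"
  using jbracket_pos[of x] by (auto simp: cone_weight_def cone_weight_dt_def)

context classical_wave
begin

text \<open>The part in direction \<open>b\<close> of the divergence of weight times
  \<open>l\<close> times P, with P the vector of primitives. It vanishes on integration and absorbs
  the terms with derivatives of \<open>l\<close> and P.\<close>

definition flux_div :: "real \<Rightarrow> real \<Rightarrow> real^2 \<Rightarrow> real^2 \<Rightarrow> real" where
  "flux_div R t b x = cone_weight_grad R t x * (x \<bullet> b) * (l t x * prim (D b) t x) +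
     cone_weight R t x * (D b t x * prim (D b) t x + l t x * prim (DD b) t x)"

lemma flux_div_integral:
  assumes "R > 0" "t > 0" "b \<in> Basis"
  shows "integrable lebesgue (flux_div R t b)" "(LINT x|lebesgue. flux_div R t b x) = 0"
proof -
  let ?B = "- (R *\<^sub>R One)" and ?C = "R *\<^sub>R One :: real^2"
  have d: "has_ddiff b (\<lambda>x. cone_weight R t x * (l t x * prim (D b) t x)) (flux_div R t b)"
    using has_ddiff_mult[OF cone_weight_ddiff[OF assms(1)]
        has_ddiff_mult[OF ddiff_l prim_D_ddiff[OF assms(3)]], of t t t]
    by (simp add: flux_div_def[abs_def])
  have c: "continuous_on UNIV (\<lambda>x. cone_weight R t x * (l t x * prim (D b) t x))"
    by (intro continuous_intros cont_slice[of "cone_weight R"] cont_slice[of l] cont_slice[of "prim (D b)"]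
        cone_weight_continuous cont_l cont_prim_D assms)
  have c': "continuous_on UNIV (flux_div R t b)"
    unfolding flux_div_def[abs_def]
    by (intro continuous_intros cont_slice[of "cone_weight R"] cont_slice[of "cone_weight_grad R"]
        cont_slice[of l] cont_slice[of "prim (D b)"] cont_slice[of "prim (DD b)"] cont_slice[of "D b"]
        cone_weight_continuous cont_l cont_D cont_prim_D prim_continuous cont_DD assms)
  have s: "cone_weight R t x * (l t x * prim (D b) t x) = 0" if "x \<notin> cbox ?B ?C" for x
    using cone_weight_support[OF assms(1,2) that] by simp
  show "integrable lebesgue (flux_div R t b)" "(LINT x|lebesgue. flux_div R t b x) = 0"
    using integral_ddiff_eq_0[OF d c c' s] by auto
qed

text \<open>Twice the divergence cancels every term with a spatial derivative of \<open>l\<close> or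
  of a primitive. What is left has order zero: the derivatives of the weight, bounded together by 6
  times the weight through Cauchy-Schwarz and \<open>cone_weight_flux\<close>, and the source, where
  2 u u1 <= u^2 + u1^2 adds the seventh unit.\<close>

lemma energy_density_dt_le:
  assumes "R > 0"
  shows "energy_density_dt R t x - 2 * (\<Sum>b\<in>Basis. flux_div R t b x) \<le>
    7 * (cone_weight R t x * energy_square t x) + cone_weight R t x * (dt l 1 x)\<^sup>2"
proof -
  define w where "w = cone_weight R t x"
  define g where "g = cone_weight_grad R t x"
  define wt where "wt = cone_weight_dt R t x"
  define P where "P b = prim (D b) t x" for b
  define p where "p = (\<Sum>b\<in>Basis. P b *\<^sub>R b)"
  define A where "A = energy_square t x"
  define u where "u = l t x"
  define u1 where "u1 = dt l 1 x"
  have w0: "w \<ge> 0" by (simp add: w_def cone_weight_nonneg)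
  have np: "(norm p)\<^sup>2 = (\<Sum>b\<in>Basis. (P b)\<^sup>2)"
  proof -
    have "p \<bullet> p = (\<Sum>b\<in>Basis. (p \<bullet> b) * (p \<bullet> b))" by (rule euclidean_inner)
    also have "\<dots> = (\<Sum>b\<in>Basis. P b * P b)" by (intro sum.cong refl) (simp add: p_def)
    finally show ?thesis by (simp only: power2_norm_eq_inner) (simp add: power2_eq_square)
  qed
  have A: "A = u\<^sup>2 + (norm p)\<^sup>2" by (simp add: A_def energy_square_def np u_def P_def)
  have S: "(\<Sum>b\<in>Basis. (x \<bullet> b) * P b) = x \<bullet> p"
    by (simp add: p_def inner_sum_right mult.commute)
  have "energy_density_dt R t x - 2 * (\<Sum>b\<in>Basis. flux_div R t b x) =
      wt * A + 2 * w * u * u1 - 2 * g * u * (\<Sum>b\<in>Basis. (x \<bullet> b) * P b)"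
    unfolding energy_density_dt_def flux_div_def dt_l_eq[of t x] w_def g_def wt_def P_def A_def u_def u1_def
    by (simp add: algebra_simps sum.distrib sum_distrib_left)
  also have "\<dots> \<le> wt * A + w * (u\<^sup>2 + u1\<^sup>2) + \<bar>g\<bar> * norm x * A"
  proof -
    have "2 * (u * u1) \<le> u\<^sup>2 + u1\<^sup>2" using sum_squares_bound[of u u1] by simp
    from mult_left_mono[OF this w0] have "2 * w * u * u1 \<le> w * (u\<^sup>2 + u1\<^sup>2)" by (simp add: mult_ac)
    moreover have "- (2 * g * u * (x \<bullet> p)) \<le> \<bar>g\<bar> * norm x * A"
    proof -
      have "- (2 * g * u * (x \<bullet> p)) \<le> 2 * \<bar>g\<bar> * \<bar>u\<bar> * \<bar>x \<bullet> p\<bar>"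
        by (rule order_trans[OF abs_ge_minus_self]) (simp add: abs_mult)
      also have "\<dots> \<le> 2 * \<bar>g\<bar> * \<bar>u\<bar> * (norm x * norm p)"
        by (intro mult_left_mono Cauchy_Schwarz_ineq2) auto
      also have "\<dots> = \<bar>g\<bar> * norm x * (2 * \<bar>u\<bar> * norm p)" by simp
      also have "\<dots> \<le> \<bar>g\<bar> * norm x * A"
        using sum_squares_bound[of "\<bar>u\<bar>" "norm p"] by (intro mult_left_mono) (auto simp: A)
      finally show ?thesis .
    qed
    ultimately show ?thesis by (simp add: S)
  qed
  also have "\<dots> \<le> wt * A + w * (u\<^sup>2 + u1\<^sup>2) + (6 * w - wt) * A"
    using cone_weight_flux[OF assms, of t x] energy_square_nonneg[of t x]
    by (intro add_left_mono mult_right_mono) (auto simp: g_def w_def wt_def A_def)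
  also have "\<dots> = 6 * (w * A) + w * u\<^sup>2 + w * u1\<^sup>2" by (simp add: algebra_simps)
  also have "\<dots> \<le> 7 * (w * A) + w * u1\<^sup>2"
    using mult_left_mono[OF _ w0, of "u\<^sup>2" A] A by simp
  finally show ?thesis by (simp add: w_def A_def u1_def)
qed

lemma energy_growth:
  assumes R: "R > 0" and t: "t > 0"
    and K: "integrable lebesgue (\<lambda>x. jbracket x ^ 6 * (dt l 1 x)\<^sup>2)"
  shows "integral (cbox (- (R *\<^sub>R One)) (R *\<^sub>R One)) (energy_density_dt R t) \<le>
    7 * energy R t + (LINT x|lebesgue. jbracket x ^ 6 * (dt l 1 x)\<^sup>2)"
proof -
  have sc: "continuous_on UNIV (energy_density_dt R t)"
    by (rule cont_slice[OF cont_energy_density_dt[OF R]])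
  have ss: "energy_density_dt R t x = 0" if "x \<notin> cbox (- (R *\<^sub>R One)) (R *\<^sub>R One)" for x
    using cone_weight_support[OF R t that] by (simp add: energy_density_dt_def cone_weight_dt_eq_0)
  note e = continuous_cbox_support_integral[OF sc ss]
  have i1: "integrable lebesgue (\<lambda>x. 7 * (cone_weight R t x * energy_square t x))"
    by (intro integrable_mult_right cone_weight_mult_integral R t cont_slice[OF cont_energy_square])
  have "(LINT x|lebesgue. energy_density_dt R t x) =
      (LINT x|lebesgue. energy_density_dt R t x - 2 * (\<Sum>b\<in>Basis. flux_div R t b x))"
    using e(1) flux_div_integral[OF R t] by simp
  also have "\<dots> \<le> (LINT x|lebesgue. 7 * (cone_weight R t x * energy_square t x) + jbracket x ^ 6 * (dt l 1 x)\<^sup>2)"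
  proof (rule integral_mono)
    show "integrable lebesgue (\<lambda>x. energy_density_dt R t x - 2 * (\<Sum>b\<in>Basis. flux_div R t b x))"
      using e(1) flux_div_integral[OF R t] by (intro Bochner_Integration.integrable_diff integrable_mult_right Bochner_Integration.integrable_sum) auto
    show "integrable lebesgue (\<lambda>x. 7 * (cone_weight R t x * energy_square t x) + jbracket x ^ 6 * (dt l 1 x)\<^sup>2)"
      by (intro Bochner_Integration.integrable_add i1 K)
    fix x
    have "cone_weight R t x * (dt l 1 x)\<^sup>2 \<le> jbracket x ^ 6 * (dt l 1 x)\<^sup>2"
      by (intro mult_right_mono cone_weight_le R t) auto
    then show "energy_density_dt R t x - 2 * (\<Sum>b\<in>Basis. flux_div R t b x) \<le>
        7 * (cone_weight R t x * energy_square t x) + jbracket x ^ 6 * (dt l 1 x)\<^sup>2"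
      using energy_density_dt_le[OF R, of t x] by linarith
  qed
  also have "\<dots> = 7 * energy R t + (LINT x|lebesgue. jbracket x ^ 6 * (dt l 1 x)\<^sup>2)"
    using i1 K by (simp add: energy_def)
  finally show ?thesis using e(2) by simp
qed

text \<open>Gronwall: E' <= 7 E + K says that (E + K / 7) exp (- 7 s) does not increase.\<close>

lemma energy_bound:
  assumes R: "R > 0" and t: "t \<ge> 1"
    and K0: "integrable lebesgue (\<lambda>x. jbracket x ^ 6 * (l 1 x)\<^sup>2)"
    and K1: "integrable lebesgue (\<lambda>x. jbracket x ^ 6 * (dt l 1 x)\<^sup>2)"
  shows "energy R t \<le> ((LINT x|lebesgue. jbracket x ^ 6 * (l 1 x)\<^sup>2) +
    (LINT x|lebesgue. jbracket x ^ 6 * (dt l 1 x)\<^sup>2)) * exp (7 * (t - 1))"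
proof -
  define K where "K = (LINT x|lebesgue. jbracket x ^ 6 * (dt l 1 x)\<^sup>2)"
  have Kpos: "K \<ge> 0"
    unfolding K_def using jbracket_pos by (intro integral_nonneg_AE) (auto simp: less_imp_le)
  let ?F = "\<lambda>s. (energy R s + K / 7) * exp (- 7 * s)"
  have "?F t \<le> ?F 1"
  proof (rule DERIV_nonpos_imp_nonincreasing[OF t])
    fix s :: real assume s: "1 \<le> s" "s \<le> t"
    let ?E = "integral (cbox (- (R *\<^sub>R One)) (R *\<^sub>R One)) (energy_density_dt R s)"
    have "(?F has_real_derivative (?E * exp (- 7 * s) + (energy R s + K / 7) * (exp (- 7 * s) * (- 7)))) (at s)"
      using s R by (auto intro!: derivative_eq_intros energy_derivative)
    moreover have "?E * exp (- 7 * s) + (energy R s + K / 7) * (exp (- 7 * s) * (- 7)) =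
        (?E - 7 * energy R s - K) * exp (- 7 * s)" by (simp add: algebra_simps)
    moreover have "\<dots> \<le> 0"
      using energy_growth[OF R _ K1, of s] s by (intro mult_nonpos_nonneg) (auto simp: K_def)
    ultimately show "\<exists>y. (?F has_real_derivative y) (at s) \<and> y \<le> 0"
      by (intro exI[of _ "?E * exp (- 7 * s) + (energy R s + K / 7) * (exp (- 7 * s) * (- 7))"]) simp
  qed
  then have "?F t * exp (7 * t) \<le> ?F 1 * exp (7 * t)" by (intro mult_right_mono) auto
  moreover have "exp (- 7 * t) * exp (7 * t) = 1" "exp (- 7 * 1) * exp (7 * t) = exp (7 * (t - 1))"
    by (simp_all add: exp_add[symmetric] algebra_simps)
  ultimately have "energy R t + K / 7 \<le> (energy R 1 + K / 7) * exp (7 * (t - 1))"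
    by (simp only: mult.assoc mult_1_right)
  also have "energy R 1 \<le> (LINT x|lebesgue. jbracket x ^ 6 * (l 1 x)\<^sup>2)"
    unfolding energy_def
  proof (rule integral_mono[OF _ K0])
    show "integrable lebesgue (\<lambda>x. cone_weight R 1 x * energy_square 1 x)"
      by (intro cone_weight_mult_integral R cont_slice[OF cont_energy_square]) auto
    show "cone_weight R 1 x * energy_square 1 x \<le> jbracket x ^ 6 * (l 1 x)\<^sup>2" for x
      using cone_weight_le[OF R, of 1 x] by (simp add: energy_square_def mult_right_mono)
  qed
  finally have "energy R t + K / 7 \<le> ((LINT x|lebesgue. jbracket x ^ 6 * (l 1 x)\<^sup>2) + K / 7) * exp (7 * (t - 1))"
    by simp
  moreover have "K / 7 * exp (7 * (t - 1)) \<le> K * exp (7 * (t - 1))"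
    using Kpos by (intro mult_right_mono) auto
  ultimately show ?thesis using Kpos unfolding K_def[symmetric] distrib_right by linarith
qed

text \<open>Let the cone open: the weights increase to \<open>\<langle>x\<rangle>\<^sup>6\<close> as \<open>R \<rightarrow> \<infinity>\<close>.\<close>

lemma weighted_square_integrable:
  assumes t: "t \<ge> 1"
    and K0: "integrable lebesgue (\<lambda>x. jbracket x ^ 6 * (l 1 x)\<^sup>2)"
    and K1: "integrable lebesgue (\<lambda>x. jbracket x ^ 6 * (dt l 1 x)\<^sup>2)"
  shows "integrable lebesgue (\<lambda>x. jbracket x ^ 6 * (l t x)\<^sup>2)"
    "(LINT x|lebesgue. jbracket x ^ 6 * (l t x)\<^sup>2) \<le> ((LINT x|lebesgue. jbracket x ^ 6 * (l 1 x)\<^sup>2) +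
      (LINT x|lebesgue. jbracket x ^ 6 * (dt l 1 x)\<^sup>2)) * exp (7 * (t - 1))"
proof -
  define C where "C = ((LINT x|lebesgue. jbracket x ^ 6 * (l 1 x)\<^sup>2) +
      (LINT x|lebesgue. jbracket x ^ 6 * (dt l 1 x)\<^sup>2)) * exp (7 * (t - 1))"
  define f where "f n x = cone_weight (real (Suc n)) t x * (l t x)\<^sup>2" for n x
  have cl2: "continuous_on UNIV (\<lambda>x. (l t x)\<^sup>2)"
    by (intro continuous_intros cont_slice[of l] cont_l)
  have f_int: "integrable lebesgue (f n)" for n
    unfolding f_def[abs_def] using t cl2 by (intro cone_weight_mult_integral) auto
  have f_mono: "f m x \<le> f n x" if "m \<le> n" for m n x
  proof -
    have "(jbracket x + t) / real (Suc n) \<le> (jbracket x + t) / real (Suc m)"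
      using that t jbracket_pos[of x] by (intro divide_left_mono) auto
    then have "(max 0 (1 - (jbracket x + t) / real (Suc m)))\<^sup>2 \<le> (max 0 (1 - (jbracket x + t) / real (Suc n)))\<^sup>2"
      by (intro power_mono) auto
    then show ?thesis unfolding f_def cone_weight_def using jbracket_pos[of x]
      by (intro mult_right_mono mult_left_mono) auto
  qed
  have f_bound: "(LINT x|lebesgue. f n x) \<le> C" for n
  proof -
    have "(LINT x|lebesgue. f n x) \<le> energy (real (Suc n)) t"
      unfolding energy_def
    proof (rule integral_mono[OF f_int])
      show "integrable lebesgue (\<lambda>x. cone_weight (real (Suc n)) t x * energy_square t x)"
        using t by (intro cone_weight_mult_integral cont_slice[OF cont_energy_square]) auto
      show "f n x \<le> cone_weight (real (Suc n)) t x * energy_square t x" for x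
        unfolding f_def energy_square_def
        by (intro mult_left_mono cone_weight_nonneg) (simp add: sum_nonneg)
    qed
    also have "\<dots> \<le> C" unfolding C_def by (intro energy_bound t K0 K1) auto
    finally show ?thesis .
  qed
  have f_lim: "(\<lambda>n. f n x) \<longlonglongrightarrow> jbracket x ^ 6 * (l t x)\<^sup>2" for x
  proof -
    have "(\<lambda>n. (jbracket x + t) * inverse (real (Suc n))) \<longlonglongrightarrow> (jbracket x + t) * 0"
      by (intro tendsto_intros LIMSEQ_inverse_real_of_nat)
    then have "(\<lambda>n. jbracket x ^ 6 * (max 0 (1 - (jbracket x + t) * inverse (real (Suc n))))\<^sup>2 * (l t x)\<^sup>2)
        \<longlonglongrightarrow> jbracket x ^ 6 * (max 0 (1 - 0))\<^sup>2 * (l t x)\<^sup>2"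
      by (intro tendsto_intros) auto
    then show ?thesis by (simp add: f_def cone_weight_def divide_inverse)
  qed
  have inc: "incseq (\<lambda>n. LINT x|lebesgue. f n x)"
    by (intro incseq_SucI integral_mono f_int f_mono) auto
  then obtain I where I: "(\<lambda>n. LINT x|lebesgue. f n x) \<longlonglongrightarrow> I"
    using incseq_convergent f_bound by blast
  have hb: "has_bochner_integral lebesgue (\<lambda>x. jbracket x ^ 6 * (l t x)\<^sup>2) I"
  proof (rule has_bochner_integral_monotone_convergence[where f = f])
    show "AE x in lebesgue. mono (\<lambda>n. f n x)" by (intro AE_I2 monoI f_mono)
    show "(\<lambda>x. jbracket x ^ 6 * (l t x)\<^sup>2) \<in> borel_measurable lebesgue"
      by (rule borel_measurable_LIMSEQ_real[where u = f]) (use f_lim f_int in auto)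
  qed (use f_int f_lim I in auto)
  then show "integrable lebesgue (\<lambda>x. jbracket x ^ 6 * (l t x)\<^sup>2)"
    by (simp add: has_bochner_integral_iff)
  show "(LINT x|lebesgue. jbracket x ^ 6 * (l t x)\<^sup>2) \<le> ((LINT x|lebesgue. jbracket x ^ 6 * (l 1 x)\<^sup>2) +
      (LINT x|lebesgue. jbracket x ^ 6 * (dt l 1 x)\<^sup>2)) * exp (7 * (t - 1))"
    using hb LIMSEQ_le_const2[OF I] f_bound unfolding C_def[symmetric]
    by (auto simp: has_bochner_integral_iff)
qed

end

section \<open>Integration along rays\<close>

text \<open>A substitute for polar coordinates: instead of over the unit sphere, the rays are averaged
  over the annulus \<open>1 \<le> \<bar>z\<bar> \<le> 2\<close>. The weight \<open>\<bar>z\<bar>\<close> gives the total mass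
  \<open>\<integral> \<bar>x\<bar> / \<rho>\<^sup>2 d\<rho> = 1\<close> over the \<open>\<rho>\<close> with \<open>\<bar>x\<bar> / 2 \<le> \<rho> \<le> \<bar>x\<bar>\<close>.\<close>

definition ray_kernel :: "'a::euclidean_space \<Rightarrow> real \<Rightarrow> real" where
  "ray_kernel z \<rho> = indicator {z. 1 \<le> norm z \<and> norm z \<le> 2} z * norm z * (indicator {0<..} \<rho> * \<rho> ^ (DIM('a) - 1))"

lemma ray_kernel_nonneg: "0 \<le> ray_kernel z \<rho>"
  by (auto simp: ray_kernel_def indicator_def)

lemma ray_kernel_measurable [measurable]:
  fixes f :: "'c \<Rightarrow> 'a::euclidean_space"
  assumes [measurable]: "f \<in> borel_measurable M" "g \<in> borel_measurable M"
  shows "(\<lambda>p. ray_kernel (f p) (g p)) \<in> borel_measurable M"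
  unfolding ray_kernel_def by measurable

text \<open>Exchange the integrals and substitute x = \<rho> z at fixed \<rho>, with Jacobian
  \<rho>^d: the kernel turns into |x| / \<rho>^2, whose \<rho>-integral is 1 for every x other than
  0.\<close>

lemma nn_integral_rays:
  fixes F :: "'a::euclidean_space \<Rightarrow> ennreal"
  assumes [measurable]: "F \<in> borel_measurable borel"
  shows "(\<integral>\<^sup>+z. \<integral>\<^sup>+\<rho>. ennreal (ray_kernel z \<rho>) * F (\<rho> *\<^sub>R z) \<partial>lborel \<partial>lborel) = (\<integral>\<^sup>+x. F x \<partial>lborel)"
proof -
  define d where "d = DIM('a)"
  have d: "d > 0" by (simp add: d_def)
  have "(\<integral>\<^sup>+z. \<integral>\<^sup>+\<rho>. ennreal (ray_kernel z \<rho>) * F (\<rho> *\<^sub>R z) \<partial>lborel \<partial>lborel) =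
      (\<integral>\<^sup>+\<rho>. \<integral>\<^sup>+z. ennreal (ray_kernel z \<rho>) * F (\<rho> *\<^sub>R z) \<partial>lborel \<partial>lborel)"
    by (intro lborel_pair.Fubini') (simp add: split_def)
  also have "\<dots> = (\<integral>\<^sup>+\<rho>. \<integral>\<^sup>+x. ennreal (if norm x / 2 \<le> \<rho> \<and> \<rho> \<le> norm x \<and> 0 < \<rho> then norm x / \<rho>\<^sup>2 else 0) * F x \<partial>lborel \<partial>lborel)"
  proof (rule nn_integral_cong)
    fix \<rho> :: real
    show "(\<integral>\<^sup>+z. ennreal (ray_kernel z \<rho>) * F (\<rho> *\<^sub>R z) \<partial>lborel) =
      (\<integral>\<^sup>+x. ennreal (if norm x / 2 \<le> \<rho> \<and> \<rho> \<le> norm x \<and> 0 < \<rho> then norm x / \<rho>\<^sup>2 else 0) * F x \<partial>lborel)" (is "_ = nn_integral _ ?G")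
    proof (cases "\<rho> > 0")
      case True
      have G: "?G \<in> borel_measurable borel" by measurable
      have "(\<integral>\<^sup>+x. ?G x \<partial>lborel) = (\<integral>\<^sup>+x. ?G x \<partial>density (distr lborel borel (\<lambda>x. 0 + \<rho> *\<^sub>R x)) (\<lambda>_. ennreal (\<bar>\<rho>\<bar> ^ d)))"
        using True lborel_affine[of \<rho> "0::'a"] by (simp add: d_def)
      also have "\<dots> = (\<integral>\<^sup>+z. ennreal (\<rho> ^ d) * ?G (\<rho> *\<^sub>R z) \<partial>lborel)"
        using True G by (subst nn_integral_density) (auto simp: nn_integral_distr)
      also have "\<dots> = (\<integral>\<^sup>+z. ennreal (ray_kernel z \<rho>) * F (\<rho> *\<^sub>R z) \<partial>lborel)"
      proof (rule nn_integral_cong)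
        fix z :: 'a
        have "\<rho> ^ d * (norm (\<rho> *\<^sub>R z) / \<rho>\<^sup>2) = norm z * \<rho> ^ (d - 1)"
          using True d by (cases d) (auto simp: field_simps power2_eq_square)
        then have "\<rho> ^ d * (if norm (\<rho> *\<^sub>R z) / 2 \<le> \<rho> \<and> \<rho> \<le> norm (\<rho> *\<^sub>R z) \<and> 0 < \<rho> then norm (\<rho> *\<^sub>R z) / \<rho>\<^sup>2 else 0) = ray_kernel z \<rho>"
          unfolding ray_kernel_def d_def[symmetric] using True by (auto simp: indicator_def field_simps)
        then show "ennreal (\<rho> ^ d) * ?G (\<rho> *\<^sub>R z) = ennreal (ray_kernel z \<rho>) * F (\<rho> *\<^sub>R z)"
          using True by (subst mult.assoc[symmetric], subst ennreal_mult'[symmetric]) auto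
      qed
      finally show ?thesis by simp
    qed (simp add: ray_kernel_def)
  qed
  also have "\<dots> = (\<integral>\<^sup>+x. \<integral>\<^sup>+\<rho>. ennreal (if norm x / 2 \<le> \<rho> \<and> \<rho> \<le> norm x \<and> 0 < \<rho> then norm x / \<rho>\<^sup>2 else 0) * F x \<partial>lborel \<partial>lborel)"
    by (intro lborel_pair.Fubini') (simp add: split_def)
  also have "\<dots> = (\<integral>\<^sup>+x. F x \<partial>lborel)"
  proof (rule nn_integral_cong_AE)
    have "AE x in lborel. x \<noteq> (0::'a)" by (rule AE_lborel_singleton)
    then show "AE x in lborel. (\<integral>\<^sup>+\<rho>. ennreal (if norm x / 2 \<le> \<rho> \<and> \<rho> \<le> norm x \<and> 0 < \<rho> then norm x / \<rho>\<^sup>2 else 0) * F x \<partial>lborel) = F x"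
    proof eventually_elim
      case (elim x)
      have "(\<integral>\<^sup>+\<rho>. ennreal (norm x / \<rho>\<^sup>2) * indicator {norm x / 2..norm x} \<rho> \<partial>lborel) =
          ennreal (- norm x / norm x - (- norm x / (norm x / 2)))"
      proof (rule nn_integral_FTC_Icc)
        fix \<rho> assume "\<rho> \<in> {norm x / 2..norm x}"
        then have "norm x \<le> 2 * \<rho>" by simp
        then have "\<rho> > 0" using zero_less_norm_iff[of x] elim by linarith
        then show "((\<lambda>\<rho>. - norm x / \<rho>) has_real_derivative norm x / \<rho>\<^sup>2) (at \<rho>)"
          by (auto intro!: derivative_eq_intros simp: power2_eq_square)
      qed auto
      also have "\<dots> = 1" using elim by simp
      also have "(\<integral>\<^sup>+\<rho>. ennreal (norm x / \<rho>\<^sup>2) * indicator {norm x / 2..norm x} \<rho> \<partial>lborel) =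
          (\<integral>\<^sup>+\<rho>. ennreal (if norm x / 2 \<le> \<rho> \<and> \<rho> \<le> norm x \<and> 0 < \<rho> then norm x / \<rho>\<^sup>2 else 0) \<partial>lborel)"
        using elim by (intro nn_integral_cong) (use zero_less_norm_iff[of x] in \<open>auto simp: indicator_def\<close>)
      finally show ?case by (subst nn_integral_multc) auto
    qed
  qed
  finally show ?thesis .
qed

text \<open>As an identity of measures the ray formula yields integrability and the value of the
  integral for signed functions at once.\<close>

lemma lborel_rays:
  "distr (density (lborel \<Otimes>\<^sub>M lborel) (\<lambda>p. ennreal (ray_kernel (fst p) (snd p)))) borel (\<lambda>p. snd p *\<^sub>R fst p)
    = (lborel :: 'a::euclidean_space measure)" (is "?D = _")
proof (rule measure_eqI)
  fix A :: "'a set" assume "A \<in> sets ?D"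
  then have [measurable]: "A \<in> sets borel" by simp
  have m: "(\<lambda>p. snd p *\<^sub>R fst p) \<in> (lborel \<Otimes>\<^sub>M lborel) \<rightarrow>\<^sub>M (borel :: 'a measure)" by measurable
  have "emeasure ?D A = (\<integral>\<^sup>+x. indicator A x \<partial>?D)" by simp
  also have "\<dots> = (\<integral>\<^sup>+p. ennreal (ray_kernel (fst p) (snd p)) * indicator A (snd p *\<^sub>R fst p) \<partial>(lborel \<Otimes>\<^sub>M lborel))"
    using m by (subst nn_integral_distr) (auto simp: nn_integral_density)
  also have "\<dots> = (\<integral>\<^sup>+z. \<integral>\<^sup>+\<rho>. ennreal (ray_kernel z \<rho>) * indicator A (\<rho> *\<^sub>R z) \<partial>lborel \<partial>lborel)"
    by (subst lborel.nn_integral_fst[symmetric]) auto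
  also have "\<dots> = emeasure lborel A" by (subst nn_integral_rays) auto
  finally show "emeasure ?D A = emeasure lborel A" .
qed simp

lemma integral_rays:
  fixes F :: "'a::euclidean_space \<Rightarrow> real"
  assumes "integrable lborel F"
  shows "integrable lborel (\<lambda>z. LINT \<rho>|lborel. ray_kernel z \<rho> * F (\<rho> *\<^sub>R z))"
    "(LINT z|lborel. LINT \<rho>|lborel. ray_kernel z \<rho> * F (\<rho> *\<^sub>R z)) = (LINT x|lborel. F x)"
proof -
  have [measurable]: "F \<in> borel_measurable borel" using assms by simp
  let ?P = "(lborel :: 'a measure) \<Otimes>\<^sub>M (lborel :: real measure)"
  let ?D = "density ?P (\<lambda>p. ennreal (ray_kernel (fst p) (snd p)))"
  have "integrable (distr ?D borel (\<lambda>p. snd p *\<^sub>R fst p)) F" using assms by (simp add: lborel_rays)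
  then have "integrable ?D (\<lambda>p. F (snd p *\<^sub>R fst p))" by (subst (asm) integrable_distr_eq) auto
  then have i: "integrable ?P (\<lambda>p. ray_kernel (fst p) (snd p) * F (snd p *\<^sub>R fst p))"
    by (subst (asm) integrable_density) (auto simp: ray_kernel_nonneg)
  show "integrable lborel (\<lambda>z. LINT \<rho>|lborel. ray_kernel z \<rho> * F (\<rho> *\<^sub>R z))"
    using lborel_pair.integrable_fst'[OF i] by simp
  have "(LINT x|lborel. F x) = (LINT x|distr ?D borel (\<lambda>p. snd p *\<^sub>R fst p). F x)"
    by (simp add: lborel_rays)
  also have "\<dots> = (LINT p|?D. F (snd p *\<^sub>R fst p))" by (subst integral_distr) auto
  also have "\<dots> = (LINT p|?P. ray_kernel (fst p) (snd p) * F (snd p *\<^sub>R fst p))"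
    by (subst integral_density) (auto simp: ray_kernel_nonneg)
  also have "\<dots> = (LINT z|lborel. LINT \<rho>|lborel. ray_kernel z \<rho> * F (\<rho> *\<^sub>R z))"
    using lborel_pair.integral_fst'[OF i] by simp
  finally show "(LINT z|lborel. LINT \<rho>|lborel. ray_kernel z \<rho> * F (\<rho> *\<^sub>R z)) = (LINT x|lborel. F x)" ..
qed

section \<open>Weighted square integrability\<close>

text \<open>Along each ray the integrand is at most 2 \<rho> / (1 + \<rho>^2)^2, with primitive - 1
  / (1 + \<rho>^2) and total mass 1; the integral is therefore at most the area of the disc of
  radius 2.\<close>

lemma integrable_inverse_jbracket_power4: "integrable lebesgue (\<lambda>x::real^2. 1 / jbracket x ^ 4)"
proof -
  have m[measurable]: "(\<lambda>x::real^2. 1 / jbracket x ^ 4) \<in> borel_measurable borel"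
    unfolding jbracket_def by measurable
  have "(\<integral>\<^sup>+x. ennreal (1 / jbracket x ^ 4) \<partial>(lborel :: (real^2) measure)) =
      (\<integral>\<^sup>+z. \<integral>\<^sup>+\<rho>. ennreal (ray_kernel (z::real^2) \<rho>) * ennreal (1 / jbracket (\<rho> *\<^sub>R z) ^ 4) \<partial>lborel \<partial>lborel)"
    by (subst nn_integral_rays) auto
  also have "\<dots> \<le> (\<integral>\<^sup>+z. \<integral>\<^sup>+\<rho>. indicator (cball (0::real^2) 2) z * (ennreal (2 * \<rho> / (1 + \<rho>\<^sup>2)\<^sup>2) * indicator {0..} \<rho>) \<partial>lborel \<partial>lborel)"
  proof (intro nn_integral_mono)
    fix z :: "real^2" and \<rho> :: real
    have "ray_kernel z \<rho> * (1 / jbracket (\<rho> *\<^sub>R z) ^ 4) \<le> 2 * \<rho> / (1 + \<rho>\<^sup>2)\<^sup>2"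
      if z: "1 \<le> norm z" "norm z \<le> 2" and \<rho>: "\<rho> > 0"
    proof -
      have "jbracket (\<rho> *\<^sub>R z) ^ 4 = (1 + \<rho>\<^sup>2 * (norm z)\<^sup>2)\<^sup>2"
        using jbracket_square[of "\<rho> *\<^sub>R z"] power_mult[of "jbracket (\<rho> *\<^sub>R z)" 2 2] by (simp add: power_mult_distrib)
      moreover have "\<rho>\<^sup>2 * 1 \<le> \<rho>\<^sup>2 * (norm z)\<^sup>2"
        using z by (intro mult_left_mono one_le_power) auto
      ultimately have "(1 + \<rho>\<^sup>2)\<^sup>2 \<le> jbracket (\<rho> *\<^sub>R z) ^ 4" by (simp add: power_mono)
      moreover have "0 < (1 + \<rho>\<^sup>2)\<^sup>2" using zero_le_power2[of \<rho>] by (intro zero_less_power) linarith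
      ultimately show ?thesis using z \<rho>
        by (auto simp: ray_kernel_def intro!: frac_le mult_right_mono)
    qed
    then show "ennreal (ray_kernel z \<rho>) * ennreal (1 / jbracket (\<rho> *\<^sub>R z) ^ 4) \<le>
        indicator (cball (0::real^2) 2) z * (ennreal (2 * \<rho> / (1 + \<rho>\<^sup>2)\<^sup>2) * indicator {0..} \<rho>)"
      by (subst ennreal_mult'[symmetric])
        (use jbracket_pos[of "\<rho> *\<^sub>R z"] in \<open>auto simp: ray_kernel_def indicator_def less_imp_le intro!: ennreal_leI split: if_splits\<close>)
  qed
  also have "\<dots> = emeasure lborel (cball (0::real^2) 2)"
  proof -
    have lim: "((\<lambda>\<rho>::real. - (1 / (1 + \<rho>\<^sup>2))) \<longlongrightarrow> - 0) at_top"
      by (intro tendsto_minus tendsto_divide_0[OF tendsto_const] filterlim_at_top_imp_at_infinity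
          filterlim_tendsto_add_at_top[OF tendsto_const] filterlim_pow_at_top filterlim_ident) auto
    have "(\<integral>\<^sup>+\<rho>. ennreal (2 * \<rho> / (1 + \<rho>\<^sup>2)\<^sup>2) * indicator {0..} \<rho> \<partial>lborel) = ennreal (0 - - (1 / (1 + 0\<^sup>2)))"
    proof (rule nn_integral_FTC_atLeast)
      fix \<rho> :: real assume "0 \<le> \<rho>"
      have "1 + \<rho>\<^sup>2 \<noteq> 0" using zero_le_power2[of \<rho>] by linarith
      then show "((\<lambda>\<rho>. - (1 / (1 + \<rho>\<^sup>2))) has_real_derivative 2 * \<rho> / (1 + \<rho>\<^sup>2)\<^sup>2) (at \<rho>)"
        by (auto intro!: derivative_eq_intros simp: power2_eq_square)
    qed (use lim in auto)
    then show ?thesis by (simp add: nn_integral_cmult)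
  qed
  also have "\<dots> < \<infinity>" by (rule emeasure_lborel_cball_finite)
  finally have "integrable lborel (\<lambda>x::real^2. 1 / jbracket x ^ 4)"
    using jbracket_pos by (intro integrableI_nonneg m AE_I2) (auto simp: less_imp_le)
  then show ?thesis using m by (subst integrable_completion) auto
qed

text \<open>Young's inequality for the factors <x>^(-2) and <x>^3 |f|: the square of the first is
  integrable in the plane. The extra factor \<open>jbracket x\<close> is what controls the Fourier
  transform linearly near frequency 0.\<close>

lemma weighted_L1:
  fixes f :: "real^2 \<Rightarrow> real"
  assumes f: "f \<in> borel_measurable lebesgue" and i: "integrable lebesgue (\<lambda>x. jbracket x ^ 6 * (f x)\<^sup>2)"
  shows "integrable lebesgue (\<lambda>x. jbracket x * \<bar>f x\<bar>)"
    "(LINT x|lebesgue. jbracket x * \<bar>f x\<bar>) \<le>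
      (LINT x|(lebesgue :: (real^2) measure). 1 / jbracket x ^ 4) + (LINT x|lebesgue. jbracket x ^ 6 * (f x)\<^sup>2)"
    "integrable lebesgue f" "(LINT x|lebesgue. \<bar>f x\<bar>) \<le> (LINT x|lebesgue. jbracket x * \<bar>f x\<bar>)"
proof -
  have mj: "(jbracket :: real^2 \<Rightarrow> real) \<in> borel_measurable lebesgue"
    by (intro continuous_lebesgue_measurable continuous_intros)
  have le: "jbracket x * \<bar>f x\<bar> \<le> 1 / jbracket x ^ 4 + jbracket x ^ 6 * (f x)\<^sup>2" for x
  proof -
    let ?q = "jbracket x"
    have q: "?q > 0" by (rule jbracket_pos)
    have "2 * (1 / ?q\<^sup>2) * (?q ^ 3 * \<bar>f x\<bar>) \<le> (1 / ?q\<^sup>2)\<^sup>2 + (?q ^ 3 * \<bar>f x\<bar>)\<^sup>2"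
      by (rule sum_squares_bound)
    moreover have "2 * (1 / ?q\<^sup>2) * (?q ^ 3 * \<bar>f x\<bar>) = 2 * (?q * \<bar>f x\<bar>)"
      using q by (simp add: field_simps eval_nat_numeral)
    moreover have "(1 / ?q\<^sup>2)\<^sup>2 = 1 / ?q ^ 4" "(?q ^ 3 * \<bar>f x\<bar>)\<^sup>2 = ?q ^ 6 * (f x)\<^sup>2"
      by (simp_all add: power_divide power_mult_distrib power_mult[symmetric])
    moreover have "?q * \<bar>f x\<bar> \<ge> 0" using q by simp
    ultimately show ?thesis by linarith
  qed
  have s: "integrable lebesgue (\<lambda>x. 1 / jbracket x ^ 4 + jbracket x ^ 6 * (f x)\<^sup>2)"
    by (intro Bochner_Integration.integrable_add integrable_inverse_jbracket_power4 i)
  show 1: "integrable lebesgue (\<lambda>x. jbracket x * \<bar>f x\<bar>)"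
  proof (rule Bochner_Integration.integrable_bound[OF s])
    show "(\<lambda>x. jbracket x * \<bar>f x\<bar>) \<in> borel_measurable lebesgue" using mj f by measurable
    show "AE x in lebesgue. norm (jbracket x * \<bar>f x\<bar>) \<le> norm (1 / jbracket x ^ 4 + jbracket x ^ 6 * (f x)\<^sup>2)"
    proof (rule AE_I2)
      fix x :: "real^2"
      have "norm (jbracket x * \<bar>f x\<bar>) = jbracket x * \<bar>f x\<bar>" using jbracket_pos[of x] by (simp add: abs_mult)
      also have "\<dots> \<le> norm (1 / jbracket x ^ 4 + jbracket x ^ 6 * (f x)\<^sup>2)"
        unfolding real_norm_def by (rule order_trans[OF le abs_ge_self])
      finally show "norm (jbracket x * \<bar>f x\<bar>) \<le> norm (1 / jbracket x ^ 4 + jbracket x ^ 6 * (f x)\<^sup>2)" .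
    qed
  qed
  have "(LINT x|lebesgue. jbracket x * \<bar>f x\<bar>) \<le> (LINT x|lebesgue. 1 / jbracket x ^ 4 + jbracket x ^ 6 * (f x)\<^sup>2)"
    by (intro integral_mono 1 s le)
  then show "(LINT x|lebesgue. jbracket x * \<bar>f x\<bar>) \<le>
      (LINT x|(lebesgue :: (real^2) measure). 1 / jbracket x ^ 4) + (LINT x|lebesgue. jbracket x ^ 6 * (f x)\<^sup>2)"
    using integrable_inverse_jbracket_power4 i by simp
  have f1: "\<bar>f x\<bar> \<le> jbracket x * \<bar>f x\<bar>" for x
    using mult_right_mono[OF jbracket_ge_1[of x], of "\<bar>f x\<bar>"] by simp
  show 2: "integrable lebesgue f"
  proof (rule Bochner_Integration.integrable_bound[OF 1 f], rule AE_I2)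
    fix x
    show "norm (f x) \<le> norm (jbracket x * \<bar>f x\<bar>)"
      using order_trans[OF f1 abs_ge_self] by simp
  qed
  show "(LINT x|lebesgue. \<bar>f x\<bar>) \<le> (LINT x|lebesgue. jbracket x * \<bar>f x\<bar>)"
    by (intro integral_mono 1 f1 integrable_abs 2)
qed

text \<open>In the application \<open>u\<close> is a continuous slice of the solution or of its time
  derivative; it agrees almost everywhere with the representative to which the weighted bound
  applies.\<close>

lemma in_wsobolev_weighted_square_integrable:
  assumes \<psi>: "radial_cutoff \<psi>" and n: "in_wsobolev m n" and u: "AE x in lebesgue. u x = n x"
    and um: "u \<in> borel_measurable lebesgue"
  shows "integrable lebesgue (\<lambda>x. jbracket x ^ 6 * (u x)\<^sup>2)"
proof -
  let ?g = "weak_diff (0, 0) n"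
  have "(\<exists>g. has_weak_diff (0, 0) n g)" and sq: "square_integrable (weighted_diff (0, 0) n)"
    using n[unfolded in_wsobolev_def, rule_format, of "(0, 0)"] by (auto simp: mi_order_def)
  then have "has_weak_diff (0, 0) n ?g" unfolding weak_diff_def by (simp add: someI_ex)
  from weak_diff_order_zero[OF \<psi> this] u have "AE x in lebesgue. u x = ?g x" by eventually_elim simp
  then have "AE x in lebesgue. (weighted_diff (0, 0) n x)\<^sup>2 = jbracket x ^ 6 * (u x)\<^sup>2"
    by eventually_elim (simp add: weighted_diff_def mi_order_def power_mult_distrib power_mult[symmetric])
  moreover have "(jbracket :: real^2 \<Rightarrow> real) \<in> borel_measurable lebesgue"
    by (intro continuous_lebesgue_measurable continuous_intros)
  ultimately show ?thesis
    using sq um integrable_cong_AE[of "\<lambda>x. (weighted_diff (0, 0) n x)\<^sup>2" lebesgue "\<lambda>x. jbracket x ^ 6 * (u x)\<^sup>2"]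
    by (auto simp: square_integrable_def)
qed

section \<open>The Fourier transform of the solution\<close>

lemma continuous_times_cbox_support_integral:
  fixes g k :: "'a::euclidean_space \<Rightarrow> real"
  assumes "continuous_on UNIV g" "continuous_on UNIV k" "\<And>x. x \<notin> cbox a b \<Longrightarrow> k x = 0"
  shows "integrable lebesgue (\<lambda>x. g x * k x)" "(LINT x|lebesgue. g x * k x) = integral (cbox a b) (\<lambda>x. g x * k x)"
  using continuous_cbox_support_integral[of "\<lambda>x. g x * k x" a b] assms
  by (auto intro!: continuous_intros)

lemma pairing_derivative:
  fixes f f' :: "real \<Rightarrow> real^2 \<Rightarrow> real"
  assumes f: "continuous_on UNIV (\<lambda>z. f (fst z) (snd z))" "continuous_on UNIV (\<lambda>z. f' (fst z) (snd z))"
    and d: "\<And>t x. ((\<lambda>t. f t x) has_real_derivative f' t x) (at t)"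
    and k: "continuous_on UNIV k" "\<And>x. x \<notin> cbox a b \<Longrightarrow> k x = 0"
  shows "((\<lambda>t. LINT x|lebesgue. f t x * k x) has_real_derivative (LINT x|lebesgue. f' t x * k x)) (at t)"
proof -
  have c: "continuous_on UNIV (f t)" "continuous_on UNIV (f' t)" for t
    using joint_continuous[OF f(1), of UNIV "\<lambda>_. t" "\<lambda>x. x"] joint_continuous[OF f(2), of UNIV "\<lambda>_. t" "\<lambda>x. x"]
    by (auto intro: continuous_intros)
  have "((\<lambda>t. integral (cbox a b) (\<lambda>x. f t x * k x)) has_field_derivative
      integral (cbox a b) (\<lambda>x. f' t x * k x)) (at t within UNIV)"
  proof (rule leibniz_rule_field_derivative)
    show "((\<lambda>t. f t x * k x) has_real_derivative f' t x * k x) (at t within UNIV)" for t x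
      using DERIV_cmult_right[OF d] by simp
    show "(\<lambda>x. f t x * k x) integrable_on cbox a b" for t
      by (intro integrable_continuous continuous_on_mult continuous_on_subset[OF c(1)] continuous_on_subset[OF k(1)]) auto
    have "continuous_on (UNIV \<times> cbox a b) (\<lambda>z. k (snd z))"
      by (intro continuous_on_compose2[OF k(1)] continuous_intros) auto
    then show "continuous_on (UNIV \<times> cbox a b) (\<lambda>(t, x). f' t x * k x)"
      unfolding split_def by (intro continuous_on_mult continuous_on_subset[OF f(2)]) auto
  qed auto
  then show ?thesis
    by (simp add: continuous_times_cbox_support_integral(2)[OF c(1) k] continuous_times_cbox_support_integral(2)[OF c(2) k])
qed

context classical_wave
begin

text \<open>Green's formula: the difference of the integrands in direction \<open>b\<close> is the
  derivative along \<open>b\<close> of \<open>D b t x * k x - l t x * k1 b x\<close>, which is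
  supported in the box.\<close>

lemma pairing_laplacian:
  fixes k :: "real^2 \<Rightarrow> real"
  assumes k: "\<And>b. b \<in> Basis \<Longrightarrow> has_ddiff b k (k1 b)" "\<And>b. b \<in> Basis \<Longrightarrow> has_ddiff b (k1 b) (k2 b)"
    and c: "continuous_on UNIV k" "\<And>b. b \<in> Basis \<Longrightarrow> continuous_on UNIV (k1 b)" "\<And>b. b \<in> Basis \<Longrightarrow> continuous_on UNIV (k2 b)"
    and s: "\<And>x. x \<notin> cbox p q \<Longrightarrow> k x = 0"
  shows "(LINT x|lebesgue. (\<Sum>b\<in>Basis. DD b t x) * k x) = (LINT x|lebesgue. l t x * (\<Sum>b\<in>Basis. k2 b x))"
proof -
  have s1: "k1 b x = 0" if "b \<in> Basis" "x \<notin> cbox p q" for b x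
    by (rule has_ddiff_eq_0[OF k(1)[OF that(1)] closed_cbox s that(2)])
  have s2: "k2 b x = 0" if "b \<in> Basis" "x \<notin> cbox p q" for b x
    by (rule has_ddiff_eq_0[OF k(2)[OF that(1)] closed_cbox s1[OF that(1)] that(2)])
  have eq: "(LINT x|lebesgue. DD b t x * k x) = (LINT x|lebesgue. l t x * k2 b x)" if b: "b \<in> Basis" for b
  proof -
    have "has_ddiff b (\<lambda>x. D b t x * k x + (- 1) * (l t x * k1 b x))
        (\<lambda>x. (DD b t x * k x + D b t x * k1 b x) + (- 1) * (D b t x * k1 b x + l t x * k2 b x))"
      using b by (intro has_ddiff_add has_ddiff_cmult has_ddiff_mult ddiff_D ddiff_l k)
    then have "has_ddiff b (\<lambda>x. D b t x * k x - l t x * k1 b x) (\<lambda>x. DD b t x * k x - l t x * k2 b x)"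
      by (simp add: algebra_simps)
    then have "(LINT x|lebesgue. DD b t x * k x - l t x * k2 b x) = 0"
      by (rule integral_ddiff_eq_0(2)[where a = p and b = q])
        (use s s1 b in \<open>auto intro!: continuous_intros c cont_slice[of l] cont_slice[of "D b"] cont_slice[of "DD b"] cont_l cont_D cont_DD\<close>)
    moreover have "integrable lebesgue (\<lambda>x. DD b t x * k x)" "integrable lebesgue (\<lambda>x. l t x * k2 b x)"
      using continuous_times_cbox_support_integral(1)[OF cont_slice[OF cont_DD[OF b]] c(1) s]
        continuous_times_cbox_support_integral(1)[OF cont_slice[OF cont_l] c(3)[OF b] s2[OF b]] by auto
    ultimately show ?thesis by simp
  qed
  have "(LINT x|lebesgue. (\<Sum>b\<in>Basis. DD b t x) * k x) = (\<Sum>b\<in>Basis. LINT x|lebesgue. DD b t x * k x)"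
    unfolding sum_distrib_right
    by (intro Bochner_Integration.integral_sum continuous_times_cbox_support_integral(1)[OF cont_slice[OF cont_DD] c(1) s])
  also have "\<dots> = (\<Sum>b\<in>Basis. LINT x|lebesgue. l t x * k2 b x)" by (intro sum.cong refl eq)
  also have "\<dots> = (LINT x|lebesgue. l t x * (\<Sum>b\<in>Basis. k2 b x))"
    unfolding sum_distrib_left
    by (intro Bochner_Integration.integral_sum[symmetric] continuous_times_cbox_support_integral(1)[OF cont_slice[OF cont_l] c(3) s2])
  finally show ?thesis .
qed

lemma cont_laplacian: "continuous_on UNIV (\<lambda>z. \<Sum>b\<in>Basis. DD b (fst z) (snd z))"
  by (intro continuous_intros cont_DD)

text \<open>Duhamel's formula for the ordinary differential equation satisfied by the pairing with a
  truncated plane wave, whose Laplacian is \<open>- a\<^sup>2 k\<close> up to the error \<open>r\<close>.\<close>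

lemma pairing_duhamel:
  fixes k :: "real^2 \<Rightarrow> real"
  assumes k: "\<And>b. b \<in> Basis \<Longrightarrow> has_ddiff b k (k1 b)" "\<And>b. b \<in> Basis \<Longrightarrow> has_ddiff b (k1 b) (k2 b)"
    and c: "continuous_on UNIV k" "\<And>b. b \<in> Basis \<Longrightarrow> continuous_on UNIV (k1 b)" "\<And>b. b \<in> Basis \<Longrightarrow> continuous_on UNIV (k2 b)"
    and s: "\<And>x. x \<notin> cbox p q \<Longrightarrow> k x = 0"
    and r: "\<And>x. (\<Sum>b\<in>Basis. k2 b x) = - (a\<^sup>2) * k x + r x" "\<And>x. \<bar>r x\<bar> \<le> \<delta>"
    and a: "a > 0" and t: "t \<ge> 1"
    and C: "\<And>s. s \<in> {1..t} \<Longrightarrow> integrable lebesgue (l s)" "\<And>s. s \<in> {1..t} \<Longrightarrow> (LINT x|lebesgue. \<bar>l s x\<bar>) \<le> C"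
  shows "\<bar>(LINT x|lebesgue. l t x * k x) - (cos ((t - 1) * a) * (LINT x|lebesgue. l 1 x * k x)
    + sin ((t - 1) * a) / a * (LINT x|lebesgue. dt l 1 x * k x))\<bar> \<le> (t - 1) * (\<delta> * C / a)"
proof -
  define G where "G s = (LINT x|lebesgue. l s x * k x)" for s
  define G' where "G' s = (LINT x|lebesgue. dt l s x * k x)" for s
  define e where "e s = (LINT x|lebesgue. l s x * r x)" for s
  have dG: "(G has_real_derivative G' s) (at s)" for s
    unfolding G_def[abs_def] G'_def by (rule pairing_derivative[OF cont_l cont_dt dt_l c(1) s])
  have dG': "(G' has_real_derivative - (a\<^sup>2) * G s + e s) (at s)" if "s \<in> {1..t}" for s
  proof -
    have "(G' has_real_derivative (LINT x|lebesgue. (\<Sum>b\<in>Basis. DD b s x) * k x)) (at s)"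
      unfolding G'_def[abs_def] by (rule pairing_derivative[OF cont_dt cont_laplacian dt_dt_l c(1) s])
    also have "(LINT x|lebesgue. (\<Sum>b\<in>Basis. DD b s x) * k x) = (LINT x|lebesgue. l s x * (- (a\<^sup>2) * k x + r x))"
      using pairing_laplacian[OF k c s] by (simp add: r(1))
    also have "\<dots> = - (a\<^sup>2) * G s + e s"
    proof -
      have i1: "integrable lebesgue (\<lambda>x. l s x * k x)"
        by (rule continuous_times_cbox_support_integral(1)[OF cont_slice[OF cont_l] c(1) s])
      have r_eq: "r = (\<lambda>x. (\<Sum>b\<in>Basis. k2 b x) + a\<^sup>2 * k x)" using r(1) by (auto simp: fun_eq_iff)
      have "continuous_on UNIV r" unfolding r_eq by (intro continuous_intros c)
      then have "r \<in> borel_measurable lebesgue" by (rule continuous_lebesgue_measurable)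
      then have i2: "integrable lebesgue (\<lambda>x. l s x * r x)"
        using C(1)[OF that]
      proof (intro Bochner_Integration.integrable_bound[OF integrable_mult_right[OF C(1)[OF that], of \<delta>]] AE_I2)
        fix x
        have "\<bar>r x\<bar> \<le> \<bar>\<delta>\<bar>" using r(2)[of x] by linarith
        then show "norm (l s x * r x) \<le> norm (\<delta> * l s x)"
          by (simp add: abs_mult mult.commute[of "\<bar>l s _\<bar>"] mult_right_mono)
      qed auto
      have "(LINT x|lebesgue. l s x * (- (a\<^sup>2) * k x + r x)) = (LINT x|lebesgue. - (a\<^sup>2) * (l s x * k x) + l s x * r x)"
        by (simp add: algebra_simps)
      also have "\<dots> = - (a\<^sup>2) * G s + e s" unfolding G_def e_def using i1 i2 by (subst Bochner_Integration.integral_add) auto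
      finally show ?thesis .
    qed
    finally show ?thesis .
  qed
  have e_bound: "\<bar>e s\<bar> \<le> \<delta> * C" if "s \<in> {1..t}" for s
  proof -
    have \<delta>: "\<delta> \<ge> 0" using r(2)[of 0] by linarith
    have "\<bar>e s\<bar> \<le> (LINT x|lebesgue. \<bar>l s x * r x\<bar>)" unfolding e_def by (rule integral_abs_bound)
    also have "\<dots> \<le> (LINT x|lebesgue. \<delta> * \<bar>l s x\<bar>)"
      using C(1)[OF that] r(2) by (intro integral_mono_AE' integrable_mult_right integrable_abs AE_I2)
        (auto simp: abs_mult mult.commute[of "\<bar>l s _\<bar>"] \<delta> intro!: mult_right_mono)
    also have "\<dots> \<le> \<delta> * C" using C(2)[OF that] \<delta> by (simp add: mult_left_mono)
    finally show ?thesis .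
  qed
  \<comment> \<open>Variation of constants: the derivative of \<open>H\<close> contains only the
    error term, while \<open>H\<close> equals the exact pairing at s = t and the free evolution of
    the initial pairings at s = 1.\<close>
  define H where "H s = G' s * (sin ((t - s) * a) / a) + G s * cos ((t - s) * a)" for s
  have dH: "(H has_real_derivative e s * (sin ((t - s) * a) / a)) (at s within {1..t})" if "s \<in> {1..t}" for s
  proof -
    have "(H has_real_derivative (- (a\<^sup>2) * G s + e s) * (sin ((t - s) * a) / a) + G' s * (cos ((t - s) * a) * (- a) / a)
        + (G' s * cos ((t - s) * a) + G s * (- sin ((t - s) * a) * (- a)))) (at s)"
      unfolding H_def[abs_def] using a by (auto intro!: derivative_eq_intros dG dG'[OF that]) (simp add: field_simps)
    moreover have "(- (a\<^sup>2) * G s + e s) * (sin ((t - s) * a) / a) + G' s * (cos ((t - s) * a) * (- a) / a)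
        + (G' s * cos ((t - s) * a) + G s * (- sin ((t - s) * a) * (- a))) = e s * (sin ((t - s) * a) / a)"
    proof -
      have "(- (a\<^sup>2) * x + z) * (y / a) + w * (c * (- a) / a) + (w * c + x * (- y * (- a))) = z * (y / a)"
        for w x y z c :: real
        using a by (simp add: field_simps power2_eq_square)
      then show ?thesis .
    qed
    ultimately show ?thesis by (simp add: has_field_derivative_at_within)
  qed
  have "norm (H t - H 1) \<le> \<delta> * C / a * norm (t - 1)"
  proof (rule field_differentiable_bound[OF convex_real_interval(5) dH])
    fix s assume s: "s \<in> {1..t}"
    have "\<bar>e s * (sin ((t - s) * a) / a)\<bar> = \<bar>e s\<bar> * \<bar>sin ((t - s) * a)\<bar> / a" using a by (simp add: abs_mult)
    also have "\<dots> \<le> (\<delta> * C) * 1 / a"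
      using a e_bound[OF s] order_trans[OF abs_ge_zero e_bound[OF s]] by (intro divide_right_mono mult_mono) auto
    finally show "norm (e s * (sin ((t - s) * a) / a)) \<le> \<delta> * C / a" by simp
  qed (use t in auto)
  then show ?thesis using t by (simp add: H_def G_def G'_def mult_ac)
qed

end

section \<open>Plane waves truncated by the cutoff at growing scales\<close>

lemma has_ddiff_scale:
  assumes "has_ddiff b f f'"
  shows "has_ddiff b (\<lambda>x. f (c *\<^sub>R x)) (\<lambda>x. c * f' (c *\<^sub>R x))"
  unfolding has_ddiff_def
proof
  fix z
  have "((\<lambda>r. f (c *\<^sub>R z + (c * r) *\<^sub>R b)) has_real_derivative f' (c *\<^sub>R z + (c * 0) *\<^sub>R b) * c) (at 0)"
    by (rule DERIV_chain2[where f = "\<lambda>r. f (c *\<^sub>R z + r *\<^sub>R b)", OF has_ddiffD[OF assms]])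
      (auto intro!: derivative_eq_intros)
  then show "((\<lambda>r. f (c *\<^sub>R (z + r *\<^sub>R b))) has_real_derivative c * f' (c *\<^sub>R z)) (at 0)"
    by (simp add: scaleR_add_right mult.commute)
qed

lemma has_ddiff_plane_wave:
  "has_ddiff b (\<lambda>x. cos (x \<bullet> \<eta> + d)) (\<lambda>x. - sin (x \<bullet> \<eta> + d) * (b \<bullet> \<eta>))"
  "has_ddiff b (\<lambda>x. - sin (x \<bullet> \<eta> + d) * (b \<bullet> \<eta>)) (\<lambda>x. - cos (x \<bullet> \<eta> + d) * (b \<bullet> \<eta>) * (b \<bullet> \<eta>))"
proof -
  have i: "((\<lambda>r. (z + r *\<^sub>R b) \<bullet> \<eta> + d) has_real_derivative b \<bullet> \<eta>) (at 0)" for z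
    unfolding inner_add_left inner_scaleR_left by (auto intro!: derivative_eq_intros)
  show "has_ddiff b (\<lambda>x. cos (x \<bullet> \<eta> + d)) (\<lambda>x. - sin (x \<bullet> \<eta> + d) * (b \<bullet> \<eta>))"
    using DERIV_fun_cos[OF i] by (simp add: has_ddiff_def)
  show "has_ddiff b (\<lambda>x. - sin (x \<bullet> \<eta> + d) * (b \<bullet> \<eta>)) (\<lambda>x. - cos (x \<bullet> \<eta> + d) * (b \<bullet> \<eta>) * (b \<bullet> \<eta>))"
    using DERIV_cmult_right[OF DERIV_minus[OF DERIV_fun_sin[OF i]], where c = "b \<bullet> \<eta>"] by (simp add: has_ddiff_def)
qed

lemma radial_cutoff_smooth_facts:
  assumes \<psi>: "radial_cutoff \<psi>" and b: "b \<in> Basis" and c: "c \<in> Basis"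
  shows "has_ddiff v \<psi> (pdiff v \<psi>)" "has_ddiff v (pdiff b \<psi>) (pdiff v (pdiff b \<psi>))"
    "continuous_on UNIV \<psi>" "continuous_on UNIV (pdiff b \<psi>)" "continuous_on UNIV (pdiff c (pdiff b \<psi>))"
    "\<And>x. norm x > 2 \<Longrightarrow> pdiff b \<psi> x = 0" "\<exists>B. \<forall>x. \<bar>pdiff b \<psi> x\<bar> \<le> B" "\<exists>B. \<forall>x. \<bar>pdiff c (pdiff b \<psi>) x\<bar> \<le> B"
proof -
  have "Ck 2 \<psi>" using radial_cutoffD(1)[OF \<psi>] by (simp add: smooth_def)
  then have d0: "\<And>x. \<psi> differentiable (at x)" and d1: "\<And>x. pdiff b \<psi> differentiable (at x)"
    and 5: "continuous_on UNIV (pdiff c (pdiff b \<psi>))"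
    using b c by (auto simp: numeral_2_eq_2)
  show 1: "has_ddiff v \<psi> (pdiff v \<psi>)" and 2: "has_ddiff v (pdiff b \<psi>) (pdiff v (pdiff b \<psi>))" for v
    by (intro has_ddiff_pdiff d0 d1)+
  show 3: "continuous_on UNIV \<psi>" and 4: "continuous_on UNIV (pdiff b \<psi>)"
    using d0 d1 by (auto simp: continuous_on_eq_continuous_at intro: differentiable_imp_continuous_within)
  show "continuous_on UNIV (pdiff c (pdiff b \<psi>))" by (rule 5)
  have s0: "\<psi> x = 0" if "x \<notin> cball 0 2" for x
    using that by (intro radial_cutoffD(6)[OF \<psi>]) simp
  have s1: "pdiff b \<psi> x = 0" if "x \<notin> cball 0 2" for x
    by (rule has_ddiff_eq_0[OF 1 closed_cball s0 that])
  have s2: "pdiff c (pdiff b \<psi>) x = 0" if "x \<notin> cball 0 2" for x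
    by (rule has_ddiff_eq_0[OF 2 closed_cball s1 that])
  show "\<And>x. norm x > 2 \<Longrightarrow> pdiff b \<psi> x = 0"
    using s1 by auto
  have bdd: "\<exists>B. \<forall>x. \<bar>f x\<bar> \<le> B" if f: "continuous_on UNIV f" "\<And>x. x \<notin> cball 0 2 \<Longrightarrow> f x = 0" for f :: "real^2 \<Rightarrow> real"
  proof -
    have "bounded (f ` cball 0 2)"
      by (intro compact_imp_bounded compact_continuous_image continuous_on_subset[OF f(1)] compact_cball) auto
    then obtain B where B: "\<And>x. x \<in> cball 0 2 \<Longrightarrow> \<bar>f x\<bar> \<le> B"
      unfolding bounded_iff by fastforce
    have "\<bar>f x\<bar> \<le> max B 0" for x using B[of x] f(2)[of x] by (cases "x \<in> cball 0 2") auto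
    then show ?thesis by blast
  qed
  show "\<exists>B. \<forall>x. \<bar>pdiff b \<psi> x\<bar> \<le> B" by (rule bdd[OF 4 s1])
  show "\<exists>B. \<forall>x. \<bar>pdiff c (pdiff b \<psi>) x\<bar> \<le> B" by (rule bdd[OF 5 s2])
qed

text \<open>The phase \<open>d\<close> lets one real family cover both parts of the complex
  exponential: \<open>d = 0\<close> gives the cosine and \<open>d = pi / 2\<close> minus the sine.
  The scale \<open>Suc n\<close> makes each derivative of the cutoff gain a factor 1 / (n +
  1).\<close>

definition cut_wave :: "(real^2 \<Rightarrow> real) \<Rightarrow> nat \<Rightarrow> real^2 \<Rightarrow> real \<Rightarrow> real^2 \<Rightarrow> real" where
  "cut_wave \<psi> n \<eta> d x = \<psi> ((1 / real (Suc n)) *\<^sub>R x) * cos (x \<bullet> \<eta> + d)"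

lemma cut_wave_integral_tendsto:
  assumes \<psi>: "radial_cutoff \<psi>" and f: "integrable lebesgue f"
  shows "(\<lambda>n. LINT x|lebesgue. f x * cut_wave \<psi> n \<eta> d x) \<longlonglongrightarrow> (LINT x|lebesgue. f x * cos (x \<bullet> \<eta> + d))"
proof (rule integral_dominated_convergence[where w = "\<lambda>x. \<bar>f x\<bar>"])
  have c\<psi>: "continuous_on UNIV \<psi>" by (intro smooth_continuous radial_cutoffD(1) \<psi>)
  have fm: "f \<in> borel_measurable lebesgue" using f by simp
  have "continuous_on UNIV (\<lambda>x. cut_wave \<psi> n \<eta> d x)" for n
    unfolding cut_wave_def by (intro continuous_intros continuous_on_compose2[OF c\<psi>]) auto
  then show "(\<lambda>x. f x * cut_wave \<psi> n \<eta> d x) \<in> borel_measurable lebesgue" for n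
    by (intro borel_measurable_times fm continuous_lebesgue_measurable)
  have "continuous_on UNIV (\<lambda>x. cos (x \<bullet> \<eta> + d))" by (intro continuous_intros)
  then show "(\<lambda>x. f x * cos (x \<bullet> \<eta> + d)) \<in> borel_measurable lebesgue"
    by (intro borel_measurable_times fm continuous_lebesgue_measurable)
  show "integrable lebesgue (\<lambda>x. \<bar>f x\<bar>)" by (rule integrable_abs[OF f])
  show "AE x in lebesgue. norm (f x * cut_wave \<psi> n \<eta> d x) \<le> \<bar>f x\<bar>" for n
  proof (rule AE_I2)
    fix x
    have "\<bar>cut_wave \<psi> n \<eta> d x\<bar> \<le> 1 * 1" unfolding cut_wave_def abs_mult
      using radial_cutoffD(2,3)[OF \<psi>] by (intro mult_mono) auto
    then show "norm (f x * cut_wave \<psi> n \<eta> d x) \<le> \<bar>f x\<bar>" by (simp add: abs_mult mult_left_le)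
  qed
  show "AE x in lebesgue. (\<lambda>n. f x * cut_wave \<psi> n \<eta> d x) \<longlonglongrightarrow> f x * cos (x \<bullet> \<eta> + d)"
  proof (rule AE_I2)
    fix x :: "real^2"
    obtain N :: nat where N: "norm x \<le> real N" using real_arch_simple by blast
    have "cut_wave \<psi> n \<eta> d x = cos (x \<bullet> \<eta> + d)" if "n \<ge> N" for n
    proof -
      have "norm x \<le> real (Suc n)" using N that by simp
      then have "norm ((1 / real (Suc n)) *\<^sub>R x) \<le> 1" by (simp add: field_simps)
      then show ?thesis using radial_cutoffD(5)[OF \<psi>] by (simp add: cut_wave_def)
    qed
    then have "\<forall>\<^sub>F n in sequentially. f x * cut_wave \<psi> n \<eta> d x = f x * cos (x \<bullet> \<eta> + d)"
      by (intro eventually_mono[OF eventually_ge_at_top[of N]]) simp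
    then show "(\<lambda>n. f x * cut_wave \<psi> n \<eta> d x) \<longlonglongrightarrow> f x * cos (x \<bullet> \<eta> + d)" by (rule tendsto_eventually)
  qed
qed

locale decaying_wave = classical_wave +
  assumes K0: "integrable lebesgue (\<lambda>x. jbracket x ^ 6 * (l 1 x)\<^sup>2)"
    and K1: "integrable lebesgue (\<lambda>x. jbracket x ^ 6 * (dt l 1 x)\<^sup>2)"
begin

lemma l_measurable: "l t \<in> borel_measurable lebesgue" "dt l t \<in> borel_measurable lebesgue"
  by (intro continuous_lebesgue_measurable cont_slice[of l] cont_slice[of "dt l"] cont_l cont_dt)+

lemma l_integrable: "t \<ge> 1 \<Longrightarrow> integrable lebesgue (l t)"
  by (rule weighted_L1(3)[OF l_measurable(1) weighted_square_integrable(1)[OF _ K0 K1]])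

lemma u1_integrable: "integrable lebesgue (dt l 1)"
  by (rule weighted_L1(3)[OF l_measurable(2) K1])

text \<open>Uniformity in time is what the accumulated error in Duhamel's formula over [1, t]
  requires.\<close>

lemma l_L1_bounded: "\<exists>C. \<forall>s\<in>{1..t}. (LINT x|lebesgue. \<bar>l s x\<bar>) \<le> C"
proof (intro exI ballI)
  fix s assume s: "s \<in> {1..t}"
  define K where "K = (LINT x|lebesgue. jbracket x ^ 6 * (l 1 x)\<^sup>2) + (LINT x|lebesgue. jbracket x ^ 6 * (dt l 1 x)\<^sup>2)"
  have "0 \<le> K" unfolding K_def using jbracket_pos
    by (intro add_nonneg_nonneg integral_nonneg_AE AE_I2) (auto simp: less_imp_le)
  note w = weighted_square_integrable[of s, OF _ K0 K1, folded K_def]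
  have "(LINT x|lebesgue. \<bar>l s x\<bar>) \<le> (LINT x|lebesgue. jbracket x * \<bar>l s x\<bar>)"
    using s by (intro weighted_L1(4)[OF l_measurable(1)] w) auto
  also have "\<dots> \<le> (LINT x|(lebesgue :: (real^2) measure). 1 / jbracket x ^ 4) + (LINT x|lebesgue. jbracket x ^ 6 * (l s x)\<^sup>2)"
    using s by (intro weighted_L1(2)[OF l_measurable(1)] w) auto
  also have "\<dots> \<le> (LINT x|(lebesgue :: (real^2) measure). 1 / jbracket x ^ 4) + K * exp (7 * (s - 1))"
    using s w(2) by auto
  also have "\<dots> \<le> (LINT x|(lebesgue :: (real^2) measure). 1 / jbracket x ^ 4) + K * exp (7 * (t - 1))"
    using s \<open>0 \<le> K\<close> by (intro add_left_mono mult_left_mono) auto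
  finally show "(LINT x|lebesgue. \<bar>l s x\<bar>) \<le> (LINT x|(lebesgue :: (real^2) measure). 1 / jbracket x ^ 4) +
     ((LINT x|lebesgue. jbracket x ^ 6 * (l 1 x)\<^sup>2) + (LINT x|lebesgue. jbracket x ^ 6 * (dt l 1 x)\<^sup>2)) * exp (7 * (t - 1))"
    unfolding K_def .
qed

text \<open>For a truncated wave the formula holds up to the commutator of the Laplacian with the
  cutoff, which is O(1 / n) uniformly in x; dominated convergence then removes the
  truncation.\<close>

lemma plane_wave_pairing:
  assumes \<psi>: "radial_cutoff \<psi>" and \<eta>: "\<eta> \<noteq> 0" and t: "t \<ge> 1"
  shows "(LINT x|lebesgue. l t x * cos (x \<bullet> \<eta> + d)) =
    cos ((t - 1) * norm \<eta>) * (LINT x|lebesgue. l 1 x * cos (x \<bullet> \<eta> + d)) +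
    sin ((t - 1) * norm \<eta>) / norm \<eta> * (LINT x|lebesgue. dt l 1 x * cos (x \<bullet> \<eta> + d))"
proof -
  obtain C where C: "\<And>s. s \<in> {1..t} \<Longrightarrow> (LINT x|lebesgue. \<bar>l s x\<bar>) \<le> C" using l_L1_bounded by metis
  have "\<exists>B. \<forall>b\<in>Basis. \<forall>x. \<bar>pdiff b \<psi> x\<bar> \<le> B b" "\<exists>B. \<forall>b\<in>Basis. \<forall>x. \<bar>pdiff b (pdiff b \<psi>) x\<bar> \<le> B b"
    using radial_cutoff_smooth_facts(7,8)[OF \<psi>] by (intro bchoice ballI; blast)+
  then obtain B1 B2 where B1: "\<And>b x. b \<in> Basis \<Longrightarrow> \<bar>pdiff b \<psi> x\<bar> \<le> B1 b"
    and B2: "\<And>b x. b \<in> Basis \<Longrightarrow> \<bar>pdiff b (pdiff b \<psi>) x\<bar> \<le> B2 b" by metis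
  define M where "M = (\<Sum>b\<in>Basis. B2 b + 2 * B1 b * \<bar>b \<bullet> \<eta>\<bar>)"
  define E where "E n = \<bar>(LINT x|lebesgue. l t x * cut_wave \<psi> n \<eta> d x) -
      (cos ((t - 1) * norm \<eta>) * (LINT x|lebesgue. l 1 x * cut_wave \<psi> n \<eta> d x)
    + sin ((t - 1) * norm \<eta>) / norm \<eta> * (LINT x|lebesgue. dt l 1 x * cut_wave \<psi> n \<eta> d x))\<bar>" for n
  have E: "E n \<le> (t - 1) * (M * inverse (real (Suc n)) * C / norm \<eta>)" for n
    unfolding E_def
  proof -
    let ?c = "1 / real (Suc n)"
    let ?P = "\<lambda>f x. f (?c *\<^sub>R x) :: real" and ?C = "\<lambda>x. cos (x \<bullet> \<eta> + d)" and ?S = "\<lambda>x. sin (x \<bullet> \<eta> + d)"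
    define k1 where "k1 b x = (?c * ?P (pdiff b \<psi>) x) * ?C x + ?P \<psi> x * (- ?S x * (b \<bullet> \<eta>))" for b x
    define k2 where "k2 b x = ((?c * (?c * ?P (pdiff b (pdiff b \<psi>)) x)) * ?C x + (?c * ?P (pdiff b \<psi>) x) * (- ?S x * (b \<bullet> \<eta>)))
       + ((?c * ?P (pdiff b \<psi>) x) * (- ?S x * (b \<bullet> \<eta>)) + ?P \<psi> x * (- ?C x * (b \<bullet> \<eta>) * (b \<bullet> \<eta>)))" for b x
    \<comment> \<open>The commutator terms: each contains at least one derivative of the cutoff and
      hence a factor \<open>?c\<close>; a second such factor is estimated by 1.\<close>
    define r where "r x = (\<Sum>b\<in>Basis. ?c * (?c * ?P (pdiff b (pdiff b \<psi>)) x * ?C x - 2 * ?P (pdiff b \<psi>) x * ?S x * (b \<bullet> \<eta>)))" for x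
    note f = radial_cutoff_smooth_facts[OF \<psi>]
    have cP: "continuous_on UNIV (\<lambda>x. ?P f x)" if "continuous_on UNIV f" for f :: "real^2 \<Rightarrow> real"
      by (rule continuous_on_compose2[OF that]) (rule linear_continuous_on[OF bounded_linear_scaleR_right], simp)
    have P0: "has_ddiff b (?P \<psi>) (\<lambda>x. ?c * ?P (pdiff b \<psi>) x)" if "b \<in> Basis" for b
      by (rule has_ddiff_scale[OF f(1)[OF that that]])
    have P1: "has_ddiff b (?P (pdiff b \<psi>)) (\<lambda>x. ?c * ?P (pdiff b (pdiff b \<psi>)) x)" if "b \<in> Basis" for b
      by (rule has_ddiff_scale[OF f(2)[OF that that]])
    show "\<bar>(LINT x|lebesgue. l t x * cut_wave \<psi> n \<eta> d x) -
      (cos ((t - 1) * norm \<eta>) * (LINT x|lebesgue. l 1 x * cut_wave \<psi> n \<eta> d x)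
    + sin ((t - 1) * norm \<eta>) / norm \<eta> * (LINT x|lebesgue. dt l 1 x * cut_wave \<psi> n \<eta> d x))\<bar> \<le>
      (t - 1) * (M * inverse (real (Suc n)) * C / norm \<eta>)"
    proof (rule pairing_duhamel[where ?k1.0 = k1 and ?k2.0 = k2 and r = r and
        p = "- ((2 * real (Suc n)) *\<^sub>R One)" and q = "(2 * real (Suc n)) *\<^sub>R One"])
      fix b :: "real^2" assume b: "b \<in> Basis"
      show "has_ddiff b (cut_wave \<psi> n \<eta> d) (k1 b)"
        unfolding cut_wave_def[abs_def] k1_def[abs_def]
        by (rule has_ddiff_mult[OF P0[OF b] has_ddiff_plane_wave(1)])
      show "has_ddiff b (k1 b) (k2 b)"
        unfolding k1_def[abs_def] k2_def[abs_def]
        by (rule has_ddiff_add[OF has_ddiff_mult[OF has_ddiff_cmult[OF P1[OF b]] has_ddiff_plane_wave(1)]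
              has_ddiff_mult[OF P0[OF b] has_ddiff_plane_wave(2)]])
      show "continuous_on UNIV (k1 b)" "continuous_on UNIV (k2 b)"
        unfolding k1_def[abs_def] k2_def[abs_def]
        by (intro continuous_intros cP f[OF b b])+
    next
      obtain b :: "real^2" where b: "b \<in> Basis" using nonempty_Basis by blast
      show "continuous_on UNIV (cut_wave \<psi> n \<eta> d)"
        unfolding cut_wave_def[abs_def] by (intro continuous_intros cP f(3)[OF b b])
    next
      fix x :: "real^2" assume "x \<notin> cbox (- ((2 * real (Suc n)) *\<^sub>R One)) ((2 * real (Suc n)) *\<^sub>R One)"
      then obtain i where i: "\<not> (- (2 * real (Suc n)) \<le> x $ i \<and> x $ i \<le> 2 * real (Suc n))"
        unfolding mem_box_cart by (auto simp del: of_nat_Suc)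
      then have "norm x \<ge> 2 * real (Suc n)" using component_le_norm_cart[of x i] by linarith
      then have "norm (?c *\<^sub>R x) \<ge> 2" by (simp add: field_simps)
      then show "cut_wave \<psi> n \<eta> d x = 0" using radial_cutoffD(6)[OF \<psi>] by (simp add: cut_wave_def)
    next
      fix x :: "real^2"
      have n2: "(norm \<eta>)\<^sup>2 = (\<Sum>b\<in>Basis. (b \<bullet> \<eta>) * (b \<bullet> \<eta>))"
        unfolding power2_norm_eq_inner by (subst euclidean_inner) (simp add: inner_commute)
      have "k2 b x = ?c * (?c * ?P (pdiff b (pdiff b \<psi>)) x * ?C x - 2 * ?P (pdiff b \<psi>) x * ?S x * (b \<bullet> \<eta>))
          - (b \<bullet> \<eta>) * (b \<bullet> \<eta>) * cut_wave \<psi> n \<eta> d x" for b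
        unfolding k2_def cut_wave_def by (simp add: algebra_simps)
      then show "(\<Sum>b\<in>Basis. k2 b x) = - ((norm \<eta>)\<^sup>2) * cut_wave \<psi> n \<eta> d x + r x"
        unfolding r_def n2 by (simp add: sum_subtractf sum_distrib_right)
      have c1: "0 < ?c" "?c \<le> 1" by simp_all
      have "\<bar>r x\<bar> \<le> (\<Sum>b\<in>Basis. ?c * (B2 b + 2 * B1 b * \<bar>b \<bullet> \<eta>\<bar>))"
        unfolding r_def
      proof (rule order_trans[OF sum_abs], rule sum_mono)
        fix b :: "real^2" assume b: "b \<in> Basis"
        have "\<bar>?c * ?P (pdiff b (pdiff b \<psi>)) x * ?C x\<bar> \<le> 1 * B2 b * 1"
          unfolding abs_mult using c1 B2[OF b] order_trans[OF abs_ge_zero B2[OF b]] by (intro mult_mono) auto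
        moreover have "\<bar>2 * ?P (pdiff b \<psi>) x * ?S x * (b \<bullet> \<eta>)\<bar> \<le> 2 * B1 b * 1 * \<bar>b \<bullet> \<eta>\<bar>"
          unfolding abs_mult using B1[OF b] order_trans[OF abs_ge_zero B1[OF b]] by (intro mult_mono) auto
        ultimately have "\<bar>?c * ?P (pdiff b (pdiff b \<psi>)) x * ?C x - 2 * ?P (pdiff b \<psi>) x * ?S x * (b \<bullet> \<eta>)\<bar>
            \<le> B2 b + 2 * B1 b * \<bar>b \<bullet> \<eta>\<bar>" by linarith
        then show "\<bar>?c * (?c * ?P (pdiff b (pdiff b \<psi>)) x * ?C x - 2 * ?P (pdiff b \<psi>) x * ?S x * (b \<bullet> \<eta>))\<bar>
            \<le> ?c * (B2 b + 2 * B1 b * \<bar>b \<bullet> \<eta>\<bar>)"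
          unfolding abs_mult[of ?c] abs_of_pos[OF c1(1)] using c1 by (intro mult_left_mono) auto
      qed
      also have "\<dots> = M * inverse (real (Suc n))" by (simp add: M_def sum_distrib_left[symmetric] divide_inverse)
      finally show "\<bar>r x\<bar> \<le> M * inverse (real (Suc n))" .
    qed (use \<eta> t C l_integrable in auto)
  qed
  have lim: "E \<longlonglongrightarrow> \<bar>(LINT x|lebesgue. l t x * cos (x \<bullet> \<eta> + d)) -
      (cos ((t - 1) * norm \<eta>) * (LINT x|lebesgue. l 1 x * cos (x \<bullet> \<eta> + d))
    + sin ((t - 1) * norm \<eta>) / norm \<eta> * (LINT x|lebesgue. dt l 1 x * cos (x \<bullet> \<eta> + d)))\<bar>" (is "E \<longlonglongrightarrow> \<bar>?L\<bar>")
    unfolding E_def[abs_def]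
    by (intro tendsto_intros cut_wave_integral_tendsto \<psi> l_integrable u1_integrable t order_refl)
  have "(\<lambda>n. (t - 1) * (M * inverse (real (Suc n)) * C / norm \<eta>)) \<longlonglongrightarrow> (t - 1) * (M * 0 * C / norm \<eta>)"
    using \<eta> by (intro tendsto_intros LIMSEQ_inverse_real_of_nat) auto
  with lim have "\<bar>?L\<bar> \<le> (t - 1) * (M * 0 * C / norm \<eta>)"
    by (rule LIMSEQ_le) (use E in blast)
  then show ?thesis by simp
qed

end

section \<open>Fourier transforms of integrable functions\<close>

lemma fourier_cos:
  assumes f: "integrable lebesgue f"
  shows "fourier f \<eta> = complex_of_real (LINT x|lebesgue. f x * cos (x \<bullet> \<eta> + 0)) +
    \<i> * complex_of_real (LINT x|lebesgue. f x * cos (x \<bullet> \<eta> + pi / 2))"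
proof -
  have i: "integrable lebesgue (\<lambda>x. f x * cos (x \<bullet> \<eta> + d))" for d
  proof (rule Bochner_Integration.integrable_bound[OF f])
    have "continuous_on UNIV (\<lambda>x. cos (x \<bullet> \<eta> + d))" by (intro continuous_intros)
    then show "(\<lambda>x. f x * cos (x \<bullet> \<eta> + d)) \<in> borel_measurable lebesgue"
      using f by (intro borel_measurable_times[OF borel_measurable_integrable] continuous_lebesgue_measurable)
    show "AE x in lebesgue. norm (f x * cos (x \<bullet> \<eta> + d)) \<le> norm (f x)"
      by (intro AE_I2) (simp add: abs_mult mult_left_le)
  qed
  have e: "complex_of_real (f x) * exp (- (\<i> * complex_of_real (x \<bullet> \<eta>))) =
      complex_of_real (f x * cos (x \<bullet> \<eta> + 0)) + \<i> * complex_of_real (f x * cos (x \<bullet> \<eta> + pi / 2))" for x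
    by (auto simp: complex_eq_iff Re_exp Im_exp cos_add)
  have "fourier f \<eta> = (LINT x|lebesgue. complex_of_real (f x * cos (x \<bullet> \<eta> + 0)) + \<i> * complex_of_real (f x * cos (x \<bullet> \<eta> + pi / 2)))"
    unfolding fourier_def e ..
  also have "\<dots> = (LINT x|lebesgue. complex_of_real (f x * cos (x \<bullet> \<eta> + 0))) +
      (LINT x|lebesgue. \<i> * complex_of_real (f x * cos (x \<bullet> \<eta> + pi / 2)))"
    by (intro Bochner_Integration.integral_add integrable_mult_right integrable_of_real i)
  finally show ?thesis by (simp only: integral_mult_right_zero integral_complex_of_real)
qed

lemma norm_fourier_le: "cmod (fourier f \<eta>) \<le> (LINT x|lebesgue. \<bar>f x\<bar>)"
  unfolding fourier_def by (rule order_trans[OF integral_norm_bound]) (simp add: norm_mult)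

lemma fourier_integrand_integrable:
  assumes f: "integrable lebesgue f"
  shows "integrable lebesgue (\<lambda>x. complex_of_real (f x) * exp (- (\<i> * complex_of_real (x \<bullet> \<eta>))))"
proof (rule Bochner_Integration.integrable_bound[OF f])
  have "continuous_on UNIV (\<lambda>x. exp (- (\<i> * complex_of_real (x \<bullet> \<eta>))))" by (intro continuous_intros)
  then show "(\<lambda>x. complex_of_real (f x) * exp (- (\<i> * complex_of_real (x \<bullet> \<eta>)))) \<in> borel_measurable lebesgue"
    using f by (intro borel_measurable_times[OF borel_measurable_integrable[OF integrable_of_real]]
        continuous_lebesgue_measurable)
qed (simp add: norm_mult)

text \<open>The bound |exp (i y) - 1| <= |y| with y = - x . \<eta> costs one factor |x|, which the
  weight \<open>jbracket x\<close> pays for.\<close>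

lemma fourier_at_0_diff:
  assumes f: "integrable lebesgue f" and w: "integrable lebesgue (\<lambda>x. jbracket x * \<bar>f x\<bar>)"
  shows "cmod (fourier f \<eta> - complex_of_real (LINT x|lebesgue. f x)) \<le> norm \<eta> * (LINT x|lebesgue. jbracket x * \<bar>f x\<bar>)"
proof -
  note i = fourier_integrand_integrable[OF f, of \<eta>]
  have "fourier f \<eta> - complex_of_real (LINT x|lebesgue. f x) =
      (LINT x|lebesgue. complex_of_real (f x) * exp (- (\<i> * complex_of_real (x \<bullet> \<eta>))) - complex_of_real (f x))"
    unfolding fourier_def using i f by (subst Bochner_Integration.integral_diff) auto
  also have "cmod \<dots> \<le> (LINT x|lebesgue. cmod (complex_of_real (f x) * exp (- (\<i> * complex_of_real (x \<bullet> \<eta>))) - complex_of_real (f x)))"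
    by (rule integral_norm_bound)
  also have "\<dots> \<le> (LINT x|lebesgue. norm \<eta> * (jbracket x * \<bar>f x\<bar>))"
  proof (rule integral_mono)
    show "integrable lebesgue (\<lambda>x. cmod (complex_of_real (f x) * exp (- (\<i> * complex_of_real (x \<bullet> \<eta>))) - complex_of_real (f x)))"
      using i f by (intro integrable_norm Bochner_Integration.integrable_diff integrable_of_real)
    show "integrable lebesgue (\<lambda>x. norm \<eta> * (jbracket x * \<bar>f x\<bar>))" by (intro integrable_mult_right w)
    fix x :: "real^2"
    have "cmod (exp (- (\<i> * complex_of_real (x \<bullet> \<eta>))) - 1) \<le> \<bar>x \<bullet> \<eta>\<bar>"
      using dist_exp_i_1[of "- (x \<bullet> \<eta>)"] abs_sin_x_le_abs_x[of "- (x \<bullet> \<eta>) / 2"] by simp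
    also have "\<dots> \<le> norm x * norm \<eta>" by (rule Cauchy_Schwarz_ineq2)
    also have "\<dots> \<le> jbracket x * norm \<eta>" by (intro mult_right_mono norm_le_jbracket) auto
    finally have "\<bar>f x\<bar> * cmod (exp (- (\<i> * complex_of_real (x \<bullet> \<eta>))) - 1) \<le> \<bar>f x\<bar> * (jbracket x * norm \<eta>)"
      by (rule mult_left_mono) simp
    moreover have "complex_of_real (f x) * exp (- (\<i> * complex_of_real (x \<bullet> \<eta>))) - complex_of_real (f x) =
        complex_of_real (f x) * (exp (- (\<i> * complex_of_real (x \<bullet> \<eta>))) - 1)" by (simp add: algebra_simps)
    ultimately show "cmod (complex_of_real (f x) * exp (- (\<i> * complex_of_real (x \<bullet> \<eta>))) - complex_of_real (f x)) \<le>
        norm \<eta> * (jbracket x * \<bar>f x\<bar>)" by (simp add: norm_mult mult_ac)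
  qed
  finally show ?thesis by simp
qed

lemma fourier_continuous:
  assumes f: "integrable lebesgue f"
  shows "continuous_on UNIV (fourier f)"
  unfolding continuous_on_sequentially
proof (intro allI ballI impI)
  fix \<eta> and \<eta>s :: "nat \<Rightarrow> real^2"
  assume "(\<forall>n. \<eta>s n \<in> UNIV) \<and> \<eta>s \<longlonglongrightarrow> \<eta>"
  then have lim: "\<eta>s \<longlonglongrightarrow> \<eta>" by simp
  show "(fourier f \<circ> \<eta>s) \<longlonglongrightarrow> fourier f \<eta>"
    unfolding fourier_def o_def
  proof (rule integral_dominated_convergence[where w = "\<lambda>x. \<bar>f x\<bar>"])
    show "AE x in lebesgue. (\<lambda>n. complex_of_real (f x) * exp (- (\<i> * complex_of_real (x \<bullet> \<eta>s n))))
        \<longlonglongrightarrow> complex_of_real (f x) * exp (- (\<i> * complex_of_real (x \<bullet> \<eta>)))"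
      by (intro AE_I2 tendsto_intros lim)
  qed (use f fourier_integrand_integrable[OF f] in \<open>auto simp: norm_mult intro: borel_measurable_integrable\<close>)
qed

text \<open>The pairings with phases 0 and pi / 2 are the real and imaginary parts. Frequency 0 is
  excluded because the quotient there has the default value 0 instead of the limit t - 1; a single
  point does not affect the integrals.\<close>

lemma (in decaying_wave) fourier_l:
  assumes \<psi>: "radial_cutoff \<psi>" and \<eta>: "\<eta> \<noteq> 0" and t: "t \<ge> 1"
  shows "fourier (l t) \<eta> = complex_of_real (cos ((t - 1) * norm \<eta>)) * fourier (l 1) \<eta> +
    complex_of_real (sin ((t - 1) * norm \<eta>) / norm \<eta>) * fourier (dt l 1) \<eta>"
  using plane_wave_pairing[OF \<psi> \<eta> t, of 0] plane_wave_pairing[OF \<psi> \<eta> t, of "pi / 2"]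
  unfolding fourier_cos[OF l_integrable[OF t]] fourier_cos[OF l_integrable[OF order_refl]] fourier_cos[OF u1_integrable]
  by (simp add: algebra_simps)

section \<open>The main term\<close>

lemma has_ddiff_components:
  fixes f :: "'a::euclidean_space \<Rightarrow> real"
  assumes "\<And>x. f differentiable (at x)"
  shows "has_ddiff z f (\<lambda>y. \<Sum>b\<in>Basis. (z \<bullet> b) * pdiff b f y)"
proof -
  have "pdiff z f = (\<lambda>y. \<Sum>b\<in>Basis. (z \<bullet> b) * pdiff b f y)"
  proof
    fix y
    have "pdiff z f y = frechet_derivative f (at y) z" by (rule pdiff_def)
    then show "pdiff z f y = (\<Sum>b\<in>Basis. (z \<bullet> b) * pdiff b f y)"
      by (simp only: pdiff_linear_sum[OF assms] real_scaleR_def)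
  qed
  then show ?thesis using has_ddiff_pdiff[OF assms, of z] by (simp only:)
qed

text \<open>The first two derivatives of the cutoff along a ray direction; the point is that one
  bound \<open>B\<close> serves all directions \<open>z\<close> of the annulus.\<close>

lemma radial_cutoff_ray:
  assumes \<psi>: "radial_cutoff \<psi>"
  obtains B where "B \<ge> 0" "\<And>z. norm z \<le> 2 \<Longrightarrow> \<exists>p1 p2. has_ddiff z \<psi> p1 \<and> has_ddiff z p1 p2 \<and>
    continuous_on UNIV p1 \<and> continuous_on UNIV p2 \<and> (\<forall>y. norm y > 2 \<longrightarrow> p1 y = 0) \<and> (\<forall>y. \<bar>p2 y\<bar> \<le> B)"
proof -
  note f = radial_cutoff_smooth_facts[OF \<psi>]
  have "\<forall>p\<in>Basis \<times> Basis. \<exists>B. \<forall>x. \<bar>pdiff (snd p) (pdiff (fst p) \<psi>) x\<bar> \<le> B"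
    using f(8) by auto
  then obtain B0 where "\<forall>p\<in>Basis \<times> Basis. \<forall>x. \<bar>pdiff (snd p) (pdiff (fst p) \<psi>) x\<bar> \<le> B0 p"
    using bchoice by metis
  then have B0: "\<bar>pdiff c (pdiff b \<psi>) x\<bar> \<le> B0 (b, c)" if "b \<in> Basis" "c \<in> Basis" for b c x
    using that by force
  define B where "B = (\<Sum>b\<in>Basis. \<Sum>c\<in>Basis. 2 * (2 * B0 (b, c)))"
  have "Ck 2 \<psi>" using radial_cutoffD(1)[OF \<psi>] by (simp add: smooth_def)
  then have d0: "\<And>x. \<psi> differentiable (at x)" and d1: "\<And>b x. b \<in> Basis \<Longrightarrow> pdiff b \<psi> differentiable (at x)"
    by (auto simp: numeral_2_eq_2)
  show ?thesis
  proof (rule that[of B])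
    show "B \<ge> 0" unfolding B_def
      using order_trans[OF abs_ge_zero B0] by (intro sum_nonneg mult_nonneg_nonneg) auto
    fix z :: "real^2" assume z: "norm z \<le> 2"
    define p1 where "p1 y = (\<Sum>b\<in>Basis. (z \<bullet> b) * pdiff b \<psi> y)" for y
    define p2 where "p2 y = (\<Sum>b\<in>Basis. (z \<bullet> b) * (\<Sum>c\<in>Basis. (z \<bullet> c) * pdiff c (pdiff b \<psi>) y))" for y
    have 1: "has_ddiff z \<psi> p1" unfolding p1_def[abs_def] by (rule has_ddiff_components[OF d0])
    have 2: "has_ddiff z p1 p2"
      unfolding p1_def[abs_def] p2_def[abs_def] has_ddiff_def
      using has_ddiff_components[OF d1, of _ z]
      by (intro allI DERIV_sum DERIV_cmult) (simp add: has_ddiff_def)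
    have 3: "continuous_on UNIV p1" unfolding p1_def[abs_def] by (intro continuous_intros f(4))
    have 4: "continuous_on UNIV p2" unfolding p2_def[abs_def] by (intro continuous_intros f(5))
    have 5: "p1 y = 0" if "norm y > 2" for y using that f(6) by (simp add: p1_def)
    have 6: "\<bar>p2 y\<bar> \<le> B" for y
      unfolding p2_def B_def sum_distrib_left
    proof (rule order_trans[OF sum_abs], rule sum_mono, rule order_trans[OF sum_abs], rule sum_mono)
      fix b c :: "real^2" assume b: "b \<in> Basis" and c: "c \<in> Basis"
      have "\<bar>z \<bullet> b\<bar> \<le> 2" "\<bar>z \<bullet> c\<bar> \<le> 2" using Basis_le_norm[OF b, of z] Basis_le_norm[OF c, of z] z by auto
      then show "\<bar>(z \<bullet> b) * ((z \<bullet> c) * pdiff c (pdiff b \<psi>) y)\<bar> \<le> 2 * (2 * B0 (b, c))"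
        unfolding abs_mult using B0[OF b c] by (intro mult_mono) auto
    qed
    show "\<exists>p1 p2. has_ddiff z \<psi> p1 \<and> has_ddiff z p1 p2 \<and> continuous_on UNIV p1 \<and> continuous_on UNIV p2 \<and>
        (\<forall>y. norm y > 2 \<longrightarrow> p1 y = 0) \<and> (\<forall>y. \<bar>p2 y\<bar> \<le> B)"
      using 1 2 3 4 5 6 by (intro exI[of _ p1] exI[of _ p2] conjI allI impI)
  qed
qed

text \<open>Two integrations by parts, packed into the primitive \<open>- \<phi> cos (a \<rho>) / a + \<phi>' sin (a \<rho>) / a\<^sup>2\<close>
  of \<open>(\<phi> + \<phi>'' / a\<^sup>2) sin (a \<rho>)\<close>.\<close>

lemma ray_oscillatory_integral:
  assumes \<psi>: "radial_cutoff \<psi>"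
  obtains B where "B \<ge> 0" "\<And>z a b. 1 \<le> norm z \<Longrightarrow> norm z \<le> 2 \<Longrightarrow> a > 0 \<Longrightarrow> b > 0 \<Longrightarrow>
    1 / a - 3 * b * B / a\<^sup>2 \<le> integral {0..3 / b} (\<lambda>\<rho>. \<psi> ((b * \<rho>) *\<^sub>R z) * sin (a * \<rho>))"
proof -
  obtain B where B: "B \<ge> 0" "\<And>z. norm z \<le> 2 \<Longrightarrow> \<exists>p1 p2. has_ddiff z \<psi> p1 \<and> has_ddiff z p1 p2 \<and>
    continuous_on UNIV p1 \<and> continuous_on UNIV p2 \<and> (\<forall>y. norm y > 2 \<longrightarrow> p1 y = 0) \<and> (\<forall>y. \<bar>p2 y\<bar> \<le> B)"
    using radial_cutoff_ray[OF \<psi>] by metis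
  show ?thesis
  proof (rule that[OF B(1)])
    fix z :: "real^2" and a b :: real
    assume z: "1 \<le> norm z" "norm z \<le> 2" and a: "a > 0" and b: "b > 0"
    obtain p1 p2 where p: "has_ddiff z \<psi> p1" "has_ddiff z p1 p2" "continuous_on UNIV p1" "continuous_on UNIV p2"
      "\<And>y. norm y > 2 \<Longrightarrow> p1 y = 0" "\<And>y. \<bar>p2 y\<bar> \<le> B" using B(2)[OF z(2)] by metis
    have c\<psi>: "continuous_on UNIV \<psi>" by (intro smooth_continuous radial_cutoffD(1) \<psi>)
    let ?\<phi> = "\<lambda>g \<rho>. g ((b * \<rho>) *\<^sub>R z) :: real"
    have ray: "((\<lambda>\<rho>. ?\<phi> g \<rho>) has_real_derivative ?\<phi> g' \<rho> * b) (at \<rho>)" if "has_ddiff z g g'" for g g' \<rho>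
    proof -
      have "((\<lambda>r. g (0 + r *\<^sub>R z)) has_real_derivative g' (0 + (b * \<rho>) *\<^sub>R z)) (at (b * \<rho>))"
        by (rule has_ddiffD[OF that])
      from DERIV_chain2[where f = "\<lambda>r. g (0 + r *\<^sub>R z)" and g = "\<lambda>\<rho>. b * \<rho>", OF this, of b]
      show ?thesis using DERIV_cmult_Id[of b \<rho>] by simp
    qed
    have cray: "continuous_on S (?\<phi> g)" if "continuous_on UNIV g" for g S
      by (rule continuous_on_compose2[OF that]) (auto intro!: continuous_intros)
    let ?\<Phi> = "\<lambda>\<rho>. - (?\<phi> \<psi> \<rho> * cos (a * \<rho>)) / a + b * ?\<phi> p1 \<rho> * sin (a * \<rho>) / a\<^sup>2"
    let ?f = "\<lambda>\<rho>. ?\<phi> \<psi> \<rho> * sin (a * \<rho>)" and ?g = "\<lambda>\<rho>. b\<^sup>2 / a\<^sup>2 * (?\<phi> p2 \<rho> * sin (a * \<rho>))"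
    have "((\<lambda>\<rho>. ?f \<rho> + ?g \<rho>) has_integral ?\<Phi> (3 / b) - ?\<Phi> 0) {0..3 / b}"
    proof (rule fundamental_theorem_of_calculus)
      show "0 \<le> 3 / b" using b by simp
      fix \<rho>
      have "((\<lambda>\<rho>. cos (a * \<rho>)) has_real_derivative - sin (a * \<rho>) * a) (at \<rho>)"
        "((\<lambda>\<rho>. sin (a * \<rho>)) has_real_derivative cos (a * \<rho>) * a) (at \<rho>)"
        by (auto intro!: derivative_eq_intros)
      note trig = this
      have "(?\<Phi> has_real_derivative - ((?\<phi> p1 \<rho> * b) * cos (a * \<rho>) + (- sin (a * \<rho>) * a) * ?\<phi> \<psi> \<rho>) / a +
          ((b * (?\<phi> p2 \<rho> * b)) * sin (a * \<rho>) + (cos (a * \<rho>) * a) * (b * ?\<phi> p1 \<rho>)) / a\<^sup>2) (at \<rho>)"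
        by (intro DERIV_add DERIV_cdivide DERIV_minus DERIV_mult DERIV_cmult ray[OF p(1)] ray[OF p(2)] trig)
      also have "- ((?\<phi> p1 \<rho> * b) * cos (a * \<rho>) + (- sin (a * \<rho>) * a) * ?\<phi> \<psi> \<rho>) / a +
          ((b * (?\<phi> p2 \<rho> * b)) * sin (a * \<rho>) + (cos (a * \<rho>) * a) * (b * ?\<phi> p1 \<rho>)) / a\<^sup>2 = ?f \<rho> + ?g \<rho>"
      proof -
        have "- ((u * b) * c + (- s * a) * w) / a + ((b * (q * b)) * s + (c * a) * (b * u)) / a\<^sup>2 = w * s + b\<^sup>2 / a\<^sup>2 * (q * s)"
          for u c w s q :: real using a by (simp add: field_simps power2_eq_square)
        then show ?thesis .
      qed
      finally show "(?\<Phi> has_vector_derivative ?f \<rho> + ?g \<rho>) (at \<rho> within {0..3 / b})"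
        by (simp add: has_real_derivative_iff_has_vector_derivative[symmetric] has_field_derivative_at_within)
    qed
    \<comment> \<open>At this end the argument has norm at least 3, beyond the support of the cutoff
      and of its derivative. The only boundary term is 1 / a, from \<rho> = 0.\<close>
    moreover have "?\<Phi> (3 / b) = 0"
    proof -
      have "norm ((b * (3 / b)) *\<^sub>R z) > 2" using z b by simp
      then show ?thesis using p(5) radial_cutoffD(6)[OF \<psi>] by (simp add: less_imp_le)
    qed
    moreover have "?\<Phi> 0 = - (1 / a)" using radial_cutoffD(5)[OF \<psi>, of 0] by simp
    ultimately have int: "((\<lambda>\<rho>. ?f \<rho> + ?g \<rho>) has_integral 0 - - (1 / a)) {0..3 / b}" by (simp only:)
    have if_: "?f integrable_on {0..3 / b}" "?g integrable_on {0..3 / b}"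
      by (intro integrable_continuous_interval continuous_intros cray c\<psi> p)+
    have "integral {0..3 / b} ?f + integral {0..3 / b} ?g = 1 / a"
      using integral_add[OF if_] integral_unique[OF int] by (simp only: diff_minus_eq_add add_0_left)
    \<comment> \<open>The remainder has size b^2 B / a^2 on an interval of length 3 / b, which
      leaves a single power of b.\<close>
    moreover have "\<bar>integral {0..3 / b} ?g\<bar> \<le> (b\<^sup>2 / a\<^sup>2 * B) * (3 / b - 0)"
      unfolding real_norm_def[symmetric]
    proof (rule integral_bound)
      show "continuous_on {0..3 / b} ?g" by (intro continuous_intros cray p)
      fix \<rho>
      have "\<bar>?\<phi> p2 \<rho> * sin (a * \<rho>)\<bar> \<le> B * 1" unfolding abs_mult using p(6) B(1) by (intro mult_mono) auto
      then have "b\<^sup>2 / a\<^sup>2 * \<bar>?\<phi> p2 \<rho> * sin (a * \<rho>)\<bar> \<le> b\<^sup>2 / a\<^sup>2 * B" by (intro mult_left_mono) auto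
      then show "norm (?g \<rho>) \<le> b\<^sup>2 / a\<^sup>2 * B" by (simp add: abs_mult)
    qed (use b in auto)
    moreover have "(b\<^sup>2 / a\<^sup>2 * B) * (3 / b - 0) = 3 * b * B / a\<^sup>2"
      using b by (simp add: power2_eq_square)
    ultimately show "1 / a - 3 * b * B / a\<^sup>2 \<le> integral {0..3 / b} ?f" by linarith
  qed
qed

text \<open>The real part of the frequency integrand with 0 and 1 in place of the transforms of the
  two data.\<close>

definition main_integrand :: "(real^2 \<Rightarrow> real) \<Rightarrow> real^2 \<Rightarrow> real \<Rightarrow> real^2 \<Rightarrow> real" where
  "main_integrand \<psi> v s \<eta> = \<psi> ((jbracket s powr (3 / 4)) *\<^sub>R \<eta>) * (sin ((s - 1) * norm \<eta>) / norm \<eta>) * cos (s * (v \<bullet> \<eta>))"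

lemma jbracket_powr_ge:
  assumes "s \<ge> (1::real)"
  shows "s powr (3 / 4) \<le> jbracket s powr (3 / 4)" "1 \<le> jbracket s powr (3 / 4)" "jbracket s powr (3 / 4) \<le> 2 * s powr (3 / 4)"
proof -
  have "s \<le> jbracket s" using norm_le_jbracket[of s] by simp
  then show "s powr (3 / 4) \<le> jbracket s powr (3 / 4)" using assms by (intro powr_mono2) auto
  show "1 \<le> jbracket s powr (3 / 4)" using jbracket_ge_1[of s] by (intro ge_one_powr_ge_zero) auto
  have "1 * 1 \<le> s * s" using assms by (intro mult_mono) auto
  then have "jbracket s \<le> 2 * s" unfolding jbracket_def using assms
    by (intro real_le_lsqrt) (auto simp: power2_eq_square)
  then have "jbracket s powr (3 / 4) \<le> (2 * s) powr (3 / 4)"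
    using jbracket_pos[of s] by (intro powr_mono2) auto
  also have "\<dots> = 2 powr (3 / 4) * s powr (3 / 4)" using assms by (intro powr_mult)
  also have "\<dots> \<le> 2 * s powr (3 / 4)"
    using powr_mono[of "3 / 4" 1 "2 :: real"] by (intro mult_right_mono) auto
  finally show "jbracket s powr (3 / 4) \<le> 2 * s powr (3 / 4)" .
qed

lemma cutoff_scaled_eq_0:
  assumes "radial_cutoff \<psi>" "b > 0" "norm \<eta> > 2 / b"
  shows "\<psi> (b *\<^sub>R \<eta>) = 0"
  using assms by (intro radial_cutoffD(6)[OF assms(1)]) (auto simp: field_simps)

lemma abs_sin_mult_div_le: "c \<ge> 0 \<Longrightarrow> \<bar>sin (c * r) / r\<bar> \<le> (c::real)"
  using abs_sin_x_le_abs_x[of "c * r"] by (cases "r = 0") (auto simp: abs_mult field_simps)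

lemma main_integrand_integrable:
  assumes \<psi>: "radial_cutoff \<psi>" and s: "s \<ge> 1"
  shows "integrable lborel (main_integrand \<psi> v s)" "(LINT \<eta>|lebesgue. main_integrand \<psi> v s \<eta>) = (LINT \<eta>|lborel. main_integrand \<psi> v s \<eta>)"
proof -
  define b where "b = jbracket s powr (3 / 4)"
  have b: "b \<ge> 1" unfolding b_def by (rule jbracket_powr_ge(2)[OF s])
  have c\<psi>: "continuous_on UNIV \<psi>" by (intro smooth_continuous radial_cutoffD(1) \<psi>)
  then have [measurable]: "\<psi> \<in> borel_measurable borel" by (rule borel_measurable_continuous_onI)
  have m: "main_integrand \<psi> v s \<in> borel_measurable borel"
    unfolding main_integrand_def[abs_def] by measurable
  have i: "integrable lborel (\<lambda>\<eta>. (s - 1) * indicator (cball (0::real^2) (2 / b)) \<eta>)"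
    using emeasure_lborel_cball_finite[of "0::real^2" "2 / b"] by (intro integrable_mult_right integrable_real_indicator) auto
  show "integrable lborel (main_integrand \<psi> v s)"
  proof (rule Bochner_Integration.integrable_bound[OF i])
    show "main_integrand \<psi> v s \<in> borel_measurable lborel" using m by simp
    show "AE \<eta> in lborel. norm (main_integrand \<psi> v s \<eta>) \<le> norm ((s - 1) * indicator (cball 0 (2 / b)) \<eta>)"
    proof (rule AE_I2)
      fix \<eta> :: "real^2"
      have "\<bar>main_integrand \<psi> v s \<eta>\<bar> \<le> 1 * (s - 1) * 1"
        unfolding main_integrand_def abs_mult
        using radial_cutoffD(2,3)[OF \<psi>] abs_sin_mult_div_le[of "s - 1" "norm \<eta>"] s
        by (intro mult_mono) (auto simp: abs_mult)
      moreover have "main_integrand \<psi> v s \<eta> = 0" if "\<eta> \<notin> cball 0 (2 / b)"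
      proof -
        have "\<psi> (b *\<^sub>R \<eta>) = 0" using that b by (intro cutoff_scaled_eq_0[OF \<psi>]) auto
        then show ?thesis by (simp add: main_integrand_def b_def)
      qed
      ultimately show "norm (main_integrand \<psi> v s \<eta>) \<le> norm ((s - 1) * indicator (cball 0 (2 / b)) \<eta>)"
        using s by (cases "\<eta> \<in> cball 0 (2 / b)") auto
    qed
  qed
  show "(LINT \<eta>|lebesgue. main_integrand \<psi> v s \<eta>) = (LINT \<eta>|lborel. main_integrand \<psi> v s \<eta>)"
    using m by (intro integral_completion) simp
qed

text \<open>In the plane the kernel is |z| \<rho>, which cancels the denominator |\<eta>| = \<rho>
  |z|; the remaining product of sine and cosine splits into two sines, with the sum and the
  difference of the phases.\<close>

lemma main_integrand_ray:
  assumes \<psi>: "radial_cutoff \<psi>" and s: "s \<ge> 1" and z: "1 \<le> norm z" "norm z \<le> 2"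
  defines "b \<equiv> jbracket s powr (3 / 4)"
  shows "(LINT \<rho>|lborel. ray_kernel z \<rho> * main_integrand \<psi> v s (\<rho> *\<^sub>R z)) =
    (integral {0..3 / b} (\<lambda>\<rho>. \<psi> ((b * \<rho>) *\<^sub>R z) * sin (((s - 1) * norm z + s * (v \<bullet> z)) * \<rho>)) +
     integral {0..3 / b} (\<lambda>\<rho>. \<psi> ((b * \<rho>) *\<^sub>R z) * sin (((s - 1) * norm z - s * (v \<bullet> z)) * \<rho>))) / 2"
proof -
  have b: "b \<ge> 1" unfolding b_def by (rule jbracket_powr_ge(2)[OF s])
  have c\<psi>: "continuous_on UNIV \<psi>" by (intro smooth_continuous radial_cutoffD(1) \<psi>)
  define f where "f w \<rho> = \<psi> ((b * \<rho>) *\<^sub>R z) * sin (w * \<rho>)" for w \<rho>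
  let ?p = "(s - 1) * norm z + s * (v \<bullet> z)" and ?m = "(s - 1) * norm z - s * (v \<bullet> z)"
  have c: "continuous_on {0..3 / b} (f w)" for w unfolding f_def[abs_def]
    by (intro continuous_intros continuous_on_compose2[OF c\<psi>]) auto
  have eq: "ray_kernel z \<rho> * main_integrand \<psi> v s (\<rho> *\<^sub>R z) = indicator {0..3 / b} \<rho> *\<^sub>R ((f ?p \<rho> + f ?m \<rho>) / 2)" for \<rho>
  proof (cases "\<rho> > 0")
    case True
    have z0: "norm z > 0" using z by linarith
    have "ray_kernel z \<rho> * main_integrand \<psi> v s (\<rho> *\<^sub>R z) =
        \<psi> ((b * \<rho>) *\<^sub>R z) * (sin ((s - 1) * norm z * \<rho>) * cos (s * (v \<bullet> z) * \<rho>))"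
      using True z z0 by (simp add: ray_kernel_def main_integrand_def b_def mult_ac)
    also have "\<dots> = (f ?p \<rho> + f ?m \<rho>) / 2"
    proof -
      have "?p * \<rho> = (s - 1) * norm z * \<rho> + s * (v \<bullet> z) * \<rho>" "?m * \<rho> = (s - 1) * norm z * \<rho> - s * (v \<bullet> z) * \<rho>"
        by (simp_all only: distrib_right left_diff_distrib)
      moreover have "q * (x * y) = (q * (x * y + x' * y') + q * (x * y - x' * y')) / 2" for q x y x' y' :: real
        by (simp add: algebra_simps)
      ultimately show ?thesis by (simp only: f_def sin_add sin_diff)
    qed
    also have "\<dots> = indicator {0..3 / b} \<rho> *\<^sub>R ((f ?p \<rho> + f ?m \<rho>) / 2)"
    proof (cases "\<rho> \<le> 3 / b")
      case False
      then have "b * \<rho> > 3" using b by (simp add: field_simps)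
      then have "3 * 1 \<le> \<bar>b * \<rho>\<bar> * norm z" using z by (intro mult_mono) auto
      then have "\<psi> ((b * \<rho>) *\<^sub>R z) = 0" by (intro radial_cutoffD(6)[OF \<psi>]) simp
      then show ?thesis by (simp add: f_def)
    qed (use True in simp)
    finally show ?thesis .
  next
    case False
    then show ?thesis by (cases "\<rho> = 0") (auto simp: ray_kernel_def f_def)
  qed
  have "(LINT \<rho>|lborel. ray_kernel z \<rho> * main_integrand \<psi> v s (\<rho> *\<^sub>R z)) = set_lebesgue_integral lborel {0..3 / b} (\<lambda>\<rho>. (f ?p \<rho> + f ?m \<rho>) / 2)"
    unfolding set_lebesgue_integral_def eq ..
  also have "\<dots> = integral {0..3 / b} (\<lambda>\<rho>. (f ?p \<rho> + f ?m \<rho>) / 2)"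
    by (intro set_borel_integral_eq_integral(2) borel_integrable_atLeastAtMost' continuous_intros c) simp
  also have "\<dots> = (integral {0..3 / b} (f ?p) + integral {0..3 / b} (f ?m)) / 2"
    using integral_add[OF integrable_continuous_interval[OF c[of ?p]] integrable_continuous_interval[OF c[of ?m]]] by simp
  finally show ?thesis by (simp add: f_def[abs_def])
qed

text \<open>Once the relative error 3 b B / a is at most 1/2, each of the two integrals on a ray is
  at least 1 / (2 a) >= 1 / (8 s). Thus \<open>c\<close> can be an eighth of the area of the
  annulus.\<close>

lemma main_integral_lower:
  fixes v :: "real^2"
  assumes \<psi>: "radial_cutoff \<psi>" and v: "norm v < 1"
  obtains c s0 where "c > 0" "s0 \<ge> 1" "\<And>s. s \<ge> s0 \<Longrightarrow> c / s \<le> (LINT \<eta>|lebesgue. main_integrand \<psi> v s \<eta>)"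
proof -
  obtain B where B: "B \<ge> 0" "\<And>z a b. 1 \<le> norm z \<Longrightarrow> norm z \<le> 2 \<Longrightarrow> a > 0 \<Longrightarrow> b > 0 \<Longrightarrow>
    1 / a - 3 * b * B / a\<^sup>2 \<le> integral {0..3 / b} (\<lambda>\<rho>. \<psi> ((b * \<rho>) *\<^sub>R z) * sin (a * \<rho>))"
    by (rule ray_oscillatory_integral[OF \<psi>]) (rule that)
  \<comment> \<open>Half of the gap between the speed 1 and |v|. Both frequencies are at least |z|
    (2 \<kappa> s - 1), where the 1 comes from the initial time; this is at least \<kappa> s as soon
    as \<kappa> s >= 1.\<close>
  define \<kappa> where "\<kappa> = (1 - norm v) / 2"
  have \<kappa>: "\<kappa> > 0" using v by (simp add: \<kappa>_def)
  define A where "A = {z :: real^2. 1 \<le> norm z \<and> norm z \<le> 2}"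
  have A_sets: "A \<in> sets borel" unfolding A_def by measurable
  have A_fin: "emeasure lborel A < \<infinity>"
  proof -
    have "emeasure lborel A \<le> emeasure lborel (cball (0::real^2) 2)"
      by (intro emeasure_mono) (auto simp: A_def)
    also have "\<dots> < \<infinity>" by (rule emeasure_lborel_cball_finite)
    finally show ?thesis .
  qed
  have A_pos: "measure lborel A > 0"
  proof -
    have "ball ((3 / 2) *\<^sub>R axis 1 1) (1 / 2) \<subseteq> A"
    proof
      fix z :: "real^2" assume "z \<in> ball ((3 / 2) *\<^sub>R axis 1 1) (1 / 2)"
      then have "norm (z - (3 / 2) *\<^sub>R axis 1 1) < 1 / 2" by (simp add: dist_norm norm_minus_commute)
      moreover have "norm ((3 / 2) *\<^sub>R axis 1 1 :: real^2) = 3 / 2" by simp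
      ultimately show "z \<in> A"
        using norm_triangle_ineq2[of z "(3 / 2) *\<^sub>R axis 1 1"] norm_triangle_ineq2[of "(3 / 2) *\<^sub>R axis 1 1" z]
        by (auto simp: A_def norm_minus_commute)
    qed
    then have "measure lborel (ball ((3 / 2) *\<^sub>R axis 1 1 :: real^2) (1 / 2)) \<le> measure lborel A"
      using A_sets A_fin by (intro measure_mono_fmeasurable fmeasurableI) auto
    moreover have "measure lborel (ball ((3 / 2) *\<^sub>R axis 1 1 :: real^2) (1 / 2)) > 0"
      by (intro content_ball_pos) simp
    ultimately show ?thesis by linarith
  qed
  \<comment> \<open>The bound for the relative error 3 b B / a obtained from b <= 2 s^(3/4) and a >=
    \<kappa> s.\<close>
  have "((\<lambda>s::real. 3 * B / \<kappa> * (2 * s powr (- (1 / 4)))) \<longlongrightarrow> 3 * B / \<kappa> * (2 * 0)) at_top"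
    by (intro tendsto_intros tendsto_neg_powr filterlim_ident) auto
  then have "\<forall>\<^sub>F s in at_top. 3 * B / \<kappa> * (2 * s powr (- (1 / 4))) < 1 / 2"
    by (intro order_tendstoD) auto
  then obtain s1 where s1: "\<And>s. s \<ge> s1 \<Longrightarrow> 3 * B / \<kappa> * (2 * s powr (- (1 / 4))) < 1 / 2"
    by (auto simp: eventually_at_top_linorder)
  define s0 where "s0 = max 1 (max s1 (1 / \<kappa>))"
  show ?thesis
  proof (rule that[of "measure lborel A / 8" s0])
    show "measure lborel A / 8 > 0" "s0 \<ge> 1" using A_pos by (auto simp: s0_def)
    fix s assume "s \<ge> s0"
    then have s: "s \<ge> 1" "s \<ge> s1" "s \<ge> 1 / \<kappa>" by (auto simp: s0_def)
    define b where "b = jbracket s powr (3 / 4)"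
    have b: "b \<ge> 1" "b \<le> 2 * s powr (3 / 4)" unfolding b_def using jbracket_powr_ge[OF s(1)] by auto
    have J: "1 / (8 * s) \<le> integral {0..3 / b} (\<lambda>\<rho>. \<psi> ((b * \<rho>) *\<^sub>R z) * sin (a * \<rho>))"
      if z: "1 \<le> norm z" "norm z \<le> 2" and a: "\<kappa> * s \<le> a" "a \<le> 4 * s" for z a
    proof -
      have a0: "a > 0" using \<kappa> s a by (smt (verit) mult_pos_pos)
      have "3 * b * B / a \<le> 3 * (2 * s powr (3 / 4)) * B / (\<kappa> * s)"
        using b B(1) \<kappa> s a by (intro frac_le mult_mono mult_nonneg_nonneg) auto
      also have "\<dots> = 3 * B / \<kappa> * (2 * (s powr (3 / 4) / s))" using \<kappa> s by (simp add: field_simps)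
      also have "s powr (3 / 4) / s = s powr (- (1 / 4))" using s powr_diff[of s "3 / 4" 1] by simp
      also have "3 * B / \<kappa> * (2 * s powr (- (1 / 4))) \<le> 1 / 2" using s1[OF s(2)] by simp
      finally have h: "3 * b * B / a \<le> 1 / 2" .
      have "1 / (8 * s) \<le> 1 / a * (1 / 2)" using a a0 s by (simp add: field_simps)
      also have "\<dots> \<le> 1 / a * (1 - 3 * b * B / a)" using h a0 by (intro mult_left_mono) auto
      also have "\<dots> = 1 / a - 3 * b * B / a\<^sup>2" using a0 by (simp add: field_simps power2_eq_square)
      also have "\<dots> \<le> integral {0..3 / b} (\<lambda>\<rho>. \<psi> ((b * \<rho>) *\<^sub>R z) * sin (a * \<rho>))"
        using b by (intro B(2) z a0) auto
      finally show ?thesis .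
    qed
    have ray: "indicator A z * (1 / (8 * s)) \<le> (LINT \<rho>|lborel. ray_kernel z \<rho> * main_integrand \<psi> v s (\<rho> *\<^sub>R z))" for z
    proof (cases "z \<in> A")
      case True
      then have z: "1 \<le> norm z" "norm z \<le> 2" by (auto simp: A_def)
      have vz: "\<bar>v \<bullet> z\<bar> \<le> norm v * norm z" by (rule Cauchy_Schwarz_ineq2)
      then have svz: "\<bar>s * (v \<bullet> z)\<bar> \<le> s * norm v * norm z"
        using s by (simp add: abs_mult mult.assoc mult_left_mono)
      have k1: "1 \<le> \<kappa> * s" using s(3) \<kappa> by (simp add: field_simps)
      then have "\<kappa> * s \<le> 1 * (2 * (\<kappa> * s) - 1)" by simp
      also have "\<dots> \<le> norm z * (2 * (\<kappa> * s) - 1)"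
        using z k1 by (intro mult_right_mono) auto
      also have "\<dots> = (s - 1) * norm z - s * norm v * norm z"
        by (simp add: \<kappa>_def field_simps)
      finally have lo: "\<kappa> * s \<le> (s - 1) * norm z - s * norm v * norm z" .
      have "s * norm v * norm z \<le> s * 1 * norm z" using v s by (intro mult_right_mono mult_left_mono) auto
      moreover have "(s - 1) * norm z \<le> s * norm z" by (intro mult_right_mono) auto
      moreover have "s * norm z \<le> s * 2" using s z by (intro mult_left_mono) auto
      ultimately have hi: "(s - 1) * norm z + s * norm v * norm z \<le> 4 * s" by linarith
      have "1 / (8 * s) \<le> (integral {0..3 / b} (\<lambda>\<rho>. \<psi> ((b * \<rho>) *\<^sub>R z) * sin (((s - 1) * norm z + s * (v \<bullet> z)) * \<rho>)) +
          integral {0..3 / b} (\<lambda>\<rho>. \<psi> ((b * \<rho>) *\<^sub>R z) * sin (((s - 1) * norm z - s * (v \<bullet> z)) * \<rho>))) / 2"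
      proof -
        have "s * (v \<bullet> z) \<le> s * norm v * norm z" "- (s * norm v * norm z) \<le> s * (v \<bullet> z)"
          using svz by (simp_all only: abs_le_iff) linarith
        then have "\<kappa> * s \<le> (s - 1) * norm z + s * (v \<bullet> z)" "(s - 1) * norm z + s * (v \<bullet> z) \<le> 4 * s"
          "\<kappa> * s \<le> (s - 1) * norm z - s * (v \<bullet> z)" "(s - 1) * norm z - s * (v \<bullet> z) \<le> 4 * s"
          using lo hi by linarith+
        note J = J[OF z this(1,2)] J[OF z this(3,4)]
        have "x \<le> (p + q) / 2" if "x \<le> p" "x \<le> q" for x p q :: real using that by simp
        from this[OF J] show ?thesis .
      qed
      then show ?thesis using True by (simp add: main_integrand_ray[OF \<psi> s(1) z] b_def)
    qed (simp add: ray_kernel_def A_def)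
    have "measure lborel A / 8 / s = (LINT z|lborel. indicator A z * (1 / (8 * s)))"
      using A_sets A_fin s by simp
    also have "\<dots> \<le> (LINT z|lborel. LINT \<rho>|lborel. ray_kernel z \<rho> * main_integrand \<psi> v s (\<rho> *\<^sub>R z))"
      using A_sets A_fin
      by (intro integral_mono ray integral_rays main_integrand_integrable \<psi> s integrable_mult_left integrable_real_indicator) auto
    also have "\<dots> = (LINT \<eta>|lebesgue. main_integrand \<psi> v s \<eta>)"
      using integral_rays(2)[OF main_integrand_integrable(1)[OF \<psi> s(1)]] main_integrand_integrable(2)[OF \<psi> s(1)] by simp
    finally show "measure lborel A / 8 / s \<le> (LINT \<eta>|lebesgue. main_integrand \<psi> v s \<eta>)" .
  qed
qed

section \<open>The frequency integral\<close>

text \<open>The transforms of the data are replaced by arbitrary profiles, since the estimates below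
  use only their continuity, their bounds and the behaviour of \<open>U1\<close> near 0.\<close>

definition freq_integrand :: "(real^2 \<Rightarrow> real) \<Rightarrow> real^2 \<Rightarrow> (real^2 \<Rightarrow> complex) \<Rightarrow> (real^2 \<Rightarrow> complex) \<Rightarrow> real \<Rightarrow> real^2 \<Rightarrow> complex" where
  "freq_integrand \<psi> v U0 U1 s \<eta> = complex_of_real (\<psi> ((jbracket s powr (3 / 4)) *\<^sub>R \<eta>)) *
     (complex_of_real (cos ((s - 1) * norm \<eta>)) * U0 \<eta> + complex_of_real (sin ((s - 1) * norm \<eta>) / norm \<eta>) * U1 \<eta>) *
     exp (\<i> * complex_of_real (s * (v \<bullet> \<eta>)))"

lemma freq_integrand_eq_0:
  assumes \<psi>: "radial_cutoff \<psi>" and s: "s \<ge> 1" and \<eta>: "\<eta> \<notin> cball 0 (2 / jbracket s powr (3 / 4))"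
  shows "freq_integrand \<psi> v U0 U1 s \<eta> = 0"
proof -
  have "\<psi> ((jbracket s powr (3 / 4)) *\<^sub>R \<eta>) = 0"
    using \<eta> jbracket_powr_ge(2)[OF s] by (intro cutoff_scaled_eq_0[OF \<psi>]) auto
  then show ?thesis by (simp add: freq_integrand_def)
qed

lemma cball_freq_subset:
  assumes "s \<ge> (1::real)"
  shows "cball 0 (2 / jbracket s powr (3 / 4)) \<subseteq> cball (0 :: real^2) 2"
proof -
  have "2 / jbracket s powr (3 / 4) \<le> 2 / 1"
    using jbracket_powr_ge(2)[OF assms] by (intro divide_left_mono) auto
  then show ?thesis by auto
qed

text \<open>A majorant that does not depend on \<open>s\<close> in [1, T], as dominated convergence
  requires; a fixed disc works because the radius of the cutoff ball is at most 2.\<close>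

lemma freq_integrand_bound:
  assumes \<psi>: "radial_cutoff \<psi>" and s: "1 \<le> s" "s \<le> T"
    and U0: "\<And>\<eta>. cmod (U0 \<eta>) \<le> C0" and U1: "\<And>\<eta>. cmod (U1 \<eta>) \<le> C1"
  shows "cmod (freq_integrand \<psi> v U0 U1 s \<eta>) \<le> (C0 + T * C1) * indicator (cball 0 2) \<eta>"
proof -
  have C: "C0 \<ge> 0" "C1 \<ge> 0" using order_trans[OF norm_ge_zero U0] order_trans[OF norm_ge_zero U1] by auto
  show ?thesis
  proof (cases "\<eta> \<in> cball 0 2")
    case True
    have "\<bar>sin ((s - 1) * norm \<eta>) / norm \<eta>\<bar> \<le> T"
      using abs_sin_mult_div_le[of "s - 1" "norm \<eta>"] s by simp
    then have "cmod (complex_of_real (cos ((s - 1) * norm \<eta>)) * U0 \<eta> + complex_of_real (sin ((s - 1) * norm \<eta>) / norm \<eta>) * U1 \<eta>) \<le> 1 * C0 + T * C1"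
      using U0[of \<eta>] U1[of \<eta>] C s
      by (intro norm_triangle_le add_mono; unfold norm_mult norm_of_real; intro mult_mono) auto
    then have "cmod (freq_integrand \<psi> v U0 U1 s \<eta>) \<le> 1 * (1 * C0 + T * C1) * 1"
      unfolding freq_integrand_def norm_mult norm_of_real
      using radial_cutoffD(2,3)[OF \<psi>] C s by (intro mult_mono) (auto intro!: mult_nonneg_nonneg)
    then show ?thesis using True by simp
  next
    case False
    then have "\<eta> \<notin> cball 0 (2 / jbracket s powr (3 / 4))" using cball_freq_subset[OF s(1)] by blast
    then show ?thesis using freq_integrand_eq_0[OF \<psi> s(1)] C s by simp
  qed
qed

lemma freq_integrand_measurable:
  assumes \<psi>: "radial_cutoff \<psi>" and U: "continuous_on UNIV U0" "continuous_on UNIV U1"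
  shows "freq_integrand \<psi> v U0 U1 s \<in> borel_measurable borel"
proof -
  have "continuous_on UNIV \<psi>" by (intro smooth_continuous radial_cutoffD(1) \<psi>)
  then have [measurable]: "\<psi> \<in> borel_measurable borel" by (rule borel_measurable_continuous_onI)
  have [measurable]: "U0 \<in> borel_measurable borel" "U1 \<in> borel_measurable borel"
    using U by (auto intro: borel_measurable_continuous_onI)
  show ?thesis unfolding freq_integrand_def[abs_def] by measurable
qed

lemma integrable_indicator_cball: "integrable lebesgue (\<lambda>\<eta>. C * indicator (cball (0::real^2) r) \<eta> :: real)"
  using emeasure_lborel_cball_finite[of "0::real^2" r] by (intro integrable_mult_right integrable_real_indicator) auto

lemma freq_integrand_integrable:
  assumes \<psi>: "radial_cutoff \<psi>" and s: "s \<ge> 1" and U: "continuous_on UNIV U0" "continuous_on UNIV U1"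
    and U0: "\<And>\<eta>. cmod (U0 \<eta>) \<le> C0" and U1: "\<And>\<eta>. cmod (U1 \<eta>) \<le> C1"
  shows "integrable lebesgue (freq_integrand \<psi> v U0 U1 s)"
proof (rule Bochner_Integration.integrable_bound[OF integrable_indicator_cball[of "C0 + s * C1" 2]])
  show "freq_integrand \<psi> v U0 U1 s \<in> borel_measurable lebesgue"
    using freq_integrand_measurable[OF \<psi> U] by (intro measurable_completion) simp
  show "AE \<eta> in lebesgue. norm (freq_integrand \<psi> v U0 U1 s \<eta>) \<le> norm ((C0 + s * C1) * indicator (cball 0 2) \<eta>)"
    using order_trans[OF freq_integrand_bound[OF \<psi> s order_refl U0 U1] abs_ge_self] by (intro AE_I2) simp
qed

text \<open>Continuity in time allows the time integral to be treated as a gauge integral and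
  compared with explicit primitives.\<close>

lemma freq_integral_continuous:
  assumes \<psi>: "radial_cutoff \<psi>" and U: "continuous_on UNIV U0" "continuous_on UNIV U1"
    and U0: "\<And>\<eta>. cmod (U0 \<eta>) \<le> C0" and U1: "\<And>\<eta>. cmod (U1 \<eta>) \<le> C1"
  shows "continuous_on {1..T} (\<lambda>s. LINT \<eta>|lebesgue. freq_integrand \<psi> v U0 U1 s \<eta>)"
  unfolding continuous_on_sequentially
proof (intro allI ballI impI)
  fix s and ss :: "nat \<Rightarrow> real"
  assume s: "s \<in> {1..T}" and "(\<forall>n. ss n \<in> {1..T}) \<and> ss \<longlonglongrightarrow> s"
  then have ss: "\<And>n. ss n \<in> {1..T}" and lim: "ss \<longlonglongrightarrow> s" by auto
  have c\<psi>: "continuous_on UNIV \<psi>" by (intro smooth_continuous radial_cutoffD(1) \<psi>)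
  have pt: "(\<lambda>n. freq_integrand \<psi> v U0 U1 (ss n) \<eta>) \<longlonglongrightarrow> freq_integrand \<psi> v U0 U1 s \<eta>" for \<eta>
  proof -
    have "jbracket s \<noteq> 0" for s :: real using jbracket_pos[of s] by simp
    then have "continuous_on UNIV (\<lambda>s::real. jbracket s powr (3 / 4))"
      by (intro continuous_on_powr continuous_intros) auto
    then have "continuous_on UNIV (\<lambda>s::real. \<psi> ((jbracket s powr (3 / 4)) *\<^sub>R \<eta>))"
      by (intro continuous_on_compose2[OF c\<psi>] continuous_on_scaleR continuous_on_const) auto
    \<comment> \<open>At frequency 0 the quotient is the constant 0 by convention, which is still
      continuous in \<open>s\<close>.\<close>
    moreover have "continuous_on UNIV (\<lambda>s. sin ((s - 1) * norm \<eta>) / norm \<eta>)"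
      by (cases "\<eta> = 0") (auto intro!: continuous_intros)
    moreover have "continuous_on UNIV (\<lambda>s. complex_of_real (p s) * (complex_of_real (cos ((s - 1) * n)) * x +
        complex_of_real (q s) * y) * exp (\<i> * complex_of_real (s * k)))"
      if "continuous_on UNIV p" "continuous_on UNIV q" for p q n x y k
      using that by (intro continuous_intros)
    ultimately have "continuous_on UNIV (\<lambda>s. freq_integrand \<psi> v U0 U1 s \<eta>)"
      unfolding freq_integrand_def by blast
    then show ?thesis using lim by (auto simp: continuous_on_sequentially o_def)
  qed
  show "((\<lambda>s. LINT \<eta>|lebesgue. freq_integrand \<psi> v U0 U1 s \<eta>) \<circ> ss) \<longlonglongrightarrow> (LINT \<eta>|lebesgue. freq_integrand \<psi> v U0 U1 s \<eta>)"
    unfolding o_def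
  proof (rule integral_dominated_convergence[OF _ _ integrable_indicator_cball[of "C0 + T * C1" 2]])
    show "freq_integrand \<psi> v U0 U1 s \<in> borel_measurable lebesgue" for s
      using freq_integrand_measurable[OF \<psi> U] by (intro measurable_completion) simp
    then show "freq_integrand \<psi> v U0 U1 (ss n) \<in> borel_measurable lebesgue" for n .
    show "AE \<eta> in lebesgue. norm (freq_integrand \<psi> v U0 U1 (ss n) \<eta>) \<le> (C0 + T * C1) * indicator (cball 0 2) \<eta>" for n
      using ss[of n] by (intro AE_I2 freq_integrand_bound[OF \<psi> _ _ U0 U1]) auto
  qed (use pt in auto)
qed

text \<open>Division by \<open>m\<close> gives the main term a positive lower bound whatever the
  sign of \<open>m\<close>; only then are real parts compared.\<close>

lemma freq_integral_lower:
  assumes \<psi>: "radial_cutoff \<psi>" and v: "norm v < 1" and m: "m \<noteq> 0"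
    and U: "continuous_on UNIV U0" "continuous_on UNIV U1"
    and U0: "\<And>\<eta>. cmod (U0 \<eta>) \<le> C0" and U1: "\<And>\<eta>. cmod (U1 \<eta>) \<le> C1"
    and U1_0: "\<And>\<eta>. cmod (U1 \<eta> - complex_of_real m) \<le> C2 * norm \<eta>"
  obtains c C s0 where "c > 0" "s0 \<ge> 1"
    "\<And>s. s \<ge> s0 \<Longrightarrow> c / s - C * s powr (- (3 / 2)) \<le> Re ((LINT \<eta>|lebesgue. freq_integrand \<psi> v U0 U1 s \<eta>) / complex_of_real m)"
proof -
  obtain c s0 where c: "c > 0" "s0 \<ge> 1" "\<And>s. s \<ge> s0 \<Longrightarrow> c / s \<le> (LINT \<eta>|lebesgue. main_integrand \<psi> v s \<eta>)"
    using main_integral_lower[OF \<psi> v] by metis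
  have C0: "C0 \<ge> 0" using order_trans[OF norm_ge_zero U0] .
  have C2: "C2 \<ge> 0" using order_trans[OF norm_ge_zero U1_0[of "axis 1 1"]] by simp
  define K where "K = (C0 + C2) / \<bar>m\<bar>"
  have K: "K \<ge> 0" using C0 C2 by (simp add: K_def)
  define vol where "vol = unit_ball_vol (real (DIM(real^2)))"
  show ?thesis
  proof (rule that[OF c(1,2), of "K * (vol * 4)"])
    fix s assume s0: "s \<ge> s0"
    with c(2) have s: "s \<ge> 1" by simp
    define b where "b = jbracket s powr (3 / 4)"
    have b: "b \<ge> 1" "s powr (3 / 4) \<le> b" unfolding b_def using jbracket_powr_ge[OF s] by auto
    let ?F = "freq_integrand \<psi> v U0 U1 s"
    have iF: "integrable lebesgue ?F" by (rule freq_integrand_integrable[OF \<psi> s U U0 U1])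
    have iM: "integrable lebesgue (main_integrand \<psi> v s)"
      using main_integrand_integrable(1)[OF \<psi> s] integrable_completion[of "main_integrand \<psi> v s" lborel] by auto
    have pt: "main_integrand \<psi> v s \<eta> - K * indicator (cball 0 (2 / b)) \<eta> \<le> Re (?F \<eta> / complex_of_real m)" for \<eta>
    proof (cases "\<eta> \<in> cball 0 (2 / b)")
      case True
      let ?p = "\<psi> ((jbracket s powr (3 / 4)) *\<^sub>R \<eta>)" and ?c = "cos ((s - 1) * norm \<eta>)"
        and ?s = "sin ((s - 1) * norm \<eta>) / norm \<eta>" and ?e = "exp (\<i> * complex_of_real (s * (v \<bullet> \<eta>)))"
      \<comment> \<open>The discarded part. The bound 1 / |\<eta>| for the quotient meets the factor
        |\<eta>| of \<open>U1_0\<close>, so \<open>E\<close> is bounded uniformly in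
        \<open>s\<close> and its integral is controlled by the area of the cutoff ball.\<close>
      define E where "E = complex_of_real ?p * (complex_of_real ?c * U0 \<eta> + complex_of_real ?s * (U1 \<eta> - complex_of_real m)) * ?e / complex_of_real m"
      have "?F \<eta> / complex_of_real m = complex_of_real (?p * ?s) * ?e + E"
      proof -
        have alg: "p * (c * u + q * w) * e / k = p * q * e + p * (c * u + q * (w - k)) * e / k" if "k \<noteq> 0"
          for p c u q w e k :: complex
          using that by (simp add: field_simps)
        show ?thesis unfolding freq_integrand_def E_def of_real_mult
          by (rule alg) (use m in simp)
      qed
      moreover have "Re (complex_of_real (?p * ?s) * ?e) = main_integrand \<psi> v s \<eta>"
        by (simp add: main_integrand_def Re_exp)
      moreover have "cmod E \<le> K"
      proof -
        have "cmod (complex_of_real ?s * (U1 \<eta> - complex_of_real m)) \<le> C2"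
        proof (cases "\<eta> = 0")
          case False
          have "\<bar>?s\<bar> \<le> 1 / norm \<eta>" by (simp add: abs_divide divide_right_mono)
          then have "\<bar>?s\<bar> * cmod (U1 \<eta> - complex_of_real m) \<le> 1 / norm \<eta> * (C2 * norm \<eta>)"
            by (intro mult_mono U1_0) auto
          then show ?thesis using False unfolding norm_mult norm_of_real by simp
        qed (use C2 in simp)
        moreover have "cmod (complex_of_real ?c * U0 \<eta>) \<le> 1 * C0"
          unfolding norm_mult norm_of_real by (intro mult_mono U0) auto
        ultimately have "cmod (complex_of_real ?c * U0 \<eta> + complex_of_real ?s * (U1 \<eta> - complex_of_real m)) \<le> C0 + C2"
          by (intro norm_triangle_le) linarith
        then have "cmod E \<le> 1 * (C0 + C2) * 1 / \<bar>m\<bar>"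
          unfolding E_def norm_mult norm_divide norm_of_real
          using radial_cutoffD(2,3)[OF \<psi>] C0 C2 by (intro divide_right_mono mult_mono) auto
        then show ?thesis by (simp add: K_def)
      qed
      ultimately show ?thesis using True abs_Re_le_cmod[of E] by simp
    next
      case False
      then have "\<psi> (b *\<^sub>R \<eta>) = 0" using b by (intro cutoff_scaled_eq_0[OF \<psi>]) auto
      then have "main_integrand \<psi> v s \<eta> = 0" "?F \<eta> = 0"
        by (simp_all add: b_def main_integrand_def freq_integrand_def)
      then show ?thesis using False by simp
    qed
    have "c / s - K * (vol * 4) * s powr (- (3 / 2)) \<le> (LINT \<eta>|lebesgue. main_integrand \<psi> v s \<eta>) - K * measure lebesgue (cball (0::real^2) (2 / b))"
    proof -
      have "measure lebesgue (cball (0::real^2) (2 / b)) = vol * (2 / b)\<^sup>2"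
        using content_cball[of "2 / b" "0 :: real^2"] b by (simp add: vol_def)
      also have "\<dots> = vol * 4 * (1 / b\<^sup>2)" by (simp add: power_divide)
      also have "\<dots> \<le> vol * 4 * s powr (- (3 / 2))"
      proof (intro mult_left_mono)
        have "(s powr (3 / 4))\<^sup>2 \<le> b\<^sup>2" using b by (intro power_mono) auto
        moreover have "(s powr (3 / 4))\<^sup>2 = s powr (3 / 2)"
          by (simp add: power2_eq_square powr_add[symmetric])
        ultimately have "1 / b\<^sup>2 \<le> 1 / s powr (3 / 2)" using s b by (intro divide_left_mono mult_pos_pos) auto
        then show "1 / b\<^sup>2 \<le> s powr (- (3 / 2))" by (simp add: powr_minus_divide)
        show "0 \<le> vol * 4" by (simp add: vol_def)
      qed
      finally have "K * measure lebesgue (cball (0::real^2) (2 / b)) \<le> K * (vol * 4 * s powr (- (3 / 2)))"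
        using K by (rule mult_left_mono)
      then show ?thesis using c(3)[OF s0] by (simp add: mult.assoc)
    qed
    also have "\<dots> = (LINT \<eta>|lebesgue. main_integrand \<psi> v s \<eta> - K * indicator (cball 0 (2 / b)) \<eta>)"
      using iM integrable_indicator_cball[of K "2 / b"] by simp
    also have "\<dots> \<le> (LINT \<eta>|lebesgue. Re (?F \<eta> / complex_of_real m))"
      by (intro integral_mono pt Bochner_Integration.integrable_diff iM integrable_indicator_cball
          integrable_Re integrable_divide iF)
    also have "\<dots> = Re (LINT \<eta>|lebesgue. ?F \<eta> / complex_of_real m)"
      by (intro integral_Re integrable_divide iF)
    also have "(LINT \<eta>|lebesgue. ?F \<eta> / complex_of_real m) = (LINT \<eta>|lebesgue. ?F \<eta>) / complex_of_real m" by simp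
    finally show "c / s - K * (vol * 4) * s powr (- (3 / 2)) \<le> Re ((LINT \<eta>|lebesgue. ?F \<eta>) / complex_of_real m)" .
  qed
qed

text \<open>The lower bound has the primitive \<open>c * ln s + 2 * C * s powr (- (1 / 2))\<close>,
  whose second part tends to 0; the stretch from 1 to \<open>s0\<close> only adds a
  constant.\<close>

lemma log_lower_bound_integral_at_top:
  fixes g :: "real \<Rightarrow> real"
  assumes cont: "\<And>T. continuous_on {1..T} g" and c: "c > 0" and s0: "s0 \<ge> 1"
    and g: "\<And>s. s \<ge> s0 \<Longrightarrow> c / s - C * s powr (- (3 / 2)) \<le> g s"
  shows "filterlim (\<lambda>t. integral {1..t} g) at_top at_top"
proof -
  let ?h = "\<lambda>s. c / s - C * s powr (- (3 / 2))" and ?H = "\<lambda>s. c * ln s + 2 * C * s powr (- (1 / 2))"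
  have le: "integral {1..s0} g + (?H t - ?H s0) \<le> integral {1..t} g" if t: "t \<ge> s0" for t
  proof -
    have h: "(?h has_integral ?H t - ?H s0) {s0..t}"
    proof (rule fundamental_theorem_of_calculus[OF t])
      fix s assume "s \<in> {s0..t}"
      then have s: "s > 0" using s0 by auto
      have "((\<lambda>s. s powr (- (1 / 2))) has_real_derivative - (1 / 2) * s powr (- (1 / 2) - 1)) (at s)"
        using s by (rule has_real_derivative_powr)
      then have "(?H has_real_derivative c * inverse s + 2 * C * (- (1 / 2) * s powr (- (1 / 2) - 1))) (at s)"
        by (rule DERIV_add[OF DERIV_cmult[OF DERIV_ln[OF s]] DERIV_cmult])
      moreover have "c * inverse s + 2 * C * (- (1 / 2) * s powr (- (1 / 2) - 1)) = ?h s"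
      proof -
        have "c * inverse s + 2 * C * (- (1 / 2) * x) = c / s - C * x" for x
          by (simp add: field_simps)
        moreover have "- (1 / 2) - 1 = - (3 / 2 :: real)" by simp
        ultimately show ?thesis by (simp only:)
      qed
      ultimately have "(?H has_real_derivative ?h s) (at s)" by (simp only:)
      then show "(?H has_vector_derivative ?h s) (at s within {s0..t})"
        by (simp add: has_real_derivative_iff_has_vector_derivative[symmetric] has_field_derivative_at_within)
    qed
    have gi: "g integrable_on {1..t}" by (intro integrable_continuous_interval cont)
    then have gi': "g integrable_on {s0..t}" by (rule integrable_on_subinterval) (use s0 in auto)
    have "?H t - ?H s0 \<le> integral {s0..t} g"
      using has_integral_le[OF h integrable_integral[OF gi']] g by auto
    moreover have "integral {1..s0} g + integral {s0..t} g = integral {1..t} g"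
      by (intro Henstock_Kurzweil_Integration.integral_combine gi t s0)
    ultimately show ?thesis by linarith
  qed
  have "filterlim (\<lambda>t. (integral {1..s0} g - ?H s0 + 2 * C * t powr (- (1 / 2))) + c * ln t) at_top at_top"
  proof (rule filterlim_tendsto_add_at_top)
    show "((\<lambda>t. integral {1..s0} g - ?H s0 + 2 * C * t powr (- (1 / 2))) \<longlongrightarrow> integral {1..s0} g - ?H s0 + 2 * C * 0) at_top"
      by (intro tendsto_intros tendsto_neg_powr filterlim_ident) auto
    show "filterlim (\<lambda>t. c * ln t) at_top at_top"
      by (rule filterlim_tendsto_pos_mult_at_top[OF tendsto_const c ln_at_top])
  qed
  then show ?thesis
    by (rule filterlim_at_top_mono) (use le in \<open>auto simp: eventually_at_top_linorder algebra_simps intro!: exI[of _ s0]\<close>)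
qed

text \<open>Controlling a real part is enough: the integral of \<open>g\<close> is the real part of
  the integral of \<open>I\<close> divided by \<open>m\<close>, hence at most its modulus.\<close>

lemma (in decaying_wave) phase_correction_at_top:
  assumes \<psi>: "radial_cutoff \<psi>" and m: "(LINT x|lebesgue. dt l 1 x) \<noteq> 0"
  shows "filterlim (\<lambda>t. cmod (phase_correction \<psi> l t \<xi>)) at_top at_top"
proof -
  define v where "v = \<xi> /\<^sub>R jbracket \<xi>"
  define m where "m = (LINT x|lebesgue. dt l 1 x)"
  define U0 where "U0 = fourier (l 1)"
  define U1 where "U1 = fourier (dt l 1)"
  define I where "I s = (LINT \<eta>|lebesgue. freq_integrand \<psi> v U0 U1 s \<eta>)" for s
  define g where "g s = Re (I s / complex_of_real m)" for s
  define k where "k = 1 / 2 * inverse (jbracket \<xi>)"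
  have k: "k > 0" using jbracket_pos[of \<xi>] by (simp add: k_def)
  have m0: "m \<noteq> 0" using m by (simp add: m_def)
  \<comment> \<open>Strict because of the 1 under the root; the gap 1 - |v| depends on \<xi>, which
    is fixed.\<close>
  have "norm \<xi> < jbracket \<xi>" unfolding jbracket_def by (intro real_less_rsqrt) simp
  then have v: "norm v < 1" using jbracket_pos[of \<xi>] by (simp add: v_def field_simps)
  have i0: "integrable lebesgue (l 1)" by (rule l_integrable) simp
  note i1 = u1_integrable
  have U: "continuous_on UNIV U0" "continuous_on UNIV U1"
    unfolding U0_def U1_def by (intro fourier_continuous i0 i1)+
  have U0: "\<And>\<eta>. cmod (U0 \<eta>) \<le> (LINT x|lebesgue. \<bar>l 1 x\<bar>)" and U1: "\<And>\<eta>. cmod (U1 \<eta>) \<le> (LINT x|lebesgue. \<bar>dt l 1 x\<bar>)"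
    unfolding U0_def U1_def by (rule norm_fourier_le)+
  have U1_0: "\<And>\<eta>. cmod (U1 \<eta> - complex_of_real m) \<le> (LINT x|lebesgue. jbracket x * \<bar>dt l 1 x\<bar>) * norm \<eta>"
    unfolding U1_def m_def
    using fourier_at_0_diff[OF i1 weighted_L1(1)[OF l_measurable(2) K1]] by (simp add: mult.commute)
  obtain c C s0 where low: "c > 0" "s0 \<ge> 1" "\<And>s. s \<ge> s0 \<Longrightarrow> c / s - C * s powr (- (3 / 2)) \<le> g s"
    using freq_integral_lower[OF \<psi> v m0 U U0 U1 U1_0] unfolding g_def I_def by metis
  have cI: "continuous_on {1..T} I" for T
    unfolding I_def by (rule freq_integral_continuous[OF \<psi> U U0 U1])
  have cg: "continuous_on {1..T} g" for T
    unfolding g_def using m0 by (intro continuous_intros cI) auto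
  have inner: "(LINT \<eta>|lebesgue. low_freq_fourier \<psi> l s \<eta> * exp (\<i> * complex_of_real (s * ((\<xi> /\<^sub>R jbracket \<xi>) \<bullet> \<eta>)))) = I s"
    if s: "s \<ge> 1" for s
    unfolding I_def
  proof (rule integral_cong_AE)
    have "AE \<eta> in lebesgue. \<eta> \<noteq> (0 :: real^2)"
      by (intro AE_completion AE_lborel_singleton)
    then show ae: "AE \<eta> in lebesgue. low_freq_fourier \<psi> l s \<eta> * exp (\<i> * complex_of_real (s * ((\<xi> /\<^sub>R jbracket \<xi>) \<bullet> \<eta>))) =
        freq_integrand \<psi> v U0 U1 s \<eta>"
      by eventually_elim
        (simp add: low_freq_fourier_def freq_integrand_def fourier_l[OF \<psi> _ s] v_def U0_def U1_def)
    have "continuous_on UNIV \<psi>" by (intro smooth_continuous radial_cutoffD(1) \<psi>)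
    then have c1: "continuous_on UNIV (\<lambda>\<eta>. \<psi> ((jbracket s powr (3 / 4)) *\<^sub>R \<eta>))"
      by (rule continuous_on_compose2) (rule linear_continuous_on[OF bounded_linear_scaleR_right], simp)
    have c2: "continuous_on UNIV (fourier (l s))" by (rule fourier_continuous[OF l_integrable[OF s]])
    have c3: "continuous_on UNIV (\<lambda>\<eta>. exp (\<i> * complex_of_real (s * ((\<xi> /\<^sub>R jbracket \<xi>) \<bullet> \<eta>))))"
      by (intro continuous_intros)
    have "continuous_on UNIV (\<lambda>\<eta>. low_freq_fourier \<psi> l s \<eta> * exp (\<i> * complex_of_real (s * ((\<xi> /\<^sub>R jbracket \<xi>) \<bullet> \<eta>))))"
      unfolding low_freq_fourier_def
      by (intro continuous_on_mult continuous_on_of_real c1 c2 c3)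
    then show "(\<lambda>\<eta>. low_freq_fourier \<psi> l s \<eta> * exp (\<i> * complex_of_real (s * ((\<xi> /\<^sub>R jbracket \<xi>) \<bullet> \<eta>)))) \<in> borel_measurable lebesgue"
      by (rule continuous_lebesgue_measurable)
    show "freq_integrand \<psi> v U0 U1 s \<in> borel_measurable lebesgue"
      using freq_integrand_measurable[OF \<psi> U] by (intro measurable_completion) simp
  qed
  \<comment> \<open>For \<open>t \<ge> 1\<close> the oriented integral is a plain one over the open
    interval; the end points carry no mass, and continuity of \<open>I\<close> turns it into a gauge
    integral.\<close>
  have phase: "phase_correction \<psi> l t \<xi> = complex_of_real k * integral {1..t} I" if t: "t \<ge> 1" for t
  proof -
    have "(LINT s=ereal t0..ereal t|lebesgue.
        (LINT \<eta>|lebesgue. low_freq_fourier \<psi> l s \<eta> * exp (\<i> * complex_of_real (s * ((\<xi> /\<^sub>R jbracket \<xi>) \<bullet> \<eta>))))) =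
        set_lebesgue_integral lebesgue {1<..<t} (\<lambda>s. LINT \<eta>|lebesgue. low_freq_fourier \<psi> l s \<eta> * exp (\<i> * complex_of_real (s * ((\<xi> /\<^sub>R jbracket \<xi>) \<bullet> \<eta>))))"
      using t by (simp add: interval_lebesgue_integral_def t0_def)
    also have "\<dots> = set_lebesgue_integral lebesgue {1<..<t} I"
      by (rule set_lebesgue_integral_cong) (use inner in auto)
    also have "\<dots> = integral {1<..<t} I"
    proof (rule set_lebesgue_integral_eq_integral(2))
      have "I absolutely_integrable_on {1..t}" by (rule absolutely_integrable_continuous_real[OF cI])
      then show "I absolutely_integrable_on {1<..<t}" by (rule set_integrable_subset) auto
    qed
    also have "\<dots> = integral {1..t} I" using integral_open_interval_real[of 1 t I] by simp
    finally show ?thesis by (simp add: phase_correction_def k_def)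
  qed
  have le: "k * \<bar>m\<bar> * integral {1..t} g \<le> cmod (phase_correction \<psi> l t \<xi>)" if t: "t \<ge> 1" for t
  proof -
    have Ii: "I integrable_on {1..t}" by (intro integrable_continuous_interval cI)
    have "(g has_integral Re (integral {1..t} I / complex_of_real m)) {1..t}"
      unfolding g_def
      by (rule has_integral_Re[OF has_integral_divide[OF integrable_integral[OF Ii]]])
    then have "integral {1..t} g = Re (integral {1..t} I / complex_of_real m)" by (rule integral_unique)
    also have "\<dots> \<le> cmod (integral {1..t} I / complex_of_real m)" by (rule complex_Re_le_cmod)
    finally have "integral {1..t} g \<le> cmod (integral {1..t} I) / \<bar>m\<bar>" by (simp add: norm_divide)
    then have "k * \<bar>m\<bar> * integral {1..t} g \<le> k * \<bar>m\<bar> * (cmod (integral {1..t} I) / \<bar>m\<bar>)"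
      using k by (intro mult_left_mono) auto
    then show ?thesis using m0 k by (simp add: phase[OF t] norm_mult)
  qed
  have "filterlim (\<lambda>t. k * \<bar>m\<bar> * integral {1..t} g) at_top at_top"
    using k m0 by (intro filterlim_tendsto_pos_mult_at_top[OF tendsto_const]
        log_lower_bound_integral_at_top[OF cg low]) auto
  then show ?thesis
    by (rule filterlim_at_top_mono) (use le in \<open>auto simp: eventually_at_top_linorder intro!: exI[of _ 1]\<close>)
qed

lemma has_data_imp_decaying_wave:
  assumes \<psi>: "radial_cutoff \<psi>" and l: "wave_solution l" and n: "has_data l n0 n1"
    and n0: "in_wsobolev M0 n0" and n1: "in_wsobolev M1 n1" and m: "(LINT x|lebesgue. n1 x) \<noteq> 0"
  shows "decaying_wave l" "(LINT x|lebesgue. dt l 1 x) \<noteq> 0"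
proof -
  interpret classical_wave l by standard (rule l)
  have ae: "AE x in lebesgue. l 1 x = n0 x" "AE x in lebesgue. dt l 1 x = n1 x"
    using n by (auto simp: has_data_def t0_def)
  have meas: "l 1 \<in> borel_measurable lebesgue" "dt l 1 \<in> borel_measurable lebesgue"
    by (intro continuous_lebesgue_measurable cont_slice[of l] cont_slice[of "dt l"] cont_l cont_dt)+
  show "decaying_wave l"
    by standard (rule in_wsobolev_weighted_square_integrable[OF \<psi> n0 ae(1) meas(1)],
        rule in_wsobolev_weighted_square_integrable[OF \<psi> n1 ae(2) meas(2)])
  \<comment> \<open>A nonzero value cannot be the default value 0 of a divergent integral, so
    \<open>n1\<close> is integrable and in particular measurable.\<close>
  have "n1 \<in> borel_measurable lebesgue"
    using m not_integrable_integral_eq by (metis borel_measurable_integrable)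
  then have "(LINT x|lebesgue. dt l 1 x) = (LINT x|lebesgue. n1 x)"
    by (intro integral_cong_AE meas ae)
  then show "(LINT x|lebesgue. dt l 1 x) \<noteq> 0" using m by simp
qed

theorem proposition6p10:
  fixes N :: nat and \<psi> :: "real^2 \<Rightarrow> real"
  assumes "N \<ge> 16"
    and "radial_cutoff \<psi>"
  shows "\<exists>\<epsilon>\<^sub>0>0. \<forall>(\<epsilon>::real) n0 n1 l.
           \<epsilon> \<le> \<epsilon>\<^sub>0 \<longrightarrow>
           in_wsobolev (N + 1) n0 \<longrightarrow>
           in_wsobolev N n1 \<longrightarrow>
           wsobolev_norm (N + 1) n0 + wsobolev_norm N n1 < \<epsilon> \<longrightarrow>
           (LINT x|lebesgue. n1 x) \<noteq> 0 \<longrightarrow>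
           wave_solution l \<longrightarrow>
           has_data l n0 n1 \<longrightarrow>
           (\<forall>\<xi>. filterlim (\<lambda>t. cmod (phase_correction \<psi> l t \<xi>)) at_top at_top)"
proof (intro exI[of _ 1] conjI allI impI)
  fix \<epsilon> :: real and n0 n1 l \<xi>
  assume "in_wsobolev (N + 1) n0" "in_wsobolev N n1" "(LINT x|lebesgue. n1 x) \<noteq> 0" "wave_solution l" "has_data l n0 n1"
  note d = has_data_imp_decaying_wave[OF assms(2) this(4,5,1,2,3)]
  interpret decaying_wave l by (rule d(1))
  show "filterlim (\<lambda>t. cmod (phase_correction \<psi> l t \<xi>)) at_top at_top"
    by (rule phase_correction_at_top[OF assms(2) d(2)])
qed simp

end
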